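(* Let $K$ be a field. There exists a $(0,1)$-polytope $P$ with a flag unimodular triangulation such that its toric ideal $I_P$ over $K$ is generated by quadrics but its toric ring $K[P]$ is not Koszul.
   Context: A $(0,1)$-polytope is a polytope $P=\operatorname{conv}(A)\subset[0,1]^d$ with $A\subset\{0,1\}^d$; then $P\cap\mathbb{Z}^d=A$. For a lattice polytope $P\subset\mathbb{R}^d$ with $A=P\cap\mathbb{Z}^d$, let $S_A=K[x_a:a\in A]$ (standard graded) and let $\varphi_A:S_A\to K[t,z_1^{\pm1},\ldots,z_d^{\pm1}]$ be the $K$-algebra homomorphism $x_a\mapsto t z^a$. The toric ideal of $P$ is $I_P=\ker(\varphi_A)$ and the toric ring is $K[P]=S_A/I_P$. "Generated by quadrics" means generated by homogeneous polynomials of degree two. A standard graded $K$-algebra $R$ is Koszul if the residue field $K$ has a linear minimal graded free resolution over $R$, i.e. the graded Betti numbers satisfy $\beta^R_{i,j}(K)=0$ for $i\ne j$. Triangulations of a lattice polytope use only lattice points as vertices. A triangulation of a $d$-dimensional lattice polytope is unimodular if every maximal simplex has normalized volume one (that is, $d!$ times its Euclidean volume is $1$). It is flag if every minimal nonface has two vertices. *)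

theory Defs
  imports "HOL-Analysis.Analysis" "HOL-Analysis.Finite_Function_Topology" "HOL-Algebra.QuotRing"
begin

section \<open>Lattice polytopes\<close>

text \<open>
  The dimension \<open>d\<close> has to be a natural number that can be quantified over, so \<open>\<int>\<^sup>d\<close> and \<open>\<real>\<^sup>d\<close>
  are the elements of \<open>nat \<Rightarrow>\<^sub>0 int\<close> and of the real vector space \<open>nat \<Rightarrow>\<^sub>0 real\<close> whose keys lie
  in \<open>{..<d}\<close>.
\<close>

definition real_point :: "(nat \<Rightarrow>\<^sub>0 int) \<Rightarrow> (nat \<Rightarrow>\<^sub>0 real)" where
  "real_point a = Poly_Mapping.map real_of_int a"

definition lattice_points :: "nat \<Rightarrow> (nat \<Rightarrow>\<^sub>0 real) set \<Rightarrow> (nat \<Rightarrow>\<^sub>0 int) set" where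
  "lattice_points d P = {a. Poly_Mapping.keys a \<subseteq> {..<d} \<and> real_point a \<in> P}"

definition zero_one_polytope :: "nat \<Rightarrow> (nat \<Rightarrow>\<^sub>0 real) set \<Rightarrow> bool" where
  "zero_one_polytope d P \<longleftrightarrow>
     (\<exists>A. A \<subseteq> {a. Poly_Mapping.keys a \<subseteq> {..<d} \<and> (\<forall>i. Poly_Mapping.lookup a i \<in> {0, 1})} \<and>
          P = convex hull (real_point ` A))"


section \<open>Triangulations\<close>

text \<open>A simplex is represented by its set of vertices.\<close>

definition geometric_simplex :: "(nat \<Rightarrow>\<^sub>0 int) set \<Rightarrow> (nat \<Rightarrow>\<^sub>0 real) set" where
  "geometric_simplex \<sigma> = convex hull (real_point ` \<sigma>)"

definition lattice_triangulation ::
    "nat \<Rightarrow> (nat \<Rightarrow>\<^sub>0 real) set \<Rightarrow> (nat \<Rightarrow>\<^sub>0 int) set set \<Rightarrow> bool" where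
  "lattice_triangulation d P \<Delta> \<longleftrightarrow>
     (\<forall>\<sigma>\<in>\<Delta>. finite \<sigma> \<and> \<sigma> \<subseteq> lattice_points d P \<and> \<not> affine_dependent (real_point ` \<sigma>)) \<and>
     (\<forall>\<sigma>\<in>\<Delta>. \<forall>\<tau>. \<tau> \<subseteq> \<sigma> \<longrightarrow> \<tau> \<in> \<Delta>) \<and>
     (\<forall>\<sigma>\<in>\<Delta>. \<forall>\<tau>\<in>\<Delta>. (geometric_simplex \<sigma> \<inter> geometric_simplex \<tau>) face_of geometric_simplex \<sigma> \<and>
                  (geometric_simplex \<sigma> \<inter> geometric_simplex \<tau>) face_of geometric_simplex \<tau>) \<and>
     (\<Union>\<sigma>\<in>\<Delta>. geometric_simplex \<sigma>) = P"

text \<open>Lebesgue measure on \<open>\<real>\<^sup>d\<close>, as the \<open>d\<close>-fold product of the one-dimensional one.\<close>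

definition euclidean_volume :: "nat \<Rightarrow> (nat \<Rightarrow>\<^sub>0 real) set \<Rightarrow> real" where
  "euclidean_volume d S =
     measure (Pi\<^sub>M {..<d} (\<lambda>_. lborel)) ((\<lambda>x. restrict (Poly_Mapping.lookup x) {..<d}) ` S)"

definition normalized_volume :: "nat \<Rightarrow> (nat \<Rightarrow>\<^sub>0 real) set \<Rightarrow> real" where
  "normalized_volume d S = fact d * euclidean_volume d S"

text \<open>
  For a nonempty triangulation of \<open>P\<close> this forces \<open>P\<close> to be \<open>d\<close>-dimensional, since
  lower-dimensional simplices have volume \<open>0\<close>.
\<close>

definition unimodular :: "nat \<Rightarrow> (nat \<Rightarrow>\<^sub>0 int) set set \<Rightarrow> bool" where
  "unimodular d \<Delta> \<longleftrightarrow>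
     (\<forall>\<sigma>\<in>\<Delta>. (\<forall>\<tau>\<in>\<Delta>. \<not> \<sigma> \<subset> \<tau>) \<longrightarrow> normalized_volume d (geometric_simplex \<sigma>) = 1)"

definition minimal_nonface :: "'v set set \<Rightarrow> 'v set \<Rightarrow> bool" where
  "minimal_nonface \<Delta> N \<longleftrightarrow> N \<subseteq> {v. {v} \<in> \<Delta>} \<and> N \<notin> \<Delta> \<and> (\<forall>M. M \<subset> N \<longrightarrow> M \<in> \<Delta>)"

definition flag :: "'v set set \<Rightarrow> bool" where
  "flag \<Delta> \<longleftrightarrow> (\<forall>N. minimal_nonface \<Delta> N \<longrightarrow> card N = 2)"


section \<open>Toric ideals and toric rings\<close>

text \<open>
  Polynomials and Laurent polynomials are elements of monoid algebras: an element of
  \<open>('v \<Rightarrow>\<^sub>0 nat) \<Rightarrow>\<^sub>0 'k\<close> is a polynomial in variables \<open>x\<^bsub>v\<^esub>\<close>, and an element of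
  \<open>(nat \<times> (nat \<Rightarrow>\<^sub>0 int)) \<Rightarrow>\<^sub>0 'k\<close> is a combination of the monomials \<open>t\<^sup>n z\<^sup>u\<close>, which are
  \<open>Poly_Mapping.single (n, u) 1\<close>.
\<close>

type_synonym ('v, 'k) mpoly = "('v \<Rightarrow>\<^sub>0 nat) \<Rightarrow>\<^sub>0 'k"
type_synonym 'k laurent = "(nat \<times> (nat \<Rightarrow>\<^sub>0 int)) \<Rightarrow>\<^sub>0 'k"

definition mpoly_ring :: "'k::field itself \<Rightarrow> 'v set \<Rightarrow> ('v, 'k) mpoly ring" where
  "mpoly_ring K A =
     \<lparr>carrier = {p. \<forall>m\<in>Poly_Mapping.keys p. Poly_Mapping.keys m \<subseteq> A},
      mult = (*), one = 1, zero = 0, add = (+)\<rparr>"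

definition laurent_ring :: "'k::field itself \<Rightarrow> nat \<Rightarrow> 'k laurent ring" where
  "laurent_ring K d =
     \<lparr>carrier = {f. \<forall>(n, u)\<in>Poly_Mapping.keys f. Poly_Mapping.keys u \<subseteq> {..<d}},
      mult = (*), one = 1, zero = 0, add = (+)\<rparr>"

definition homogeneous_component ::
    "'k::field itself \<Rightarrow> 'v set \<Rightarrow> nat \<Rightarrow> ('v, 'k) mpoly set" where
  "homogeneous_component K A j =
     {p \<in> carrier (mpoly_ring K A).
        \<forall>m\<in>Poly_Mapping.keys p. (\<Sum>v\<in>Poly_Mapping.keys m. Poly_Mapping.lookup m v) = j}"

text \<open>The \<open>K\<close>-algebra homomorphism \<open>x\<^bsub>a\<^esub> \<mapsto> t z\<^sup>a\<close>.\<close>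

definition toric_map :: "(nat \<Rightarrow>\<^sub>0 int, 'k::field) mpoly \<Rightarrow> 'k laurent" where
  "toric_map p =
     (\<Sum>m\<in>Poly_Mapping.keys p. Poly_Mapping.single 0 (Poly_Mapping.lookup p m) *
        (\<Prod>a\<in>Poly_Mapping.keys m. Poly_Mapping.single (1, a) 1 ^ Poly_Mapping.lookup m a))"

definition toric_ideal ::
    "'k::field itself \<Rightarrow> nat \<Rightarrow> (nat \<Rightarrow>\<^sub>0 real) set \<Rightarrow> (nat \<Rightarrow>\<^sub>0 int, 'k) mpoly set" where
  "toric_ideal K d P =
     a_kernel (mpoly_ring K (lattice_points d P)) (laurent_ring K d) toric_map"

definition generated_by_quadrics ::
    "'k::field itself \<Rightarrow> 'v set \<Rightarrow> ('v, 'k) mpoly set \<Rightarrow> bool" where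
  "generated_by_quadrics K A I \<longleftrightarrow>
     (\<exists>Q \<subseteq> homogeneous_component K A 2. I = Idl\<^bsub>mpoly_ring K A\<^esub> Q)"

definition toric_ring ::
    "'k::field itself \<Rightarrow> nat \<Rightarrow> (nat \<Rightarrow>\<^sub>0 real) set \<Rightarrow> (nat \<Rightarrow>\<^sub>0 int, 'k) mpoly set ring" where
  "toric_ring K d P = mpoly_ring K (lattice_points d P) Quot toric_ideal K d P"

text \<open>The degree-\<open>j\<close> component of the toric ring.\<close>

definition toric_grading ::
    "'k::field itself \<Rightarrow> nat \<Rightarrow> (nat \<Rightarrow>\<^sub>0 real) set \<Rightarrow> nat \<Rightarrow> (nat \<Rightarrow>\<^sub>0 int, 'k) mpoly set set" where
  "toric_grading K d P j =
     (\<lambda>p. toric_ideal K d P +>\<^bsub>mpoly_ring K (lattice_points d P)\<^esub> p) `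
       homogeneous_component K (lattice_points d P) j"


section \<open>Koszul algebras\<close>

text \<open>
  Below \<open>R\<close> is a standard graded algebra over a field with homogeneous components
  \<open>G 0, G 1, \<dots>\<close>. As \<open>R\<close> is noetherian, minimal graded free resolutions of finitely
  generated graded modules consist of free modules of finite rank.
\<close>

definition irrelevant_ideal :: "'r ring \<Rightarrow> (nat \<Rightarrow> 'r set) \<Rightarrow> 'r set" where
  "irrelevant_ideal R G = Idl\<^bsub>R\<^esub> (\<Union>j\<in>{0<..}. G j)"

definition free_module :: "'r ring \<Rightarrow> nat \<Rightarrow> (nat \<Rightarrow> 'r) set" where
  "free_module R n = {..<n} \<rightarrow>\<^sub>E carrier R"

text \<open>The linear map \<open>R\<^sup>m \<rightarrow> R\<^sup>n\<close> sending the \<open>k\<close>-th basis vector to the \<open>k\<close>-th row of \<open>M\<close>.\<close>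

definition matrix_map :: "'r ring \<Rightarrow> nat \<Rightarrow> nat \<Rightarrow> (nat \<Rightarrow> nat \<Rightarrow> 'r) \<Rightarrow> (nat \<Rightarrow> 'r) \<Rightarrow> (nat \<Rightarrow> 'r)" where
  "matrix_map R m n M v = (\<lambda>l\<in>{..<n}. \<Oplus>\<^bsub>R\<^esub>k\<in>{..<m}. v k \<otimes>\<^bsub>R\<^esub> M k l)"

text \<open>
  A minimal graded free resolution
  \<open>\<dots> \<rightarrow> F\<^sub>2 \<rightarrow> F\<^sub>1 \<rightarrow> F\<^sub>0 = R \<rightarrow> K \<rightarrow> 0\<close> of the residue field \<open>K = R / R\<^sub>+\<close>: the free module
  \<open>F\<^bsub>i\<^esub>\<close> has \<open>b i\<close> basis elements, the \<open>k\<close>-th one in degree \<open>e i k\<close>, and \<open>D i\<close> is the matrix of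
  \<open>F\<^bsub>i+1\<^esub> \<rightarrow> F\<^bsub>i\<^esub>\<close>. The differentials are homogeneous of degree \<open>0\<close>; minimality means that
  \<open>F\<^bsub>i+1\<^esub>\<close> is mapped into \<open>R\<^sub>+ F\<^bsub>i\<^esub>\<close>.
\<close>

definition minimal_graded_free_resolution ::
    "'r ring \<Rightarrow> (nat \<Rightarrow> 'r set) \<Rightarrow> (nat \<Rightarrow> nat) \<Rightarrow> (nat \<Rightarrow> nat \<Rightarrow> nat) \<Rightarrow>
     (nat \<Rightarrow> nat \<Rightarrow> nat \<Rightarrow> 'r) \<Rightarrow> bool" where
  "minimal_graded_free_resolution R G b e D \<longleftrightarrow>
     b 0 = 1 \<and> e 0 0 = 0 \<and>
     (\<forall>i. \<forall>k<b (Suc i). \<forall>l<b i.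
        D i k l \<in> (if e i l \<le> e (Suc i) k then G (e (Suc i) k - e i l) else {\<zero>\<^bsub>R\<^esub>})) \<and>
     (\<forall>i. \<forall>k<b (Suc i). \<forall>l<b i. D i k l \<in> irrelevant_ideal R G) \<and>
     matrix_map R (b 1) (b 0) (D 0) ` free_module R (b 1) =
       {v \<in> free_module R (b 0). v 0 \<in> irrelevant_ideal R G} \<and>
     (\<forall>i. matrix_map R (b (Suc (Suc i))) (b (Suc i)) (D (Suc i)) ` free_module R (b (Suc (Suc i))) =
       {v \<in> free_module R (b (Suc i)).
          matrix_map R (b (Suc i)) (b i) (D i) v = (\<lambda>l\<in>{..<b i}. \<zero>\<^bsub>R\<^esub>)})"

definition betti_number :: "(nat \<Rightarrow> nat) \<Rightarrow> (nat \<Rightarrow> nat \<Rightarrow> nat) \<Rightarrow> nat \<Rightarrow> nat \<Rightarrow> nat" where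
  "betti_number b e i j = card {k. k < b i \<and> e i k = j}"

definition koszul :: "'r ring \<Rightarrow> (nat \<Rightarrow> 'r set) \<Rightarrow> bool" where
  "koszul R G \<longleftrightarrow>
     (\<exists>b e D. minimal_graded_free_resolution R G b e D \<and>
        (\<forall>i j. i \<noteq> j \<longrightarrow> betti_number b e i j = 0))"

end

theory Submission
  imports Defs
begin

text \<open>
  The polytope is the convex hull of 15 vertices of the cube \<open>[0,1]\<^sup>5\<close>.

  \<^bold>\<open>Triangulation.\<close> The complex consists of all sets of vertices that contain none of 25 forbidden
  pairs, so it is flag by construction. It is a triangulation because every point of the polytope is a
  convex combination of the vertices of exactly one such set. Existence: a decision tree on linear
  inequalities assigns to each point one of 41 simplices whose barycentric coordinates are
  nonnegative there (\<open>locate_correct\<close>). Uniqueness: the difference of two representations is an affine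
  dependence whose positive and negative parts avoid the forbidden pairs, and linear arithmetic shows
  that only the zero dependence does so (\<open>unique_difference\<close>). Uniqueness gives affine independence and
  the face-to-face property, for any such complex (\<open>lattice_triangulationI\<close>). The barycentric
  coordinates of the 41 simplices have integer coefficients, so the edge matrices are invertible over
  \<open>\<int>\<close> and the volumes are \<open>1 / 5!\<close> (\<open>normalized_volume_simplex\<close>).

  \<^bold>\<open>Quadrics.\<close> For a suitable weight on the variables, the toric ideal has a Groebner basis of 25
  quadrics and a single cubic. A monomial divisible by no leading monomial is determined by its image
  under the toric map (\<open>unique_standard\<close>, again linear arithmetic), and the cubic is a consequence of
  the quadrics; hence any two monomials with the same image are congruent modulo the quadrics.

  \<^bold>\<open>Koszulness.\<close> The toric ring is the algebra of the monoid \<open>M\<close> generated by the points \<open>(1, a)\<close>, and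
  \<open>Tor\<^sub>3(K, K)\<close> in the multidegree of an element \<open>\<Lambda>\<close> of degree 4 is the first homology of the open
  interval \<open>(0, \<Lambda>)\<close> of \<open>M\<close> ordered by divisibility. The ring is not Koszul because that homology is
  nonzero for \<open>\<Lambda> = (4; 2, 3, 1, 1, 1)\<close>. The criterion \<open>not_koszul_criterion\<close> is the elementary form of
  this: a one-cocycle on the interval becomes a functional on the second module of a linear
  resolution; it vanishes on the image of the third module, but a cycle in the interval that pairs
  nontrivially with the cocycle produces an element of the kernel on which the functional is nonzero.
  Cocycle and pairing are integral with value 1, so the characteristic of \<open>K\<close> does not matter.

  A regular flag unimodular triangulation would make the ring Koszul through a quadratic Groebner
  basis, so the triangulation here is necessarily not regular.
\<close>

section \<open>Monomials and the toric map\<close>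

text \<open>
  The exponent \<open>(n, u)\<close> of the image \<open>t\<^sup>n z\<^sup>u\<close> of a monomial under the toric map; multiplication by
  \<open>of_nat k\<close> in the ring \<open>nat \<Rightarrow>\<^sub>0 int\<close> is the \<open>k\<close>-fold sum.
\<close>

definition toric_exponent :: "((nat \<Rightarrow>\<^sub>0 int) \<Rightarrow>\<^sub>0 nat) \<Rightarrow> nat \<times> (nat \<Rightarrow>\<^sub>0 int)" where
  "toric_exponent m =
     (\<Sum>a\<in>Poly_Mapping.keys m. (Poly_Mapping.lookup m a, of_nat (Poly_Mapping.lookup m a) * a))"

lemma sum_single_lookup: "(\<Sum>k\<in>Poly_Mapping.keys p. Poly_Mapping.single k (Poly_Mapping.lookup p k)) = p"
proof (rule poly_mapping_eqI)
  fix k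
  have "Poly_Mapping.lookup (\<Sum>k\<in>Poly_Mapping.keys p. Poly_Mapping.single k (Poly_Mapping.lookup p k)) k
      = (\<Sum>j\<in>Poly_Mapping.keys p. if j = k then Poly_Mapping.lookup p k else 0)"
    unfolding lookup_sum by (intro sum.cong) (auto simp: lookup_single)
  also have "\<dots> = Poly_Mapping.lookup p k"
    by (auto simp: in_keys_iff)
  finally show "Poly_Mapping.lookup (\<Sum>k\<in>Poly_Mapping.keys p. Poly_Mapping.single k (Poly_Mapping.lookup p k)) k
      = Poly_Mapping.lookup p k" .
qed

lemma single_power: "Poly_Mapping.single (n, a) (1::'k::comm_semiring_1) ^ k =
    Poly_Mapping.single (k * n, of_nat k * a) 1"
  for a :: "nat \<Rightarrow>\<^sub>0 int"
  by (induction k) (auto simp: mult_single algebra_simps zero_prod_def[symmetric])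

lemma prod_single: "(\<Prod>a\<in>S. Poly_Mapping.single (f a) (1::'k::comm_semiring_1)) =
    Poly_Mapping.single (\<Sum>a\<in>S. f a :: 'a::comm_monoid_add) 1"
  by (induction S rule: infinite_finite_induct) (auto simp: mult_single)

lemma toric_map_eq:
  "toric_map p = (\<Sum>m\<in>Poly_Mapping.keys p. Poly_Mapping.single (toric_exponent m) (Poly_Mapping.lookup p m))"
  unfolding toric_map_def toric_exponent_def
  by (intro sum.cong refl) (simp add: single_power prod_single mult_single)

lemma toric_map_superset:
  assumes "finite S" "Poly_Mapping.keys p \<subseteq> S"
  shows "toric_map p = (\<Sum>m\<in>S. Poly_Mapping.single (toric_exponent m) (Poly_Mapping.lookup p m))"
  unfolding toric_map_eq
  by (rule sum.mono_neutral_left) (use assms in \<open>auto simp: in_keys_iff\<close>)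

lemma toric_exponent_superset:
  assumes "finite S" "Poly_Mapping.keys m \<subseteq> S"
  shows "toric_exponent m = (\<Sum>a\<in>S. (Poly_Mapping.lookup m a, of_nat (Poly_Mapping.lookup m a) * a))"
  unfolding toric_exponent_def
  by (rule sum.mono_neutral_left) (use assms in \<open>auto simp: in_keys_iff zero_prod_def\<close>)

lemma toric_exponent_add: "toric_exponent (m + m') = toric_exponent m + toric_exponent m'"
proof -
  let ?S = "Poly_Mapping.keys m \<union> Poly_Mapping.keys m'"
  have "Poly_Mapping.keys (m + m') \<subseteq> ?S"
    by (rule keys_add)
  then show ?thesis
    by (simp add: toric_exponent_superset[of ?S] sum.distrib[symmetric] lookup_add algebra_simps)
qed

lemma toric_exponent_zero [simp]: "toric_exponent 0 = 0"
  by (simp add: toric_exponent_def)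

lemma toric_exponent_single [simp]: "toric_exponent (Poly_Mapping.single a k) = (k, of_nat k * a)"
  by (cases "k = 0") (auto simp: toric_exponent_def zero_prod_def)

lemma fst_toric_exponent: "fst (toric_exponent m) = (\<Sum>a\<in>Poly_Mapping.keys m. Poly_Mapping.lookup m a)"
  by (simp add: toric_exponent_def fst_sum)

lemma toric_map_add: "toric_map (p + q) = toric_map p + toric_map q"
proof -
  let ?S = "Poly_Mapping.keys p \<union> Poly_Mapping.keys q"
  have "Poly_Mapping.keys (p + q) \<subseteq> ?S"
    by (rule keys_add)
  then show ?thesis
    by (simp add: toric_map_superset[of ?S] sum.distrib[symmetric] lookup_add single_add)
qed

lemma toric_map_zero [simp]: "toric_map 0 = 0"
  by (simp add: toric_map_eq)

lemma toric_map_single [simp]: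
  "toric_map (Poly_Mapping.single m c) = Poly_Mapping.single (toric_exponent m) c"
  by (cases "c = 0") (auto simp: toric_map_eq)

lemma toric_map_sum: "toric_map (sum f S) = (\<Sum>x\<in>S. toric_map (f x))"
  by (induction S rule: infinite_finite_induct) (auto simp: toric_map_add)

lemma toric_map_mult: "toric_map (p * q) = toric_map p * toric_map q"
proof -
  have "toric_map (p * q) =
      toric_map ((\<Sum>m\<in>Poly_Mapping.keys p. Poly_Mapping.single m (Poly_Mapping.lookup p m)) *
                 (\<Sum>m\<in>Poly_Mapping.keys q. Poly_Mapping.single m (Poly_Mapping.lookup q m)))"
    by (simp only: sum_single_lookup)
  also have "\<dots> = toric_map p * toric_map q"
    by (simp add: sum_product toric_map_sum mult_single toric_exponent_add toric_map_eq[of p] toric_map_eq[of q])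
  finally show ?thesis .
qed

lemma toric_map_one [simp]: "toric_map 1 = 1"
  by (simp flip: single_one)

text \<open>
  A polynomial lies in the toric ideal iff its coefficients sum to zero over each fibre of the
  exponent map; this is the form in which membership is used.
\<close>

lemma lookup_toric_map:
  "Poly_Mapping.lookup (toric_map p) z =
     (\<Sum>m\<in>{m\<in>Poly_Mapping.keys p. toric_exponent m = z}. Poly_Mapping.lookup p m)"
proof -
  have "Poly_Mapping.lookup (toric_map p) z =
      (\<Sum>m\<in>Poly_Mapping.keys p. if toric_exponent m = z then Poly_Mapping.lookup p m else 0)"
    unfolding toric_map_eq lookup_sum by (intro sum.cong) (auto simp: lookup_single)
  then show ?thesis
    by (simp add: sum.inter_filter)
qed

lemma cring_mpoly_ring: "cring (mpoly_ring K A)"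
proof (rule cringI)
  have cl: "p + q \<in> carrier (mpoly_ring K A)" "- p \<in> carrier (mpoly_ring K A)"
    if "p \<in> carrier (mpoly_ring K A)" "q \<in> carrier (mpoly_ring K A)" for p q :: "('a, 'b) mpoly"
    using that keys_add[of p q] by (fastforce simp: mpoly_ring_def in_keys_iff)+
  show "abelian_group (mpoly_ring K A)"
  proof (rule abelian_groupI)
    fix x assume x: "x \<in> carrier (mpoly_ring K A)"
    show "\<exists>y\<in>carrier (mpoly_ring K A). y \<oplus>\<^bsub>mpoly_ring K A\<^esub> x = \<zero>\<^bsub>mpoly_ring K A\<^esub>"
      by (rule bexI[of _ "- x"]) (use cl[OF x x] in \<open>auto simp: mpoly_ring_def\<close>)
  next
    fix x y assume "x \<in> carrier (mpoly_ring K A)" "y \<in> carrier (mpoly_ring K A)"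
    then show "x \<oplus>\<^bsub>mpoly_ring K A\<^esub> y \<in> carrier (mpoly_ring K A)"
      using cl(1)[of x y] by (simp add: mpoly_ring_def)
  qed (auto simp: mpoly_ring_def algebra_simps)
  have "x * y \<in> carrier (mpoly_ring K A)"
    if "x \<in> carrier (mpoly_ring K A)" "y \<in> carrier (mpoly_ring K A)" for x y :: "('a, 'b) mpoly"
  proof -
    have "Poly_Mapping.keys m \<subseteq> A" if m: "m \<in> Poly_Mapping.keys (x * y)" for m
    proof -
      obtain a b where "m = a + b" "a \<in> Poly_Mapping.keys x" "b \<in> Poly_Mapping.keys y"
        using keys_mult[of x y] m by blast
      then show ?thesis
        using keys_add[of a b] \<open>x \<in> _\<close> \<open>y \<in> _\<close> by (fastforce simp: mpoly_ring_def)
    qed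
    then show ?thesis by (simp add: mpoly_ring_def)
  qed
  note mult_closed = this
  show "comm_monoid (mpoly_ring K A)"
  proof (rule comm_monoidI)
    fix x y assume "x \<in> carrier (mpoly_ring K A)" "y \<in> carrier (mpoly_ring K A)"
    then show "x \<otimes>\<^bsub>mpoly_ring K A\<^esub> y \<in> carrier (mpoly_ring K A)"
      using mult_closed[of x y] by (simp add: mpoly_ring_def)
  qed (auto simp: mpoly_ring_def mult_ac)
qed (auto simp: mpoly_ring_def algebra_simps)

lemma ring_laurent_ring: "ring (laurent_ring K d)"
proof (rule ringI)
  have car: "f \<in> carrier (laurent_ring K d) \<longleftrightarrow> (\<forall>z\<in>Poly_Mapping.keys f. Poly_Mapping.keys (snd z) \<subseteq> {..<d})"
    for f :: "'a laurent"
    by (auto simp: laurent_ring_def split_beta)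
  have cl: "p + q \<in> carrier (laurent_ring K d)" "- p \<in> carrier (laurent_ring K d)"
    if "p \<in> carrier (laurent_ring K d)" "q \<in> carrier (laurent_ring K d)" for p q :: "'a laurent"
    using that keys_add[of p q] unfolding car by (auto simp: in_keys_iff)+
  show "abelian_group (laurent_ring K d)"
  proof (rule abelian_groupI)
    fix x assume x: "x \<in> carrier (laurent_ring K d)"
    show "\<exists>y\<in>carrier (laurent_ring K d). y \<oplus>\<^bsub>laurent_ring K d\<^esub> x = \<zero>\<^bsub>laurent_ring K d\<^esub>"
      by (rule bexI[of _ "- x"]) (use cl[OF x x] in \<open>auto simp: laurent_ring_def\<close>)
  next
    fix x y assume "x \<in> carrier (laurent_ring K d)" "y \<in> carrier (laurent_ring K d)"
    then show "x \<oplus>\<^bsub>laurent_ring K d\<^esub> y \<in> carrier (laurent_ring K d)"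
      using cl(1)[of x y] by (simp add: laurent_ring_def)
  qed (auto simp: laurent_ring_def algebra_simps)
  have "x * y \<in> carrier (laurent_ring K d)"
    if "x \<in> carrier (laurent_ring K d)" "y \<in> carrier (laurent_ring K d)" for x y :: "'a laurent"
  proof -
    have "Poly_Mapping.keys (snd m) \<subseteq> {..<d}" if m: "m \<in> Poly_Mapping.keys (x * y)" for m
    proof -
      obtain a b where "m = a + b" "a \<in> Poly_Mapping.keys x" "b \<in> Poly_Mapping.keys y"
        using keys_mult[of x y] m by blast
      then show ?thesis
        using keys_add[of "snd a" "snd b"] \<open>x \<in> _\<close> \<open>y \<in> _\<close> unfolding car by fastforce
    qed
    then show ?thesis by (simp add: car)
  qed
  note mult_closed = this
  show "Group.monoid (laurent_ring K d)"
  proof (rule monoidI)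
    fix x y assume "x \<in> carrier (laurent_ring K d)" "y \<in> carrier (laurent_ring K d)"
    then show "x \<otimes>\<^bsub>laurent_ring K d\<^esub> y \<in> carrier (laurent_ring K d)"
      using mult_closed[of x y] by (simp add: laurent_ring_def)
  next
    have "(1 :: 'a laurent) \<in> carrier (laurent_ring K d)"
      by (simp add: car)
    then show "\<one>\<^bsub>laurent_ring K d\<^esub> \<in> carrier (laurent_ring K d)"
      by (simp add: laurent_ring_def)
  qed (simp_all add: laurent_ring_def mult_ac)
qed (auto simp: laurent_ring_def algebra_simps)

lemma toric_map_hom:
  assumes "A \<subseteq> {a. Poly_Mapping.keys a \<subseteq> {..<d}}"
  shows "ring_hom_ring (mpoly_ring K A) (laurent_ring K d) toric_map"
proof (rule ring_hom_ringI)
  show "ring (mpoly_ring K A)"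
    using cring_mpoly_ring by (rule cring.axioms)
  show "ring (laurent_ring K d)"
    by (rule ring_laurent_ring)
next
  fix p assume p: "p \<in> carrier (mpoly_ring K A)"
  have "Poly_Mapping.keys (snd z) \<subseteq> {..<d}" if z: "z \<in> Poly_Mapping.keys (toric_map p)" for z
  proof -
    obtain m where m: "m \<in> Poly_Mapping.keys p" "toric_exponent m = z"
    proof -
      have "(\<Sum>m\<in>{m\<in>Poly_Mapping.keys p. toric_exponent m = z}. Poly_Mapping.lookup p m) \<noteq> 0"
        using z by (simp only: in_keys_iff lookup_toric_map simp_thms)
      then have "{m\<in>Poly_Mapping.keys p. toric_exponent m = z} \<noteq> {}"
        by (metis sum.empty)
      then show ?thesis using that by blast
    qed
    have snd_z: "snd z = (\<Sum>a\<in>Poly_Mapping.keys m. of_nat (Poly_Mapping.lookup m a) * a)"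
      unfolding m(2)[symmetric] toric_exponent_def by (simp add: snd_sum)
    have "Poly_Mapping.keys (of_nat k * a) \<subseteq> {..<d}" if "a \<in> Poly_Mapping.keys m" for a k
    proof -
      have "a \<in> A" using p m that by (auto simp: mpoly_ring_def)
      then have "Poly_Mapping.keys a \<subseteq> {..<d}" using assms by auto
      then show ?thesis
      proof (induction k)
        case (Suc k)
        then show ?case using keys_add[of a "of_nat k * a"] by (auto simp: algebra_simps)
      qed auto
    qed
    note summand = this
    have "finite S \<Longrightarrow> S \<subseteq> Poly_Mapping.keys m \<Longrightarrow>
        Poly_Mapping.keys (\<Sum>a\<in>S. of_nat (Poly_Mapping.lookup m a) * a) \<subseteq> {..<d}" for S
    proof (induction S rule: finite_induct)
      case (insert x S)
      then show ?case
        using summand[of x "Poly_Mapping.lookup m x"]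
          keys_add[of "of_nat (Poly_Mapping.lookup m x) * x" "\<Sum>a\<in>S. of_nat (Poly_Mapping.lookup m a) * a"]
        by auto
    qed auto
    from this[OF finite_keys order_refl] show ?thesis unfolding snd_z .
  qed
  then show "toric_map p \<in> carrier (laurent_ring K d)"
    by (auto simp: laurent_ring_def) (metis subsetD snd_conv lessThan_iff)
qed (auto simp: mpoly_ring_def laurent_ring_def toric_map_add toric_map_mult)

section \<open>The toric ring as a subring of the Laurent polynomial ring\<close>

lemma lookup_mult_single:
  fixes f :: "'a::cancel_comm_monoid_add \<Rightarrow>\<^sub>0 'k::semiring_0"
  shows "Poly_Mapping.lookup (f * Poly_Mapping.single k c) (z + k) = Poly_Mapping.lookup f z * c"
proof -
  have "f * Poly_Mapping.single k c =
      (\<Sum>j\<in>Poly_Mapping.keys f. Poly_Mapping.single j (Poly_Mapping.lookup f j)) * Poly_Mapping.single k c"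
    by (simp only: sum_single_lookup)
  also have "\<dots> = (\<Sum>j\<in>Poly_Mapping.keys f. Poly_Mapping.single (j + k) (Poly_Mapping.lookup f j * c))"
    by (simp add: sum_distrib_right mult_single)
  finally have "Poly_Mapping.lookup (f * Poly_Mapping.single k c) (z + k) =
      (\<Sum>j\<in>Poly_Mapping.keys f. if j = z then Poly_Mapping.lookup f z * c else 0)"
    by (simp add: lookup_sum lookup_single when_def cong: if_cong)
  then show ?thesis
    by (auto simp: in_keys_iff)
qed

text \<open>
  The toric ring is handled through the injective homomorphism \<open>ev\<close> into Laurent polynomials, so that
  identities between cosets become identities between coefficients.
\<close>

locale toric =
  fixes K :: "'k::field itself" and d :: nat and P :: "(nat \<Rightarrow>\<^sub>0 real) set"
  assumes finite_points: "finite (lattice_points d P)"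
begin

abbreviation "A \<equiv> lattice_points d P"
abbreviation "S \<equiv> mpoly_ring K A"
abbreviation "I \<equiv> toric_ideal K d P"
abbreviation "R \<equiv> toric_ring K d P"
abbreviation "G \<equiv> toric_grading K d P"

definition ev :: "(nat \<Rightarrow>\<^sub>0 int, 'k) mpoly set \<Rightarrow> 'k laurent" where
  "ev X = the_elem (toric_map ` X)"

lemma points_keys: "A \<subseteq> {a. Poly_Mapping.keys a \<subseteq> {..<d}}"
  by (auto simp: lattice_points_def)

sublocale hom: ring_hom_ring S "laurent_ring K d" toric_map
  by (rule toric_map_hom[OF points_keys])

lemma I_ideal: "ideal I S"
  unfolding toric_ideal_def by (rule hom.kernel_is_ideal)

sublocale R: ring R
  unfolding toric_ring_def by (rule ideal.quotient_is_ring[OF I_ideal])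

lemma ev_ring_hom: "ev \<in> ring_hom R (laurent_ring K d)"
  using hom.the_elem_hom unfolding ev_def[abs_def] toric_ring_def toric_ideal_def .

lemma ev_coset: "p \<in> carrier S \<Longrightarrow> ev (I +>\<^bsub>S\<^esub> p) = toric_map p"
  unfolding ev_def toric_ideal_def by (rule hom.the_elem_simp)

lemma coset_in_R: "p \<in> carrier S \<Longrightarrow> I +>\<^bsub>S\<^esub> p \<in> carrier R"
  unfolding toric_ring_def by (rule ring_hom_closed[OF ideal.rcos_ring_hom[OF I_ideal]])

lemma R_cases:
  assumes "X \<in> carrier R"
  obtains p where "p \<in> carrier S" "X = I +>\<^bsub>S\<^esub> p"
  using assms unfolding toric_ring_def FactRing_def A_RCOSETS_def' by auto

lemma ev_inj: "X \<in> carrier R \<Longrightarrow> Y \<in> carrier R \<Longrightarrow> ev X = ev Y \<Longrightarrow> X = Y"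
  using hom.the_elem_inj unfolding ev_def toric_ring_def toric_ideal_def by blast

lemma ev_add: "X \<in> carrier R \<Longrightarrow> Y \<in> carrier R \<Longrightarrow> ev (X \<oplus>\<^bsub>R\<^esub> Y) = ev X + ev Y"
  using ring_hom_add[OF ev_ring_hom] by (simp add: laurent_ring_def)

lemma ev_mult: "X \<in> carrier R \<Longrightarrow> Y \<in> carrier R \<Longrightarrow> ev (X \<otimes>\<^bsub>R\<^esub> Y) = ev X * ev Y"
  using ring_hom_mult[OF ev_ring_hom] by (simp add: laurent_ring_def)

lemma ev_one: "ev \<one>\<^bsub>R\<^esub> = 1"
  using ring_hom_one[OF ev_ring_hom] by (simp add: laurent_ring_def)

lemma ev_zero: "ev \<zero>\<^bsub>R\<^esub> = 0"
  using ev_add[OF R.zero_closed R.zero_closed] by simp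

lemma ev_minus: "X \<in> carrier R \<Longrightarrow> Y \<in> carrier R \<Longrightarrow> ev (X \<ominus>\<^bsub>R\<^esub> Y) = ev X - ev Y"
  using ev_add[of "X \<ominus>\<^bsub>R\<^esub> Y" Y] by (simp add: R.minus_eq R.a_assoc R.l_neg)

lemma ev_finsum:
  "f \<in> J \<rightarrow> carrier R \<Longrightarrow> finite J \<Longrightarrow> ev (\<Oplus>\<^bsub>R\<^esub>k\<in>J. f k) = (\<Sum>k\<in>J. ev (f k))"
proof (induction J rule: infinite_finite_induct)
  case (insert x J)
  then have "f x \<in> carrier R" "f \<in> J \<rightarrow> carrier R" by auto
  with insert show ?case
    by (simp add: R.finsum_insert ev_add R.finsum_closed)
qed (auto simp: ev_zero)

lemma ev_matrix_map:
  assumes "v \<in> free_module R m" "\<And>k. k < m \<Longrightarrow> M k l \<in> carrier R" "l < n"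
  shows "ev (matrix_map R m n M v l) = (\<Sum>k<m. ev (v k) * ev (M k l))"
proof -
  have "v k \<in> carrier R" if "k < m" for k
    using assms(1) that by (auto simp: free_module_def)
  with assms(2,3) show ?thesis
    by (simp add: matrix_map_def ev_finsum Pi_def ev_mult)
qed

lemma matrix_map_eqI:
  assumes "v \<in> free_module R m" "\<And>k l. k < m \<Longrightarrow> l < n \<Longrightarrow> M k l \<in> carrier R" "w \<in> free_module R n"
    and "\<And>l. l < n \<Longrightarrow> (\<Sum>k<m. ev (v k) * ev (M k l)) = ev (w l)"
  shows "matrix_map R m n M v = w"
proof
  fix l
  show "matrix_map R m n M v l = w l"
  proof (cases "l < n")
    case True
    have "v k \<in> carrier R" if "k < m" for k
      using assms(1) that by (auto simp: free_module_def)
    then have "matrix_map R m n M v l \<in> carrier R"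
      using True assms(2) by (auto simp: matrix_map_def intro!: R.finsum_closed)
    moreover have "w l \<in> carrier R"
      using assms(3) True by (auto simp: free_module_def)
    ultimately show ?thesis
      using ev_matrix_map[of v m M l n, OF assms(1) _ True] assms(2)[OF _ True] assms(4)[OF True]
      by (intro ev_inj) simp_all
  next
    case False
    then have "w l = undefined"
      using assms(3) unfolding free_module_def by (intro PiE_arb) auto
    with False show ?thesis
      by (simp add: matrix_map_def)
  qed
qed

subsection \<open>Supports\<close>

text \<open>
  The monoid generated by the points \<open>(1, a)\<close>, which carries the supports of the elements of the ring.
  In degrees 0 and 1 it contains only the origin and the generators.
\<close>

definition semigroup :: "(nat \<times> (nat \<Rightarrow>\<^sub>0 int)) set" where
  "semigroup = toric_exponent ` {m. Poly_Mapping.keys m \<subseteq> A}"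

lemma semigroup_0: "(0, u) \<in> semigroup \<Longrightarrow> u = 0"
proof -
  assume "(0, u) \<in> semigroup"
  then obtain m where m: "toric_exponent m = (0, u)"
    by (auto simp: semigroup_def)
  then have "(\<Sum>a\<in>Poly_Mapping.keys m. Poly_Mapping.lookup m a) = 0"
    by (metis fst_conv fst_toric_exponent)
  then have "Poly_Mapping.keys m = {}"
    by (metis equals0I finite_keys in_keys_iff sum_eq_0_iff)
  with m show "u = 0"
    by (simp add: toric_exponent_def zero_prod_def)
qed

lemma semigroup_1: "(1, u) \<in> semigroup \<Longrightarrow> u \<in> A"
proof -
  assume "(1, u) \<in> semigroup"
  then obtain m where m: "toric_exponent m = (1, u)" "Poly_Mapping.keys m \<subseteq> A"
    by (auto simp: semigroup_def)
  then have sum: "(\<Sum>a\<in>Poly_Mapping.keys m. Poly_Mapping.lookup m a) = 1"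
    by (metis fst_conv fst_toric_exponent)
  then obtain a where a: "a \<in> Poly_Mapping.keys m"
    by (metis ex_in_conv sum.empty zero_neq_one)
  have "toric_exponent m = (\<Sum>b\<in>Poly_Mapping.keys m. if b = a then (1, a) else 0)"
    unfolding toric_exponent_def
  proof (rule sum.cong)
    fix b assume b: "b \<in> Poly_Mapping.keys m"
    have "(\<Sum>b\<in>Poly_Mapping.keys m - {a}. Poly_Mapping.lookup m b) + Poly_Mapping.lookup m a = 1"
      using sum a by (simp add: sum.remove[of _ a])
    moreover have "Poly_Mapping.lookup m a \<noteq> 0"
      using a by (simp add: in_keys_iff)
    ultimately have "Poly_Mapping.lookup m a = 1" "(\<Sum>b\<in>Poly_Mapping.keys m - {a}. Poly_Mapping.lookup m b) = 0"
      by linarith+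
    then have "Poly_Mapping.lookup m a = 1" "\<forall>b\<in>Poly_Mapping.keys m - {a}. Poly_Mapping.lookup m b = 0"
      by (simp_all only: sum_eq_0_iff finite_Diff finite_keys)
    then show "(Poly_Mapping.lookup m b, of_nat (Poly_Mapping.lookup m b) * b) = (if b = a then (1, a) else 0)"
      using b by (auto simp: zero_prod_def)
  qed simp
  then have "toric_exponent m = (1, a)"
    using a by simp
  with m a show "u \<in> A" by auto
qed

lemma keys_ev:
  assumes "X \<in> carrier R" shows "Poly_Mapping.keys (ev X) \<subseteq> semigroup"
proof
  fix z assume z: "z \<in> Poly_Mapping.keys (ev X)"
  obtain p where p: "p \<in> carrier S" "X = I +>\<^bsub>S\<^esub> p"
    using assms by (rule R_cases)
  have "(\<Sum>m\<in>{m\<in>Poly_Mapping.keys p. toric_exponent m = z}. Poly_Mapping.lookup p m) \<noteq> 0"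
    using z p by (simp only: ev_coset in_keys_iff lookup_toric_map simp_thms)
  then have "{m\<in>Poly_Mapping.keys p. toric_exponent m = z} \<noteq> {}"
    by (metis sum.empty)
  then show "z \<in> semigroup"
    using p(1) by (auto simp: semigroup_def mpoly_ring_def)
qed

lemma G_carrier: "X \<in> G j \<Longrightarrow> X \<in> carrier R"
  unfolding toric_grading_def homogeneous_component_def using coset_in_R by auto

lemma ev_G:
  assumes "X \<in> G j" shows "Poly_Mapping.keys (ev X) \<subseteq> {z. fst z = j}"
proof
  fix z assume z: "z \<in> Poly_Mapping.keys (ev X)"
  obtain p where p: "p \<in> homogeneous_component K A j" "X = I +>\<^bsub>S\<^esub> p"
    using assms unfolding toric_grading_def by auto
  then have pS: "p \<in> carrier S" by (simp add: homogeneous_component_def)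
  have "(\<Sum>m\<in>{m\<in>Poly_Mapping.keys p. toric_exponent m = z}. Poly_Mapping.lookup p m) \<noteq> 0"
    using z pS unfolding p(2) by (simp only: ev_coset in_keys_iff lookup_toric_map simp_thms)
  then have "{m\<in>Poly_Mapping.keys p. toric_exponent m = z} \<noteq> {}"
    by (metis sum.empty)
  then show "z \<in> {z. fst z = j}"
    using p(1) by (auto simp: homogeneous_component_def fst_toric_exponent)
qed

definition var :: "(nat \<Rightarrow>\<^sub>0 int) \<Rightarrow> (nat \<Rightarrow>\<^sub>0 int, 'k) mpoly set" where
  "var a = I +>\<^bsub>S\<^esub> Poly_Mapping.single (Poly_Mapping.single a 1) 1"

lemma var_mpoly:
  "a \<in> A \<Longrightarrow> Poly_Mapping.single (Poly_Mapping.single a 1) (1::'k) \<in> homogeneous_component K A 1"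
  by (auto simp: homogeneous_component_def mpoly_ring_def)

lemma var_G: "a \<in> A \<Longrightarrow> var a \<in> G 1"
  unfolding var_def toric_grading_def using var_mpoly by blast

lemma var_R: "a \<in> A \<Longrightarrow> var a \<in> carrier R"
  using var_G G_carrier by blast

lemma ev_var: "a \<in> A \<Longrightarrow> ev (var a) = Poly_Mapping.single (1, a) 1"
  unfolding var_def using var_mpoly[of a] by (subst ev_coset) (auto simp: homogeneous_component_def)

lemma var_irrelevant: "a \<in> A \<Longrightarrow> var a \<in> irrelevant_ideal R G"
proof -
  assume a: "a \<in> A"
  have "(\<Union>j\<in>{0<..}. G j) \<subseteq> irrelevant_ideal R G"
    unfolding irrelevant_ideal_def by (rule R.genideal_self) (use G_carrier in auto)
  moreover have "var a \<in> (\<Union>j\<in>{0<..}. G j)"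
    using var_G[OF a] by force
  ultimately show ?thesis by blast
qed

end

section \<open>An obstruction to Koszulness in degree four\<close>

context toric
begin

lemma lookup_mult_linear:
  assumes u: "Poly_Mapping.keys u \<subseteq> Pair 1 ` A"
  shows "Poly_Mapping.lookup (f * u) (Suc n, v) =
    (\<Sum>a\<in>A. Poly_Mapping.lookup f (n, v - a) * Poly_Mapping.lookup u (1, a))"
proof -
  have "u = (\<Sum>k\<in>Pair 1 ` A. Poly_Mapping.single k (Poly_Mapping.lookup u k))"
    by (subst sum_single_lookup[of u, symmetric], rule sum.mono_neutral_left)
       (use u finite_points in \<open>auto simp: in_keys_iff\<close>)
  also have "\<dots> = (\<Sum>a\<in>A. Poly_Mapping.single (1, a) (Poly_Mapping.lookup u (1, a)))"
    by (subst sum.reindex) (auto simp: inj_on_def)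
  finally have "f * u = f * (\<Sum>a\<in>A. Poly_Mapping.single (1, a) (Poly_Mapping.lookup u (1, a)))"
    by (rule arg_cong)
  then have "f * u = (\<Sum>a\<in>A. f * Poly_Mapping.single (1, a) (Poly_Mapping.lookup u (1, a)))"
    by (simp only: sum_distrib_left)
  moreover have "Poly_Mapping.lookup (f * Poly_Mapping.single (1, a) c) (Suc n, v) =
      Poly_Mapping.lookup f (n, v - a) * c" for a c
    using lookup_mult_single[of f "(1, a)" c "(n, v - a)"] by simp
  ultimately show ?thesis
    by (simp add: lookup_sum)
qed

text \<open>
  If linear forms satisfy \<open>\<Sum> f\<^sub>l g\<^sub>l = 0\<close>, then weighting each product of two variables by a function \<open>h\<close> of
  its multidegree alone gives zero, since every coefficient of the sum vanishes separately. This
  is what makes the two error terms of the cocycle condition disappear.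
\<close>

lemma linear_syzygy:
  fixes f g :: "'l \<Rightarrow> 'k laurent"
  assumes "\<And>l. l \<in> L \<Longrightarrow> Poly_Mapping.keys (f l) \<subseteq> Pair 1 ` A"
    and "\<And>l. l \<in> L \<Longrightarrow> Poly_Mapping.keys (g l) \<subseteq> Pair 1 ` A"
    and zero: "(\<Sum>l\<in>L. f l * g l) = 0"
  shows "(\<Sum>l\<in>L. \<Sum>p\<in>A. \<Sum>y\<in>A. Poly_Mapping.lookup (f l) (1, y) * Poly_Mapping.lookup (g l) (1, p) * h (y + p)) = 0"
proof -
  define V where "V = (\<lambda>(y, p). y + p) ` (A \<times> A)"
  have fV: "finite V"
    using finite_points by (simp add: V_def)
  have inner: "(\<Sum>y\<in>A. Poly_Mapping.lookup (f l) (1, y) * h (y + p)) =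
      (\<Sum>v\<in>V. Poly_Mapping.lookup (f l) (1, v - p) * h v)" if "l \<in> L" "p \<in> A" for l p
  proof -
    have "(\<Sum>y\<in>A. Poly_Mapping.lookup (f l) (1, y) * h (y + p)) =
        (\<Sum>v\<in>(\<lambda>y. y + p) ` A. Poly_Mapping.lookup (f l) (1, v - p) * h v)"
      by (subst sum.reindex) (auto simp: inj_on_def)
    also have "\<dots> = (\<Sum>v\<in>V. Poly_Mapping.lookup (f l) (1, v - p) * h v)"
    proof (rule sum.mono_neutral_left)
      show "(\<lambda>y. y + p) ` A \<subseteq> V" using that by (force simp: V_def)
      show "\<forall>i\<in>V - (\<lambda>y. y + p) ` A. Poly_Mapping.lookup (f l) (1, i - p) * h i = 0"
      proof
        fix v assume "v \<in> V - (\<lambda>y. y + p) ` A"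
        then have "v - p \<notin> A" by (force simp: image_iff)
        then have "(1, v - p) \<notin> Poly_Mapping.keys (f l)" using assms(1)[OF that(1)] by auto
        then show "Poly_Mapping.lookup (f l) (1, v - p) * h v = 0" by (simp add: in_keys_iff)
      qed
    qed (rule fV)
    finally show ?thesis .
  qed
  have "(\<Sum>l\<in>L. \<Sum>p\<in>A. \<Sum>y\<in>A. Poly_Mapping.lookup (f l) (1, y) * Poly_Mapping.lookup (g l) (1, p) * h (y + p)) =
      (\<Sum>l\<in>L. \<Sum>p\<in>A. Poly_Mapping.lookup (g l) (1, p) * (\<Sum>y\<in>A. Poly_Mapping.lookup (f l) (1, y) * h (y + p)))"
    unfolding sum_distrib_left by (intro sum.cong refl) (simp only: mult_ac)
  also have "\<dots> = (\<Sum>l\<in>L. \<Sum>p\<in>A. \<Sum>v\<in>V. Poly_Mapping.lookup (f l) (1, v - p) * Poly_Mapping.lookup (g l) (1, p) * h v)"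
  proof (intro sum.cong refl)
    fix l p assume "l \<in> L" "p \<in> A"
    then have "Poly_Mapping.lookup (g l) (1, p) * (\<Sum>y\<in>A. Poly_Mapping.lookup (f l) (1, y) * h (y + p)) =
        Poly_Mapping.lookup (g l) (1, p) * (\<Sum>v\<in>V. Poly_Mapping.lookup (f l) (1, v - p) * h v)"
      by (simp only: inner)
    then show "Poly_Mapping.lookup (g l) (1, p) * (\<Sum>y\<in>A. Poly_Mapping.lookup (f l) (1, y) * h (y + p)) =
        (\<Sum>v\<in>V. Poly_Mapping.lookup (f l) (1, v - p) * Poly_Mapping.lookup (g l) (1, p) * h v)"
      by (simp only: sum_distrib_left mult_ac)
  qed
  also have "\<dots> = (\<Sum>l\<in>L. \<Sum>v\<in>V. \<Sum>p\<in>A. Poly_Mapping.lookup (f l) (1, v - p) * Poly_Mapping.lookup (g l) (1, p) * h v)"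
    by (intro sum.cong refl sum.swap)
  also have "\<dots> = (\<Sum>v\<in>V. \<Sum>l\<in>L. \<Sum>p\<in>A. Poly_Mapping.lookup (f l) (1, v - p) * Poly_Mapping.lookup (g l) (1, p) * h v)"
    by (rule sum.swap)
  also have "\<dots> = (\<Sum>v\<in>V. h v * (\<Sum>l\<in>L. Poly_Mapping.lookup (f l * g l) (Suc 1, v)))"
  proof -
    have "Poly_Mapping.lookup (f l * g l) (Suc 1, v) =
        (\<Sum>p\<in>A. Poly_Mapping.lookup (f l) (1, v - p) * Poly_Mapping.lookup (g l) (1, p))" if "l \<in> L" for l v
      by (rule lookup_mult_linear[OF assms(2)[OF that]])
    then show ?thesis
      by (simp only: sum_distrib_left mult_ac cong: sum.cong)
  qed
  also have "\<dots> = (\<Sum>v\<in>V. h v * Poly_Mapping.lookup (\<Sum>l\<in>L. f l * g l) (Suc 1, v))"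
    by (simp add: lookup_sum)
  also have "\<dots> = 0"
    by (simp add: zero)
  finally show ?thesis .
qed

text \<open>
  On a chain \<open>x < x + y < \<Lambda> - q\<close> of the interval below \<open>\<Lambda> = x + y + p + q\<close>, think of \<open>T p q\<close> as the value of
  a one-cochain \<open>\<phi>\<close> on the edge from \<open>x + y = \<Lambda> - p - q\<close> to \<open>\<Lambda> - q\<close>, of \<open>B x q\<close> as its value on the edge
  from \<open>x\<close> to \<open>\<Lambda> - q\<close>, and of \<open>- T y x\<close> as its value on the edge from \<open>x\<close> to \<open>x + y\<close>; that is, \<open>\<phi>\<close> changes sign
  under the order-reversing involution \<open>s \<mapsto> \<Lambda> - s\<close>. The first hypothesis is the cocycle condition. The
  remaining ones describe a closed path from \<open>\<Lambda> - b\<close> down to \<open>r1 + s1\<close>, up to \<open>\<Lambda> - b'\<close>, down to \<open>r2 + s2\<close>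
  and back up to \<open>\<Lambda> - b\<close>, on which the sum of \<open>\<phi>\<close> is not zero.

  For the proof, suppose that a linear resolution exists, with matrices \<open>D 0\<close>, \<open>D 1\<close>, \<open>D 2\<close> of linear forms.
  Pairing \<open>T\<close> with products of entries of \<open>D 1\<close> and \<open>D 0\<close> defines a functional \<open>F\<close> on the second free module. On the
  image of \<open>D 2\<close> the cocycle condition splits \<open>F\<close> into a part that vanishes because the product of \<open>D 2\<close>
  and \<open>D 1\<close> is zero, and a part that vanishes because the product of \<open>D 1\<close> and \<open>D 0\<close> is zero. The closed
  path yields an element of the kernel of \<open>D 1\<close>, which is the image of \<open>D 2\<close> by exactness, with \<open>F \<noteq> 0\<close>.
\<close>

lemma not_koszul_criterion:
  fixes T B :: "(nat \<Rightarrow>\<^sub>0 int) \<Rightarrow> (nat \<Rightarrow>\<^sub>0 int) \<Rightarrow> 'k"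
  assumes cocycle: "\<And>x y p q. x \<in> A \<Longrightarrow> y \<in> A \<Longrightarrow> p \<in> A \<Longrightarrow> q \<in> A \<Longrightarrow> x + y + p + q = \<Lambda>
      \<Longrightarrow> T p q - T y x = B x q"
    and "b \<in> A" "b' \<in> A"
    and p1: "r1 \<in> A" "s1 \<in> A" "a1 \<in> A" "a1' \<in> A" "a1 + b = a1' + b'" "r1 + s1 + a1 + b = \<Lambda>"
    and p2: "r2 \<in> A" "s2 \<in> A" "a2 \<in> A" "a2' \<in> A" "a2 + b = a2' + b'" "r2 + s2 + a2 + b = \<Lambda>"
    and nonzero: "T a1 b - T a1' b' \<noteq> T a2 b - T a2' b'"
  shows "\<not> koszul R G"
proof
  assume "koszul R G"
  then obtain bt e D where res: "minimal_graded_free_resolution R G bt e D"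
    and lin: "\<And>i j. i \<noteq> j \<Longrightarrow> betti_number bt e i j = 0"
    unfolding koszul_def by blast
  have deg: "e i k = i" if "k < bt i" for i k
  proof (rule ccontr)
    assume "e i k \<noteq> i"
    then have "card {k'. k' < bt i \<and> e i k' = e i k} = 0"
      using lin[of i "e i k"] by (simp add: betti_number_def)
    moreover have "finite {k'. k' < bt i \<and> e i k' = e i k}" by simp
    ultimately have "{k'. k' < bt i \<and> e i k' = e i k} = {}" by (simp only: card_0_eq)
    then show False using that by blast
  qed
  have b0: "bt 0 = 1"
    using res by (simp add: minimal_graded_free_resolution_def)
  have DG: "D i k l \<in> G 1" if "k < bt (Suc i)" "l < bt i" for i k l
  proof -
    have "\<forall>i. \<forall>k<bt (Suc i). \<forall>l<bt i.
        D i k l \<in> (if e i l \<le> e (Suc i) k then G (e (Suc i) k - e i l) else {\<zero>\<^bsub>R\<^esub>})"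
      using res unfolding minimal_graded_free_resolution_def by (elim conjE)
    with that have "D i k l \<in> (if e i l \<le> e (Suc i) k then G (e (Suc i) k - e i l) else {\<zero>\<^bsub>R\<^esub>})"
      by simp
    then show ?thesis using deg that by simp
  qed
  have DR: "D i k l \<in> carrier R" if "k < bt (Suc i)" "l < bt i" for i k l
    using DG[OF that] by (rule G_carrier)
  define M where "M = (\<lambda>i k l. ev (D i k l))"
  have M_keys: "Poly_Mapping.keys (M i k l) \<subseteq> Pair 1 ` A" if "k < bt (Suc i)" "l < bt i" for i k l
  proof
    fix z assume "z \<in> Poly_Mapping.keys (M i k l)"
    then have "fst z = 1" "z \<in> semigroup"
      using ev_G[OF DG[OF that]] keys_ev[OF DR[OF that]] by (auto simp: M_def)
    then show "z \<in> Pair 1 ` A"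
      using semigroup_1 by (cases z) auto
  qed
  have exact0: "matrix_map R (bt 1) (bt 0) (D 0) ` free_module R (bt 1) =
       {v \<in> free_module R (bt 0). v 0 \<in> irrelevant_ideal R G}"
    using res unfolding minimal_graded_free_resolution_def by (elim conjE)
  have "\<forall>i. matrix_map R (bt (Suc (Suc i))) (bt (Suc i)) (D (Suc i)) ` free_module R (bt (Suc (Suc i))) =
       {v \<in> free_module R (bt (Suc i)).
          matrix_map R (bt (Suc i)) (bt i) (D i) v = (\<lambda>l\<in>{..<bt i}. \<zero>\<^bsub>R\<^esub>)}"
    using res unfolding minimal_graded_free_resolution_def by (elim conjE)
  note exact = spec[OF this]
  \<comment> \<open>Consecutive matrices multiply to zero: apply exactness to the unit vectors.\<close>
  have complex: "(\<Sum>l<bt (Suc i). M (Suc i) k l * M i l m) = 0"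
    if k: "k < bt (Suc (Suc i))" and m: "m < bt i" for i k m
  proof -
    define v where "v = (\<lambda>k'\<in>{..<bt (Suc (Suc i))}. if k' = k then \<one>\<^bsub>R\<^esub> else \<zero>\<^bsub>R\<^esub>)"
    have v: "v \<in> free_module R (bt (Suc (Suc i)))"
      by (auto simp: v_def free_module_def)
    let ?w = "matrix_map R (bt (Suc (Suc i))) (bt (Suc i)) (D (Suc i)) v"
    have w: "?w \<in> free_module R (bt (Suc i))" "matrix_map R (bt (Suc i)) (bt i) (D i) ?w = (\<lambda>l\<in>{..<bt i}. \<zero>\<^bsub>R\<^esub>)"
      using imageI[OF v, of "matrix_map R (bt (Suc (Suc i))) (bt (Suc i)) (D (Suc i))"]
      unfolding exact by simp_all
    have "ev (?w l) = M (Suc i) k l" if "l < bt (Suc i)" for l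
    proof -
      have "ev (?w l) = (\<Sum>k'<bt (Suc (Suc i)). ev (v k') * M (Suc i) k' l)"
        using that v by (subst ev_matrix_map) (auto simp: DR M_def)
      also have "\<dots> = (\<Sum>k'<bt (Suc (Suc i)). if k' = k then M (Suc i) k l else 0)"
        by (intro sum.cong) (auto simp: v_def ev_one ev_zero)
      finally show ?thesis using k by simp
    qed
    moreover have "0 = ev (matrix_map R (bt (Suc i)) (bt i) (D i) ?w m)"
      using m by (simp add: w(2) ev_zero)
    moreover have "\<dots> = (\<Sum>l<bt (Suc i). ev (?w l) * M i l m)"
      using m w(1) by (subst ev_matrix_map) (auto simp: DR M_def)
    ultimately show ?thesis by simp
  qed

  \<comment> \<open>The functional sees only the component of multidegree \<open>\<Lambda>\<close> of the second free module.\<close>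
  define F :: "(nat \<Rightarrow> 'k laurent) \<Rightarrow> 'k" where "F = (\<lambda>W. \<Sum>l<bt 2. \<Sum>m<bt 1. \<Sum>p\<in>A. \<Sum>q\<in>A.
      Poly_Mapping.lookup (W l) (2, \<Lambda> - q - p) * Poly_Mapping.lookup (M 1 l m) (1, p) *
      Poly_Mapping.lookup (M 0 m 0) (1, q) * T p q)"

  have F_boundary: "F (\<lambda>l. \<Sum>k<bt 3. x k * M 2 k l) = 0"
    if x: "\<And>k. k < bt 3 \<Longrightarrow> Poly_Mapping.keys (x k) \<subseteq> semigroup" for x
  proof -
    let ?c = "\<lambda>k v. Poly_Mapping.lookup (x k) (1, v)"
    let ?t = "\<lambda>k l m p q y. ?c k (\<Lambda> - q - p - y) * Poly_Mapping.lookup (M 2 k l) (1, y) *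
        Poly_Mapping.lookup (M 1 l m) (1, p) * Poly_Mapping.lookup (M 0 m 0) (1, q)"
    \<comment> \<open>The cocycle condition applies when \<open>\<Lambda> - q - p - y\<close> is a generator; otherwise the coefficient of \<open>x k\<close> is zero.\<close>
    have split: "?t k l m p q y * T p q =
        ?t k l m p q y * B (\<Lambda> - q - p - y) q + ?t k l m p q y * T y (\<Lambda> - q - p - y)"
      if "k < bt 3" "p \<in> A" "q \<in> A" "y \<in> A" for k l m p q y
    proof (cases "\<Lambda> - q - p - y \<in> A")
      case True
      have "T p q = B (\<Lambda> - q - p - y) q + T y (\<Lambda> - q - p - y)"
        using cocycle[OF True that(4,2,3)] by (simp add: algebra_simps)
      then show ?thesis by (simp only: distrib_left)
    next
      case False
      then have "?c k (\<Lambda> - q - p - y) = 0"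
        using x[OF that(1)] semigroup_1 by (metis in_keys_iff subsetD)
      then show ?thesis by simp
    qed
    have "F (\<lambda>l. \<Sum>k<bt 3. x k * M 2 k l) =
        (\<Sum>l<bt 2. \<Sum>m<bt 1. \<Sum>p\<in>A. \<Sum>q\<in>A. \<Sum>k<bt 3. \<Sum>y\<in>A. ?t k l m p q y * T p q)"
      unfolding F_def
    proof (intro sum.cong refl)
      fix l m p q assume "l \<in> {..<bt 2}"
      then have l: "l < bt 2" by simp
      have "Poly_Mapping.lookup (\<Sum>k<bt 3. x k * M 2 k l) (2, \<Lambda> - q - p) =
          (\<Sum>k<bt 3. \<Sum>y\<in>A. ?c k (\<Lambda> - q - p - y) * Poly_Mapping.lookup (M 2 k l) (1, y))"
        unfolding lookup_sum
      proof (intro sum.cong refl)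
        fix k assume "k \<in> {..<bt 3}"
        then have "Poly_Mapping.keys (M 2 k l) \<subseteq> Pair 1 ` A"
          using M_keys[of k 2 l] l by (simp add: numeral_eq_Suc)
        from lookup_mult_linear[OF this, of "x k" 1 "\<Lambda> - q - p"]
        show "Poly_Mapping.lookup (x k * M 2 k l) (2, \<Lambda> - q - p) =
          (\<Sum>y\<in>A. ?c k (\<Lambda> - q - p - y) * Poly_Mapping.lookup (M 2 k l) (1, y))"
          by (simp add: numeral_2_eq_2)
      qed
      then show "Poly_Mapping.lookup (\<Sum>k<bt 3. x k * M 2 k l) (2, \<Lambda> - q - p) *
          Poly_Mapping.lookup (M 1 l m) (1, p) * Poly_Mapping.lookup (M 0 m 0) (1, q) * T p q =
          (\<Sum>k<bt 3. \<Sum>y\<in>A. ?t k l m p q y * T p q)"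
        by (simp add: sum_distrib_left sum_distrib_right mult_ac)
    qed
    also have "\<dots> =
        (\<Sum>l<bt 2. \<Sum>m<bt 1. \<Sum>p\<in>A. \<Sum>q\<in>A. \<Sum>k<bt 3. \<Sum>y\<in>A. ?t k l m p q y * B (\<Lambda> - q - p - y) q) +
        (\<Sum>l<bt 2. \<Sum>m<bt 1. \<Sum>p\<in>A. \<Sum>q\<in>A. \<Sum>k<bt 3. \<Sum>y\<in>A. ?t k l m p q y * T y (\<Lambda> - q - p - y))"
      unfolding sum.distrib[symmetric] by (intro sum.cong refl split) auto
    also have "(\<Sum>l<bt 2. \<Sum>m<bt 1. \<Sum>p\<in>A. \<Sum>q\<in>A. \<Sum>k<bt 3. \<Sum>y\<in>A. ?t k l m p q y * B (\<Lambda> - q - p - y) q) = 0"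
    proof -
      have "(\<Sum>l<bt 2. \<Sum>m<bt 1. \<Sum>p\<in>A. \<Sum>q\<in>A. \<Sum>k<bt 3. \<Sum>y\<in>A. ?t k l m p q y * B (\<Lambda> - q - p - y) q) =
          (\<Sum>m<bt 1. \<Sum>q\<in>A. \<Sum>k<bt 3. \<Sum>l<bt 2. \<Sum>p\<in>A. \<Sum>y\<in>A. ?t k l m p q y * B (\<Lambda> - q - p - y) q)"
        unfolding sum.cartesian_product
        by (rule sum.reindex_bij_witness[of _ "\<lambda>(m, q, k, l, p, y). (l, m, p, q, k, y)"
              "\<lambda>(l, m, p, q, k, y). (m, q, k, l, p, y)"]) auto
      also have "\<dots> = 0"
      proof (rule sum.neutral, rule ballI, rule sum.neutral, rule ballI, rule sum.neutral, rule ballI)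
        fix m q k assume m: "m \<in> {..<bt 1}" and k: "k \<in> {..<bt 3}"
        have "(\<Sum>l<bt 2. \<Sum>p\<in>A. \<Sum>y\<in>A. Poly_Mapping.lookup (M 2 k l) (1, y) * Poly_Mapping.lookup (M 1 l m) (1, p) *
             (\<lambda>v. ?c k (\<Lambda> - q - v) * B (\<Lambda> - q - v) q * Poly_Mapping.lookup (M 0 m 0) (1, q)) (y + p)) = 0"
          using m k M_keys[of k 2] M_keys[of _ 1 m] complex[of k 1 m]
          by (intro linear_syzygy) (auto simp: numeral_eq_Suc)
        then show "(\<Sum>l<bt 2. \<Sum>p\<in>A. \<Sum>y\<in>A. ?t k l m p q y * B (\<Lambda> - q - p - y) q) = 0"
          by (simp add: algebra_simps)
      qed
      finally show ?thesis .
    qed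
    also have "(\<Sum>l<bt 2. \<Sum>m<bt 1. \<Sum>p\<in>A. \<Sum>q\<in>A. \<Sum>k<bt 3. \<Sum>y\<in>A. ?t k l m p q y * T y (\<Lambda> - q - p - y)) = 0"
    proof (rule sum.neutral, rule ballI)
      fix l assume l: "l \<in> {..<bt 2}"
      have "(\<Sum>m<bt 1. \<Sum>p\<in>A. \<Sum>q\<in>A. \<Sum>k<bt 3. \<Sum>y\<in>A. ?t k l m p q y * T y (\<Lambda> - q - p - y)) =
          (\<Sum>k<bt 3. \<Sum>y\<in>A. \<Sum>m<bt 1. \<Sum>q\<in>A. \<Sum>p\<in>A. ?t k l m p q y * T y (\<Lambda> - q - p - y))"
        unfolding sum.cartesian_product
        by (rule sum.reindex_bij_witness[of _ "\<lambda>(k, y, m, q, p). (m, p, q, k, y)"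
              "\<lambda>(m, p, q, k, y). (k, y, m, q, p)"]) auto
      also have "\<dots> = 0"
      proof (rule sum.neutral, rule ballI, rule sum.neutral, rule ballI)
        fix k y assume k: "k \<in> {..<bt 3}"
        have "(\<Sum>m<bt 1. \<Sum>q\<in>A. \<Sum>p\<in>A. Poly_Mapping.lookup (M 1 l m) (1, p) * Poly_Mapping.lookup (M 0 m 0) (1, q) *
             (\<lambda>v. ?c k (\<Lambda> - v - y) * T y (\<Lambda> - v - y) * Poly_Mapping.lookup (M 2 k l) (1, y)) (p + q)) = 0"
          using l M_keys[of l 1] M_keys[of _ 0 0] complex[of l 0 0] b0
          by (intro linear_syzygy) (auto simp: numeral_eq_Suc)
        then show "(\<Sum>m<bt 1. \<Sum>q\<in>A. \<Sum>p\<in>A. ?t k l m p q y * T y (\<Lambda> - q - p - y)) = 0"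
          by (simp add: algebra_simps)
      qed
      finally show "(\<Sum>m<bt 1. \<Sum>p\<in>A. \<Sum>q\<in>A. \<Sum>k<bt 3. \<Sum>y\<in>A. ?t k l m p q y * T y (\<Lambda> - q - p - y)) = 0" .
    qed
    finally show ?thesis by simp
  qed

  \<comment> \<open>\<open>\<alpha> c\<close> lifts the variable \<open>x\<^sub>c\<close> to the first free module.\<close>
  have "\<exists>\<alpha>\<in>free_module R (bt 1). (\<Sum>m<bt 1. ev (\<alpha> m) * M 0 m 0) = Poly_Mapping.single (1, c) 1" if "c \<in> A" for c
  proof -
    have "(\<lambda>l\<in>{..<1}. var c) \<in> {v \<in> free_module R (bt 0). v 0 \<in> irrelevant_ideal R G}"
      using that by (auto simp: free_module_def b0 var_R var_irrelevant)
    then obtain \<alpha> where \<alpha>: "\<alpha> \<in> free_module R (bt 1)" "matrix_map R (bt 1) (bt 0) (D 0) \<alpha> = (\<lambda>l\<in>{..<1}. var c)"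
      unfolding exact0[symmetric] by auto
    have "(\<Sum>m<bt 1. ev (\<alpha> m) * M 0 m 0) = ev (matrix_map R (bt 1) (bt 0) (D 0) \<alpha> 0)"
      using \<alpha>(1) by (subst ev_matrix_map) (auto simp: b0 M_def DR)
    also have "\<dots> = Poly_Mapping.single (1, c) 1"
      unfolding \<alpha>(2) using that by (simp add: ev_var)
    finally show ?thesis using \<alpha>(1) by blast
  qed
  then have "\<forall>c\<in>A. \<exists>\<alpha>. \<alpha> \<in> free_module R (bt 1) \<and> (\<Sum>m<bt 1. ev (\<alpha> m) * M 0 m 0) = Poly_Mapping.single (1, c) 1"
    unfolding Bex_def by (intro ballI)
  from bchoice[OF this] obtain \<alpha> where \<alpha>': "\<forall>c\<in>A. \<alpha> c \<in> free_module R (bt 1) \<and>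
      (\<Sum>m<bt 1. ev (\<alpha> c m) * M 0 m 0) = Poly_Mapping.single (1, c) 1"
    by (elim exE)
  have \<alpha>: "\<And>c. c \<in> A \<Longrightarrow> \<alpha> c \<in> free_module R (bt 1)"
    "\<And>c. c \<in> A \<Longrightarrow> (\<Sum>m<bt 1. ev (\<alpha> c m) * M 0 m 0) = Poly_Mapping.single (1, c) 1"
    using \<alpha>' by (simp_all only:)
  have \<alpha>_R: "\<alpha> c m \<in> carrier R" if "c \<in> A" "m < bt 1" for c m
    using \<alpha>(1)[OF that(1)] that(2) by (auto simp: free_module_def)

  \<comment> \<open>The relation \<open>x\<^sub>a x\<^sub>b = x\<^bsub>a'\<^esub> x\<^bsub>b'\<^esub>\<close> gives a syzygy of \<open>D 0\<close>, which lifts to the second module by exactness.\<close>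
  have lift: "\<exists>\<gamma>\<in>free_module R (bt 2). \<forall>m<bt 1. (\<Sum>l<bt 2. ev (\<gamma> l) * M 1 l m) =
      Poly_Mapping.single (1, a) 1 * ev (\<alpha> b m) - Poly_Mapping.single (1, a') 1 * ev (\<alpha> b' m)"
    if a: "a \<in> A" "a' \<in> A" "a + b = a' + b'" for a a'
  proof -
    define \<rho> where "\<rho> = (\<lambda>m\<in>{..<bt 1}. (var a \<otimes>\<^bsub>R\<^esub> \<alpha> b m) \<ominus>\<^bsub>R\<^esub> (var a' \<otimes>\<^bsub>R\<^esub> \<alpha> b' m))"
    have ev_\<rho>: "ev (\<rho> m) = Poly_Mapping.single (1, a) 1 * ev (\<alpha> b m) - Poly_Mapping.single (1, a') 1 * ev (\<alpha> b' m)"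
      if "m < bt 1" for m
      using that a \<open>b \<in> A\<close> \<open>b' \<in> A\<close> by (simp add: \<rho>_def ev_minus ev_mult ev_var \<alpha>_R var_R)
    have \<rho>: "\<rho> \<in> free_module R (bt 1)"
      using a \<open>b \<in> A\<close> \<open>b' \<in> A\<close> by (auto simp: \<rho>_def free_module_def \<alpha>_R var_R)
    have "matrix_map R (bt 1) (bt 0) (D 0) \<rho> = (\<lambda>l\<in>{..<bt 0}. \<zero>\<^bsub>R\<^esub>)"
    proof (rule matrix_map_eqI)
      fix l assume "l < bt 0"
      then have [simp]: "l = 0" by (simp add: b0)
      have "(\<Sum>m<bt 1. ev (\<rho> m) * M 0 m 0) =
          (\<Sum>m<bt 1. Poly_Mapping.single (1, a) 1 * (ev (\<alpha> b m) * M 0 m 0) - Poly_Mapping.single (1, a') 1 * (ev (\<alpha> b' m) * M 0 m 0))"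
        by (intro sum.cong refl) (simp add: ev_\<rho> algebra_simps)
      also have "\<dots> = Poly_Mapping.single (1, a) 1 * (\<Sum>m<bt 1. ev (\<alpha> b m) * M 0 m 0) -
          Poly_Mapping.single (1, a') 1 * (\<Sum>m<bt 1. ev (\<alpha> b' m) * M 0 m 0)"
        by (simp add: sum_subtractf sum_distrib_left)
      also have "\<dots> = 0"
        unfolding \<alpha>(2)[OF \<open>b \<in> A\<close>] \<alpha>(2)[OF \<open>b' \<in> A\<close>] by (simp add: mult_single a(3))
      finally show "(\<Sum>k<bt 1. ev (\<rho> k) * ev (D 0 k l)) = ev ((\<lambda>l\<in>{..<bt 0}. \<zero>\<^bsub>R\<^esub>) l)"
        by (simp add: M_def ev_zero b0)
    qed (use \<rho> DR[of _ 0] in \<open>auto simp: free_module_def\<close>)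
    then have "\<rho> \<in> matrix_map R (bt 2) (bt 1) (D 1) ` free_module R (bt 2)"
      using exact[of 0] \<rho> by (auto simp: numeral_2_eq_2)
    then obtain \<gamma> where \<gamma>: "\<gamma> \<in> free_module R (bt 2)" "\<rho> = matrix_map R (bt 2) (bt 1) (D 1) \<gamma>"
      by blast
    have "(\<Sum>l<bt 2. ev (\<gamma> l) * M 1 l m) = ev (\<rho> m)" if "m < bt 1" for m
      unfolding \<gamma>(2) using \<gamma>(1) that DR[of _ 1] by (subst ev_matrix_map) (auto simp: M_def numeral_2_eq_2)
    then show ?thesis
      using \<gamma>(1) ev_\<rho> by (intro bexI[of _ \<gamma>]) auto
  qed
  obtain \<gamma>1 where \<gamma>1: "\<gamma>1 \<in> free_module R (bt 2)" "\<And>m. m < bt 1 \<Longrightarrow> (\<Sum>l<bt 2. ev (\<gamma>1 l) * M 1 l m) =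
      Poly_Mapping.single (1, a1) 1 * ev (\<alpha> b m) - Poly_Mapping.single (1, a1') 1 * ev (\<alpha> b' m)"
    using lift[OF p1(3-5)] by blast
  obtain \<gamma>2 where \<gamma>2: "\<gamma>2 \<in> free_module R (bt 2)" "\<And>m. m < bt 1 \<Longrightarrow> (\<Sum>l<bt 2. ev (\<gamma>2 l) * M 1 l m) =
      Poly_Mapping.single (1, a2) 1 * ev (\<alpha> b m) - Poly_Mapping.single (1, a2') 1 * ev (\<alpha> b' m)"
    using lift[OF p2(3-5)] by blast
  have \<gamma>_R: "\<gamma> l \<in> carrier R" if "\<gamma> \<in> free_module R (bt 2)" "l < bt 2" for \<gamma> l
    using that by (auto simp: free_module_def)

  \<comment> \<open>Multiplying the two lifted relations into multidegree \<open>\<Lambda>\<close> makes their images in the first module equal.\<close>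
  define w where "w = (\<lambda>l\<in>{..<bt 2}. ((var r1 \<otimes>\<^bsub>R\<^esub> var s1) \<otimes>\<^bsub>R\<^esub> \<gamma>1 l) \<ominus>\<^bsub>R\<^esub> ((var r2 \<otimes>\<^bsub>R\<^esub> var s2) \<otimes>\<^bsub>R\<^esub> \<gamma>2 l))"
  have w: "w \<in> free_module R (bt 2)"
    using \<gamma>1(1) \<gamma>2(1) p1 p2 by (auto simp: w_def free_module_def var_R \<gamma>_R)
  have ev_w: "ev (w l) = Poly_Mapping.single (2, r1 + s1) 1 * ev (\<gamma>1 l) - Poly_Mapping.single (2, r2 + s2) 1 * ev (\<gamma>2 l)"
    if "l < bt 2" for l
    using that \<gamma>1(1) \<gamma>2(1) p1 p2
    by (simp add: w_def ev_minus ev_mult ev_var var_R \<gamma>_R mult_single numeral_2_eq_2)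
  have "matrix_map R (bt 2) (bt 1) (D 1) w = (\<lambda>l\<in>{..<bt 1}. \<zero>\<^bsub>R\<^esub>)"
  proof (rule matrix_map_eqI)
    fix m assume m: "m < bt 1"
    have "(\<Sum>l<bt 2. ev (w l) * M 1 l m) =
        (\<Sum>l<bt 2. Poly_Mapping.single (2, r1 + s1) 1 * (ev (\<gamma>1 l) * M 1 l m) - Poly_Mapping.single (2, r2 + s2) 1 * (ev (\<gamma>2 l) * M 1 l m))"
      by (intro sum.cong refl) (simp add: ev_w algebra_simps)
    also have "\<dots> = Poly_Mapping.single (2, r1 + s1) 1 * (\<Sum>l<bt 2. ev (\<gamma>1 l) * M 1 l m) -
        Poly_Mapping.single (2, r2 + s2) 1 * (\<Sum>l<bt 2. ev (\<gamma>2 l) * M 1 l m)"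
      by (simp add: sum_subtractf sum_distrib_left)
    also have "\<dots> = 0"
    proof -
      have "r1 + s1 + a1 + b = r2 + s2 + a2 + b"
        by (simp only: p1(6) p2(6))
      moreover have "r1 + s1 + a1' + b' = r2 + s2 + a2' + b'"
        using p1(6) p2(6) unfolding add.assoc p1(5) p2(5) by simp
      ultimately have eq: "r1 + s1 + a1 = r2 + s2 + a2" "r1 + s1 + a1' = r2 + s2 + a2'"
        by simp_all
      show ?thesis
        unfolding \<gamma>1(2)[OF m] \<gamma>2(2)[OF m]
        by (simp add: right_diff_distrib mult.assoc[symmetric] mult_single eq)
    qed
    finally show "(\<Sum>k<bt 2. ev (w k) * ev (D 1 k m)) = ev ((\<lambda>l\<in>{..<bt 1}. \<zero>\<^bsub>R\<^esub>) m)"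
      using m by (simp add: M_def ev_zero)
  qed (use w DR[of _ 1] in \<open>auto simp: free_module_def numeral_2_eq_2\<close>)
  then have "w \<in> matrix_map R (bt 3) (bt 2) (D 2) ` free_module R (bt 3)"
    using exact[of 1] w by (auto simp: numeral_eq_Suc)
  then obtain x where x: "x \<in> free_module R (bt 3)" "w = matrix_map R (bt 3) (bt 2) (D 2) x"
    by blast
  have "ev (w l) = (\<Sum>k<bt 3. ev (x k) * M 2 k l)" if "l < bt 2" for l
    unfolding x(2) using x(1) that DR[of _ 2] by (subst ev_matrix_map) (auto simp: M_def numeral_eq_Suc)
  then have "F (\<lambda>l. ev (w l)) = F (\<lambda>l. \<Sum>k<bt 3. ev (x k) * M 2 k l)"
    by (simp add: F_def)
  also have "\<dots> = 0"
    using x(1) keys_ev by (intro F_boundary) (auto simp: free_module_def)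
  finally have F0: "F (\<lambda>l. ev (w l)) = 0" .

  \<comment> \<open>Only the constant terms of \<open>\<gamma>\<close> and \<open>\<alpha>\<close> enter, because \<open>D 1\<close> and \<open>D 0\<close> are linear.\<close>
  have F_part: "F (\<lambda>l. Poly_Mapping.single (2, r) 1 * ev (\<gamma> l)) = T a b - T a' b'"
    if \<gamma>: "\<gamma> \<in> free_module R (bt 2)" "\<And>m. m < bt 1 \<Longrightarrow> (\<Sum>l<bt 2. ev (\<gamma> l) * M 1 l m) =
      Poly_Mapping.single (1, a) 1 * ev (\<alpha> b m) - Poly_Mapping.single (1, a') 1 * ev (\<alpha> b' m)"
      and a: "a \<in> A" "a' \<in> A" "a + b = a' + b'" "r + a + b = \<Lambda>" for \<gamma> a a' r
  proof -
    let ?g = "\<lambda>l. Poly_Mapping.lookup (ev (\<gamma> l)) (0, 0)"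
    let ?al = "\<lambda>c m. Poly_Mapping.lookup (ev (\<alpha> c m)) (0, 0)"
    let ?M0 = "\<lambda>m q. Poly_Mapping.lookup (M 0 m 0) (1, q)"
    let ?M1 = "\<lambda>l m p. Poly_Mapping.lookup (M 1 l m) (1, p)"
    have zero: "Poly_Mapping.lookup (ev X) (0, v) = 0" if "X \<in> carrier R" "v \<noteq> 0" for X v
      using keys_ev[OF that(1)] semigroup_0[of v] that(2) by (auto simp: in_keys_iff)
    have lookW: "Poly_Mapping.lookup (Poly_Mapping.single (2, r) 1 * ev (\<gamma> l)) (2, v) = (if v = r then ?g l else 0)"
      if "l < bt 2" for l v
      using lookup_mult_single[of "ev (\<gamma> l)" "(2, r)" 1 "(0, v - r)"] zero[OF \<gamma>_R[OF \<gamma>(1) that], of "v - r"]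
      by (cases "v = r") (simp_all add: mult.commute eval_nat_numeral)
    have coef1: "(\<Sum>l<bt 2. ?g l * ?M1 l m p) = (if p = a then ?al b m else 0) - (if p = a' then ?al b' m else 0)"
      if m: "m < bt 1" for m p
    proof -
      have "Poly_Mapping.lookup (ev (\<gamma> l) * M 1 l m) (1, p) = ?g l * ?M1 l m p" if l: "l < bt 2" for l
      proof -
        have "Poly_Mapping.lookup (ev (\<gamma> l) * M 1 l m) (Suc 0, p) =
            (\<Sum>c\<in>A. Poly_Mapping.lookup (ev (\<gamma> l)) (0, p - c) * ?M1 l m c)"
          using l m M_keys[of l 1 m] by (intro lookup_mult_linear) (auto simp: numeral_2_eq_2)
        also have "\<dots> = (\<Sum>c\<in>A. if c = p then ?g l * ?M1 l m p else 0)"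
          using zero[OF \<gamma>_R[OF \<gamma>(1) l]] by (intro sum.cong refl) auto
        also have "\<dots> = ?g l * ?M1 l m p"
          using l m M_keys[of l 1 m] finite_points by (auto simp: numeral_2_eq_2 in_keys_iff)
        finally show ?thesis by simp
      qed
      then have "(\<Sum>l<bt 2. ?g l * ?M1 l m p) = Poly_Mapping.lookup (\<Sum>l<bt 2. ev (\<gamma> l) * M 1 l m) (1, p)"
        by (simp add: lookup_sum)
      moreover have "Poly_Mapping.lookup (Poly_Mapping.single (1, c) 1 * ev (\<alpha> c' m)) (1, p) = (if p = c then ?al c' m else 0)"
        if "c' \<in> A" for c c'
        using lookup_mult_single[of "ev (\<alpha> c' m)" "(1, c)" 1 "(0, p - c)"] zero[OF \<alpha>_R[OF that m], of "p - c"]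
        by (cases "p = c") (simp_all add: mult.commute)
      ultimately show ?thesis
        using m \<open>b \<in> A\<close> \<open>b' \<in> A\<close> unfolding \<gamma>(2)[OF m] by (simp add: lookup_minus)
    qed
    have coef0: "(\<Sum>m<bt 1. ?al c m * ?M0 m q) = (if q = c then 1 else 0)" if c: "c \<in> A" for c q
    proof -
      have "Poly_Mapping.lookup (ev (\<alpha> c m) * M 0 m 0) (1, q) = ?al c m * ?M0 m q" if m: "m < bt 1" for m
      proof -
        have "Poly_Mapping.lookup (ev (\<alpha> c m) * M 0 m 0) (Suc 0, q) =
            (\<Sum>c'\<in>A. Poly_Mapping.lookup (ev (\<alpha> c m)) (0, q - c') * ?M0 m c')"
          using m M_keys[of m 0 0] by (intro lookup_mult_linear) (auto simp: b0)
        also have "\<dots> = (\<Sum>c'\<in>A. if c' = q then ?al c m * ?M0 m q else 0)"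
          using zero[OF \<alpha>_R[OF c m]] by (intro sum.cong refl) auto
        also have "\<dots> = ?al c m * ?M0 m q"
          using m M_keys[of m 0 0] finite_points by (auto simp: b0 in_keys_iff)
        finally show ?thesis by simp
      qed
      then have "(\<Sum>m<bt 1. ?al c m * ?M0 m q) = Poly_Mapping.lookup (\<Sum>m<bt 1. ev (\<alpha> c m) * M 0 m 0) (1, q)"
        by (simp add: lookup_sum)
      then show ?thesis unfolding \<alpha>(2)[OF c] by (simp add: lookup_single)
    qed
    let ?ind = "\<lambda>p q. if \<Lambda> - q - p = r then T p q else 0"
    have "F (\<lambda>l. Poly_Mapping.single (2, r) 1 * ev (\<gamma> l)) =
        (\<Sum>l<bt 2. \<Sum>m<bt 1. \<Sum>p\<in>A. \<Sum>q\<in>A. ?ind p q * ?M0 m q * (?g l * ?M1 l m p))"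
      unfolding F_def by (intro sum.cong refl) (simp add: lookW)
    also have "\<dots> = (\<Sum>m<bt 1. \<Sum>p\<in>A. \<Sum>q\<in>A. ?ind p q * ?M0 m q * (\<Sum>l<bt 2. ?g l * ?M1 l m p))"
      unfolding sum_distrib_left sum.cartesian_product
      by (rule sum.reindex_bij_witness[of _ "\<lambda>(m, p, q, l). (l, m, p, q)" "\<lambda>(l, m, p, q). (m, p, q, l)"]) auto
    also have "\<dots> = (\<Sum>m<bt 1. \<Sum>p\<in>A. \<Sum>q\<in>A. (if p = a then ?ind a q * (?al b m * ?M0 m q) else 0) - (if p = a' then ?ind a' q * (?al b' m * ?M0 m q) else 0))"
    proof (intro sum.cong refl)
      fix m p q assume "m \<in> {..<bt 1}"
      then have "m < bt 1" by simp
      show "?ind p q * ?M0 m q * (\<Sum>l<bt 2. ?g l * ?M1 l m p) =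
          (if p = a then ?ind a q * (?al b m * ?M0 m q) else 0) - (if p = a' then ?ind a' q * (?al b' m * ?M0 m q) else 0)"
        unfolding coef1[OF \<open>m < bt 1\<close>] by (simp add: algebra_simps)
    qed
    also have "\<dots> = (\<Sum>m<bt 1. \<Sum>q\<in>A. \<Sum>p\<in>A. (if p = a then ?ind a q * (?al b m * ?M0 m q) else 0) - (if p = a' then ?ind a' q * (?al b' m * ?M0 m q) else 0))"
      by (rule sum.cong[OF refl], rule sum.swap)
    also have "\<dots> = (\<Sum>m<bt 1. \<Sum>q\<in>A. ?ind a q * (?al b m * ?M0 m q) - ?ind a' q * (?al b' m * ?M0 m q))"
      using a finite_points by (intro sum.cong refl) (simp add: sum_subtractf)
    also have "\<dots> = (\<Sum>q\<in>A. \<Sum>m<bt 1. ?ind a q * (?al b m * ?M0 m q) - ?ind a' q * (?al b' m * ?M0 m q))"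
      by (rule sum.swap)
    also have "\<dots> = (\<Sum>q\<in>A. ?ind a q * (if q = b then 1 else 0) - ?ind a' q * (if q = b' then 1 else 0))"
      using coef0[OF \<open>b \<in> A\<close>] coef0[OF \<open>b' \<in> A\<close>]
      by (intro sum.cong refl) (simp only: sum_subtractf sum_distrib_left[symmetric])
    also have "\<dots> = (\<Sum>q\<in>A. (if q = b then ?ind a b else 0) - (if q = b' then ?ind a' b' else 0))"
      by (intro sum.cong refl) auto
    also have "\<dots> = ?ind a b - ?ind a' b'"
      using finite_points \<open>b \<in> A\<close> \<open>b' \<in> A\<close> by (simp add: sum_subtractf)
    also have "\<dots> = T a b - T a' b'"
    proof -
      have "\<Lambda> - b - a = r" using a(4) by (simp add: algebra_simps)
      moreover have "r + (a' + b') = \<Lambda>" using a(4) by (simp only: a(3)[symmetric] add.assoc)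
      then have "\<Lambda> - b' - a' = r" by (auto simp: algebra_simps)
      ultimately show ?thesis by simp
    qed
    finally show ?thesis .
  qed
  have "F (\<lambda>l. ev (w l)) = F (\<lambda>l. Poly_Mapping.single (2, r1 + s1) 1 * ev (\<gamma>1 l)) -
      F (\<lambda>l. Poly_Mapping.single (2, r2 + s2) 1 * ev (\<gamma>2 l))"
    unfolding F_def sum_subtractf[symmetric]
    by (intro sum.cong refl) (simp add: ev_w lookup_minus algebra_simps)
  also have "\<dots> = (T a1 b - T a1' b') - (T a2 b - T a2' b')"
    using F_part[OF \<gamma>1 p1(3-6)] F_part[OF \<gamma>2 p2(3-6)] by simp
  finally show False
    using F0 nonzero by simp
qed

end

section \<open>Congruence of monomials modulo quadrics\<close>

context toric
begin

definition quadric_ideal :: "(nat \<Rightarrow>\<^sub>0 int, 'k) mpoly set" where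
  "quadric_ideal = Idl\<^bsub>S\<^esub> (I \<inter> homogeneous_component K A 2)"

definition quadric_equiv :: "((nat \<Rightarrow>\<^sub>0 int) \<Rightarrow>\<^sub>0 nat) \<Rightarrow> ((nat \<Rightarrow>\<^sub>0 int) \<Rightarrow>\<^sub>0 nat) \<Rightarrow> bool" where
  "quadric_equiv m m' \<longleftrightarrow> Poly_Mapping.single m 1 - Poly_Mapping.single m' 1 \<in> quadric_ideal"

lemma I_iff: "p \<in> I \<longleftrightarrow> p \<in> carrier S \<and> toric_map p = 0"
  unfolding toric_ideal_def a_kernel_def' by (simp add: laurent_ring_def)

lemma quadrics_subset: "I \<inter> homogeneous_component K A 2 \<subseteq> carrier S"
  by (auto simp: homogeneous_component_def)

lemma quadric_ideal: "ideal quadric_ideal S"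
  unfolding quadric_ideal_def by (rule hom.R.genideal_ideal[OF quadrics_subset])

lemma quadric_ideal_add: "p \<in> quadric_ideal \<Longrightarrow> q \<in> quadric_ideal \<Longrightarrow> p + q \<in> quadric_ideal"
  using additive_subgroup.a_closed[OF ideal.axioms(1)[OF quadric_ideal]] by (simp add: mpoly_ring_def)

lemma quadric_ideal_mult: "p \<in> quadric_ideal \<Longrightarrow> q \<in> carrier S \<Longrightarrow> q * p \<in> quadric_ideal"
  using ideal.I_l_closed[OF quadric_ideal] by (simp add: mpoly_ring_def)

lemma quadric_ideal_zero: "0 \<in> quadric_ideal"
  using additive_subgroup.zero_closed[OF ideal.axioms(1)[OF quadric_ideal]] by (simp add: mpoly_ring_def)

lemma quadric_ideal_sum: "(\<And>x. x \<in> X \<Longrightarrow> f x \<in> quadric_ideal) \<Longrightarrow> sum f X \<in> quadric_ideal"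
  by (induction X rule: infinite_finite_induct) (auto simp: quadric_ideal_zero quadric_ideal_add)

lemma constant_S: "Poly_Mapping.single 0 c \<in> carrier S"
  by (auto simp: mpoly_ring_def)

lemma quadric_equiv_refl: "quadric_equiv m m"
  by (simp add: quadric_equiv_def quadric_ideal_zero)

lemma quadric_equiv_sym:
  assumes "quadric_equiv m m'" shows "quadric_equiv m' m"
proof -
  have "Poly_Mapping.single 0 (-1) * (Poly_Mapping.single m 1 - Poly_Mapping.single m' 1) \<in> quadric_ideal"
    using assms unfolding quadric_equiv_def by (rule quadric_ideal_mult[OF _ constant_S])
  then show ?thesis
    by (simp add: quadric_equiv_def single_uminus)
qed

lemma quadric_equiv_trans:
  assumes "quadric_equiv m m'" "quadric_equiv m' m''" shows "quadric_equiv m m''"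
  using quadric_ideal_add[OF assms[unfolded quadric_equiv_def]] by (simp add: quadric_equiv_def)

text \<open>
  Replacing two variables inside a monomial by two others with the same sum is the basic move.
\<close>

lemma quadric_equiv_step:
  assumes "a \<in> A" "b \<in> A" "c \<in> A" "e \<in> A" "a + b = c + e" and m: "Poly_Mapping.keys m \<subseteq> A"
  shows "quadric_equiv (m + Poly_Mapping.single a 1 + Poly_Mapping.single b 1)
           (m + Poly_Mapping.single c 1 + Poly_Mapping.single e 1)"
proof -
  let ?x = "\<lambda>a. Poly_Mapping.single a (1::nat)"
  let ?q = "Poly_Mapping.single (?x a + ?x b) (1::'k) - Poly_Mapping.single (?x c + ?x e) 1"
  have deg: "(\<Sum>v\<in>Poly_Mapping.keys (?x a + ?x b). Poly_Mapping.lookup (?x a + ?x b) v) = 2" for a b :: "nat \<Rightarrow>\<^sub>0 int"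
    unfolding fst_toric_exponent[symmetric] by (simp add: toric_exponent_add)
  have keys2: "Poly_Mapping.keys (?x a + ?x b) \<subseteq> A" if "a \<in> A" "b \<in> A" for a b
    using keys_add[of "?x a" "?x b"] that by auto
  have keysq: "Poly_Mapping.keys ?q \<subseteq> {?x a + ?x b, ?x c + ?x e}"
    by (auto simp: in_keys_iff lookup_minus lookup_single when_def split: if_splits)
  have "?q \<in> homogeneous_component K A 2"
  proof -
    have "Poly_Mapping.keys m \<subseteq> A \<and> (\<Sum>v\<in>Poly_Mapping.keys m. Poly_Mapping.lookup m v) = 2"
      if "m \<in> Poly_Mapping.keys ?q" for m
    proof -
      have "m = ?x a + ?x b \<or> m = ?x c + ?x e"
        using that keysq by blast
      then show ?thesis
        using keys2[OF assms(1,2)] keys2[OF assms(3,4)] deg by (elim disjE) (simp_all only:)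
    qed
    then show ?thesis
      unfolding homogeneous_component_def mpoly_ring_def by simp
  qed
  moreover have "toric_map ?q = 0"
  proof -
    have "toric_map ?q + toric_map (Poly_Mapping.single (?x c + ?x e) 1) = toric_map (Poly_Mapping.single (?x a + ?x b) 1 :: (_, 'k) mpoly)"
      unfolding toric_map_add[symmetric] by simp
    then show ?thesis
      by (simp add: toric_exponent_add assms(5))
  qed
  ultimately have "?q \<in> I \<inter> homogeneous_component K A 2"
    unfolding Int_iff I_iff by (simp add: homogeneous_component_def)
  then have "?q \<in> quadric_ideal"
    unfolding quadric_ideal_def using hom.R.genideal_self[OF quadrics_subset] by blast
  moreover have "Poly_Mapping.single m 1 \<in> carrier S"
    using m by (auto simp: mpoly_ring_def)
  ultimately have "Poly_Mapping.single m 1 * ?q \<in> quadric_ideal"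
    by (rule quadric_ideal_mult)
  then show ?thesis
    by (simp add: quadric_equiv_def right_diff_distrib mult_single add.assoc)
qed

text \<open>
  The toric ideal is spanned by differences of monomials with equal image: subtracting from each
  monomial of \<open>p\<close> a representative of its fibre leaves a combination of the representatives whose
  coefficients are the coefficients of the image of \<open>p\<close>, hence zero.
\<close>

lemma generated_by_quadricsI:
  assumes equiv: "\<And>m m'. Poly_Mapping.keys m \<subseteq> A \<Longrightarrow> Poly_Mapping.keys m' \<subseteq> A \<Longrightarrow>
      toric_exponent m = toric_exponent m' \<Longrightarrow> quadric_equiv m m'"
  shows "generated_by_quadrics K A I"
proof -
  have "quadric_ideal \<subseteq> I"
    unfolding quadric_ideal_def by (rule hom.R.genideal_minimal[OF I_ideal]) simp
  moreover have "p \<in> quadric_ideal" if "p \<in> I" for p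
  proof -
    have p: "p \<in> carrier S" "toric_map p = 0"
      using that unfolding I_iff by simp_all
    define rep where "rep z = (SOME m. m \<in> Poly_Mapping.keys p \<and> toric_exponent m = z)" for z
    have rep: "rep (toric_exponent m) \<in> Poly_Mapping.keys p" "toric_exponent (rep (toric_exponent m)) = toric_exponent m"
      if "m \<in> Poly_Mapping.keys p" for m
    proof -
      have "\<exists>m'. m' \<in> Poly_Mapping.keys p \<and> toric_exponent m' = toric_exponent m"
        using that by blast
      from someI_ex[OF this]
      show "rep (toric_exponent m) \<in> Poly_Mapping.keys p" "toric_exponent (rep (toric_exponent m)) = toric_exponent m"
        unfolding rep_def by simp_all
    qed
    let ?c = "Poly_Mapping.lookup p"
    have "(\<Sum>m\<in>Poly_Mapping.keys p. Poly_Mapping.single (rep (toric_exponent m)) (?c m)) =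
        (\<Sum>z\<in>toric_exponent ` Poly_Mapping.keys p. \<Sum>m\<in>{m\<in>Poly_Mapping.keys p. toric_exponent m = z}.
          Poly_Mapping.single (rep (toric_exponent m)) (?c m))"
      by (rule sum.image_gen) simp
    also have "\<dots> = (\<Sum>z\<in>toric_exponent ` Poly_Mapping.keys p. Poly_Mapping.single (rep z) (Poly_Mapping.lookup (toric_map p) z))"
    proof (rule sum.cong[OF refl])
      fix z
      have "(\<Sum>m\<in>{m\<in>Poly_Mapping.keys p. toric_exponent m = z}. Poly_Mapping.single (rep (toric_exponent m)) (?c m)) =
          (\<Sum>m\<in>{m\<in>Poly_Mapping.keys p. toric_exponent m = z}. Poly_Mapping.single (rep z) (?c m))"
        by (rule sum.cong) auto
      also have "\<dots> = Poly_Mapping.single (rep z) (\<Sum>m\<in>{m\<in>Poly_Mapping.keys p. toric_exponent m = z}. ?c m)"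
        by (rule poly_mapping_eqI) (simp add: lookup_sum lookup_single when_def)
      finally show "(\<Sum>m\<in>{m\<in>Poly_Mapping.keys p. toric_exponent m = z}. Poly_Mapping.single (rep (toric_exponent m)) (?c m)) =
          Poly_Mapping.single (rep z) (Poly_Mapping.lookup (toric_map p) z)"
        by (simp only: lookup_toric_map)
    qed
    also have "\<dots> = 0"
      by (simp add: p(2))
    finally have "p = (\<Sum>m\<in>Poly_Mapping.keys p. Poly_Mapping.single m (?c m)) -
        (\<Sum>m\<in>Poly_Mapping.keys p. Poly_Mapping.single (rep (toric_exponent m)) (?c m))"
      by (simp add: sum_single_lookup)
    also have "\<dots> = (\<Sum>m\<in>Poly_Mapping.keys p.
        Poly_Mapping.single 0 (?c m) * (Poly_Mapping.single m 1 - Poly_Mapping.single (rep (toric_exponent m)) 1))"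
      by (simp add: sum_subtractf right_diff_distrib mult_single)
    also have "\<dots> \<in> quadric_ideal"
    proof (rule quadric_ideal_sum)
      fix m assume m: "m \<in> Poly_Mapping.keys p"
      have "Poly_Mapping.keys m \<subseteq> A" "Poly_Mapping.keys (rep (toric_exponent m)) \<subseteq> A"
        using p(1) m rep(1)[OF m] by (auto simp: mpoly_ring_def)
      then have "quadric_equiv m (rep (toric_exponent m))"
        using rep(2)[OF m] by (intro equiv) auto
      then show "Poly_Mapping.single 0 (?c m) * (Poly_Mapping.single m 1 - Poly_Mapping.single (rep (toric_exponent m)) 1) \<in> quadric_ideal"
        unfolding quadric_equiv_def by (rule quadric_ideal_mult[OF _ constant_S])
    qed
    finally show ?thesis .
  qed
  ultimately have "I = quadric_ideal" by blast
  then show ?thesis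
    unfolding generated_by_quadrics_def quadric_ideal_def
    by (intro exI[of _ "I \<inter> homogeneous_component K A 2"]) auto
qed

end

section \<open>Triangulations from unique representations\<close>

lemma lookup_real_point [simp]: "Poly_Mapping.lookup (real_point a) i = real_of_int (Poly_Mapping.lookup a i)"
  by (simp add: real_point_def Poly_Mapping.map.rep_eq when_def)

lemma lookup_scaleR [simp]: "Poly_Mapping.lookup (r *\<^sub>R x) i = r *\<^sub>R Poly_Mapping.lookup x i"
proof -
  have "finite {i. r *\<^sub>R Poly_Mapping.lookup x i \<noteq> 0}"
    by (rule finite_subset[OF _ finite_lookup[of x]]) auto
  then show ?thesis
    by (simp add: scaleR_poly_mapping_def)
qed

lemma inj_real_point: "inj real_point"
  by (rule injI, rule poly_mapping_eqI) (metis lookup_real_point of_int_eq_iff)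

lemma convex_hull_real_point:
  assumes "finite \<sigma>"
  shows "x \<in> convex hull (real_point ` \<sigma>) \<longleftrightarrow>
    (\<exists>w. (\<forall>a\<in>\<sigma>. 0 \<le> w a) \<and> sum w \<sigma> = 1 \<and> (\<Sum>a\<in>\<sigma>. w a *\<^sub>R real_point a) = x)"
proof
  assume "x \<in> convex hull (real_point ` \<sigma>)"
  then obtain u where "\<forall>y\<in>real_point ` \<sigma>. 0 \<le> u y" "sum u (real_point ` \<sigma>) = 1"
    "(\<Sum>y\<in>real_point ` \<sigma>. u y *\<^sub>R y) = x"
    using assms by (auto simp: convex_hull_finite)
  moreover have "inj_on real_point \<sigma>"
    using inj_real_point by (rule inj_on_subset) simp
  ultimately show "\<exists>w. (\<forall>a\<in>\<sigma>. 0 \<le> w a) \<and> sum w \<sigma> = 1 \<and> (\<Sum>a\<in>\<sigma>. w a *\<^sub>R real_point a) = x"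
    by (intro exI[of _ "u \<circ> real_point"]) (simp add: sum.reindex)
next
  assume "\<exists>w. (\<forall>a\<in>\<sigma>. 0 \<le> w a) \<and> sum w \<sigma> = 1 \<and> (\<Sum>a\<in>\<sigma>. w a *\<^sub>R real_point a) = x"
  then obtain w where "\<forall>a\<in>\<sigma>. 0 \<le> w a" "sum w \<sigma> = 1" "(\<Sum>a\<in>\<sigma>. w a *\<^sub>R real_point a) = x"
    by blast
  moreover from this have "(\<Sum>a\<in>\<sigma>. w a *\<^sub>R real_point a) \<in> convex hull (real_point ` \<sigma>)"
    using assms by (intro convex_sum) (auto intro: hull_inc)
  ultimately show "x \<in> convex hull (real_point ` \<sigma>)"
    by simp
qed

text \<open>
  Every 0/1 vector is a vertex of the cube: where a coordinate of the combination is 0 or 1, all points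
  with positive weight share that coordinate, so a lattice point of the hull equals each of them.
\<close>

lemma lattice_points_zero_one:
  assumes "finite A" and A: "A \<subseteq> {a. Poly_Mapping.keys a \<subseteq> {..<d} \<and> (\<forall>i. Poly_Mapping.lookup a i \<in> {0, 1})}"
  shows "lattice_points d (convex hull (real_point ` A)) = A"
proof
  show "A \<subseteq> lattice_points d (convex hull (real_point ` A))"
    using A by (auto simp: lattice_points_def intro: hull_inc)
next
  show "lattice_points d (convex hull (real_point ` A)) \<subseteq> A"
  proof
    fix a assume "a \<in> lattice_points d (convex hull (real_point ` A))"
    then obtain w where w: "\<forall>b\<in>A. 0 \<le> w b" "sum w A = 1" "(\<Sum>b\<in>A. w b *\<^sub>R real_point b) = real_point a"
      using assms(1) by (auto simp: lattice_points_def convex_hull_real_point)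
    have coord: "(\<Sum>b\<in>A. w b * Poly_Mapping.lookup b i) = Poly_Mapping.lookup a i" for i
      using arg_cong[OF w(3), of "\<lambda>x. Poly_Mapping.lookup x i"] by (simp add: lookup_sum)
    obtain b where b: "b \<in> A" "w b \<noteq> 0"
      using w(2) by (metis sum.neutral zero_neq_one)
    have "Poly_Mapping.lookup a i = Poly_Mapping.lookup b i" for i
    proof -
      have b01: "Poly_Mapping.lookup c i \<in> {0, 1}" if "c \<in> A" for c
        using A that by auto
      have nn: "0 \<le> w c * Poly_Mapping.lookup c i" "0 \<le> w c * (1 - Poly_Mapping.lookup c i)" if "c \<in> A" for c
        using w(1) b01[OF that] that by auto
      have one: "(\<Sum>c\<in>A. w c * (1 - Poly_Mapping.lookup c i)) = 1 - Poly_Mapping.lookup a i"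
        using coord[of i] w(2) by (simp add: right_diff_distrib sum_subtractf)
      have "0 \<le> real_of_int (Poly_Mapping.lookup a i)" "0 \<le> 1 - real_of_int (Poly_Mapping.lookup a i)"
        using sum_nonneg[of A "\<lambda>c. w c * Poly_Mapping.lookup c i"] nn(1)
          sum_nonneg[of A "\<lambda>c. w c * (1 - Poly_Mapping.lookup c i)"] nn(2)
        unfolding coord one by simp_all
      then have "Poly_Mapping.lookup a i = 0 \<or> Poly_Mapping.lookup a i = 1"
        by linarith
      then show ?thesis
      proof
        assume "Poly_Mapping.lookup a i = 0"
        then have "w b * Poly_Mapping.lookup b i = 0"
          using coord[of i] nn(1) b(1) assms(1) by (simp add: sum_nonneg_eq_0_iff)
        with b \<open>Poly_Mapping.lookup a i = 0\<close> show ?thesis by simp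
      next
        assume "Poly_Mapping.lookup a i = 1"
        then have "w b * (1 - Poly_Mapping.lookup b i) = 0"
          using one nn(2) b(1) assms(1) by (simp add: sum_nonneg_eq_0_iff)
        with b \<open>Poly_Mapping.lookup a i = 1\<close> show ?thesis by simp
      qed
    qed
    then have "a = b" by (intro poly_mapping_eqI)
    with b show "a \<in> A" by simp
  qed
qed

text \<open>
  If nonnegative weights whose support is a face are determined by their total and the point they
  represent, then an affine dependence inside a face is impossible (compare its positive and negative
  parts), and the intersection of two simplices is a face of each: weights on \<open>\<sigma>\<close> that represent a
  point of the simplex of \<open>\<tau>\<close> have to vanish outside \<open>\<tau>\<close>.
\<close>

lemma lattice_triangulationI:
  assumes A: "finite A" "A = lattice_points d P" "P = convex hull (real_point ` A)"
    and sub: "\<And>\<sigma>. \<sigma> \<in> \<Delta> \<Longrightarrow> \<sigma> \<subseteq> A"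
    and down: "\<And>\<sigma> \<tau>. \<sigma> \<in> \<Delta> \<Longrightarrow> \<tau> \<subseteq> \<sigma> \<Longrightarrow> \<tau> \<in> \<Delta>"
    and cover: "\<And>x. x \<in> P \<Longrightarrow> \<exists>\<sigma>\<in>\<Delta>. x \<in> geometric_simplex \<sigma>"
    and unique: "\<And>\<alpha> \<beta> :: (nat \<Rightarrow>\<^sub>0 int) \<Rightarrow> real. (\<And>a. a \<in> A \<Longrightarrow> 0 \<le> \<alpha> a) \<Longrightarrow> (\<And>a. a \<in> A \<Longrightarrow> 0 \<le> \<beta> a) \<Longrightarrow>
      {a\<in>A. \<alpha> a \<noteq> 0} \<in> \<Delta> \<Longrightarrow> {a\<in>A. \<beta> a \<noteq> 0} \<in> \<Delta> \<Longrightarrow> sum \<alpha> A = sum \<beta> A \<Longrightarrow>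
      (\<Sum>a\<in>A. \<alpha> a *\<^sub>R real_point a) = (\<Sum>a\<in>A. \<beta> a *\<^sub>R real_point a) \<Longrightarrow> \<forall>a\<in>A. \<alpha> a = \<beta> a"
  shows "lattice_triangulation d P \<Delta>"
proof -
  have fin: "finite \<sigma>" if "\<sigma> \<in> \<Delta>" for \<sigma>
    using sub[OF that] A(1) by (rule finite_subset)
  have weights: "\<exists>w. (\<forall>a\<in>A. 0 \<le> w a) \<and> (\<forall>a. a \<notin> \<sigma> \<longrightarrow> w a = 0) \<and> sum w A = 1 \<and> (\<Sum>a\<in>A. w a *\<^sub>R real_point a) = x"
    if \<sigma>: "\<sigma> \<in> \<Delta>" and x: "x \<in> geometric_simplex \<sigma>" for \<sigma> x
  proof -
    obtain w where w: "\<forall>a\<in>\<sigma>. 0 \<le> w a" "sum w \<sigma> = 1" "(\<Sum>a\<in>\<sigma>. w a *\<^sub>R real_point a) = x"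
      using x fin[OF \<sigma>] by (auto simp: geometric_simplex_def convex_hull_real_point)
    define w' where "w' a = (if a \<in> \<sigma> then w a else 0)" for a
    have "sum w' A = sum w \<sigma>"
      using sub[OF \<sigma>] A(1) by (intro sum.mono_neutral_cong_right) (auto simp: w'_def)
    moreover have "(\<Sum>a\<in>A. w' a *\<^sub>R real_point a) = (\<Sum>a\<in>\<sigma>. w a *\<^sub>R real_point a)"
      using sub[OF \<sigma>] A(1) by (intro sum.mono_neutral_cong_right) (auto simp: w'_def)
    ultimately show ?thesis
      using w by (intro exI[of _ w']) (auto simp: w'_def)
  qed
  have supp: "{a\<in>A. w a \<noteq> 0} \<in> \<Delta>" if "\<sigma> \<in> \<Delta>" "\<forall>a. a \<notin> \<sigma> \<longrightarrow> w a = 0" for \<sigma> and w :: "(nat \<Rightarrow>\<^sub>0 int) \<Rightarrow> real"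
    by (rule down[OF that(1)]) (use that(2) in auto)
  have in_hull: "x \<in> geometric_simplex \<sigma>"
    if "\<sigma> \<in> \<Delta>" "\<forall>a\<in>A. 0 \<le> w a" "\<forall>a\<in>A. a \<notin> \<sigma> \<longrightarrow> w a = 0" "sum w A = 1" "(\<Sum>a\<in>A. w a *\<^sub>R real_point a) = x"
    for \<sigma> w x
  proof -
    have "sum w \<sigma> = sum w A"
      using sub[OF that(1)] A(1) that(3) by (intro sum.mono_neutral_left) auto
    moreover have "(\<Sum>a\<in>\<sigma>. w a *\<^sub>R real_point a) = (\<Sum>a\<in>A. w a *\<^sub>R real_point a)"
      using sub[OF that(1)] A(1) that(3) by (intro sum.mono_neutral_left) auto
    ultimately show ?thesis
      using that sub[OF that(1)] fin[OF that(1)]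
      by (auto simp: geometric_simplex_def convex_hull_real_point intro!: exI[of _ w])
  qed
  have indep: "\<not> affine_dependent (real_point ` \<sigma>)" if \<sigma>: "\<sigma> \<in> \<Delta>" for \<sigma>
  proof
    assume "affine_dependent (real_point ` \<sigma>)"
    then obtain U where U: "sum U (real_point ` \<sigma>) = 0" "\<exists>v\<in>real_point ` \<sigma>. U v \<noteq> 0"
      "(\<Sum>v\<in>real_point ` \<sigma>. U v *\<^sub>R v) = 0"
      using fin[OF \<sigma>] by (auto simp: affine_dependent_explicit_finite)
    define u where "u a = (if a \<in> \<sigma> then U (real_point a) else 0)" for a
    have inj: "inj_on real_point \<sigma>"
      using inj_real_point by (rule inj_on_subset) simp
    have u0: "sum u A = 0"
    proof -
      have "sum u A = sum (U \<circ> real_point) \<sigma>"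
        using sub[OF \<sigma>] A(1) by (intro sum.mono_neutral_cong_right) (auto simp: u_def)
      then show ?thesis using U(1) inj by (simp add: sum.reindex)
    qed
    have ux: "(\<Sum>a\<in>A. u a *\<^sub>R real_point a) = 0"
    proof -
      have "(\<Sum>a\<in>A. u a *\<^sub>R real_point a) = (\<Sum>a\<in>\<sigma>. U (real_point a) *\<^sub>R real_point a)"
        using sub[OF \<sigma>] A(1) by (intro sum.mono_neutral_cong_right) (auto simp: u_def)
      then show ?thesis using U(3) inj by (simp add: sum.reindex)
    qed
    \<comment> \<open>The positive and the negative part of the dependence represent the same point.\<close>
    define p where "p a = max 0 (u a)" for a
    define n where "n a = max 0 (- u a)" for a
    have pn: "u a = p a - n a" for a by (simp add: p_def n_def max_def)
    have "\<forall>a\<in>A. p a = n a"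
    proof (rule unique)
      show "sum p A = sum n A"
        using u0 by (simp add: pn sum_subtractf)
      show "(\<Sum>a\<in>A. p a *\<^sub>R real_point a) = (\<Sum>a\<in>A. n a *\<^sub>R real_point a)"
        using ux by (simp add: pn sum_subtractf scaleR_left_diff_distrib)
      show "{a\<in>A. p a \<noteq> 0} \<in> \<Delta>"
        by (rule supp[OF \<sigma>]) (simp add: p_def u_def)
      show "{a\<in>A. n a \<noteq> 0} \<in> \<Delta>"
        by (rule supp[OF \<sigma>]) (simp add: n_def u_def)
    qed (auto simp: p_def n_def)
    then have "\<forall>a\<in>\<sigma>. U (real_point a) = 0"
      using sub[OF \<sigma>] pn by (auto simp: u_def) (metis diff_self subsetD u_def)
    with U(2) show False by auto
  qed
  have face: "(geometric_simplex \<sigma> \<inter> geometric_simplex \<tau>) face_of geometric_simplex \<sigma>"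
    if \<sigma>: "\<sigma> \<in> \<Delta>" and \<tau>: "\<tau> \<in> \<Delta>" for \<sigma> \<tau>
    unfolding face_of_def
  proof (intro conjI ballI impI)
    show "convex (geometric_simplex \<sigma> \<inter> geometric_simplex \<tau>)"
      by (auto simp: geometric_simplex_def convex_Int)
  next
    fix y z x assume y: "y \<in> geometric_simplex \<sigma>" and z: "z \<in> geometric_simplex \<sigma>"
      and x: "x \<in> geometric_simplex \<sigma> \<inter> geometric_simplex \<tau>" "x \<in> open_segment y z"
    from x(2) obtain t where t: "0 < t" "t < 1" "x = (1 - t) *\<^sub>R y + t *\<^sub>R z"
      by (auto simp: in_segment)
    obtain \<alpha> where \<alpha>: "\<forall>a\<in>A. 0 \<le> \<alpha> a" "\<forall>a. a \<notin> \<sigma> \<longrightarrow> \<alpha> a = 0" "sum \<alpha> A = 1" "(\<Sum>a\<in>A. \<alpha> a *\<^sub>R real_point a) = y"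
      using weights[OF \<sigma> y] by blast
    obtain \<beta> where \<beta>: "\<forall>a\<in>A. 0 \<le> \<beta> a" "\<forall>a. a \<notin> \<sigma> \<longrightarrow> \<beta> a = 0" "sum \<beta> A = 1" "(\<Sum>a\<in>A. \<beta> a *\<^sub>R real_point a) = z"
      using weights[OF \<sigma> z] by blast
    obtain \<gamma> where \<gamma>: "\<forall>a\<in>A. 0 \<le> \<gamma> a" "\<forall>a. a \<notin> \<tau> \<longrightarrow> \<gamma> a = 0" "sum \<gamma> A = 1" "(\<Sum>a\<in>A. \<gamma> a *\<^sub>R real_point a) = x"
      using weights[OF \<tau>] x(1) by blast
    \<comment> \<open>The weights of the inner point \<open>x\<close> mix those of both ends with positive factors, so they cannot vanish unless both do.\<close>
    define \<delta> where "\<delta> a = (1 - t) * \<alpha> a + t * \<beta> a" for a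
    have "\<forall>a\<in>A. \<delta> a = \<gamma> a"
    proof (rule unique)
      show "\<And>a. a \<in> A \<Longrightarrow> 0 \<le> \<delta> a"
        using \<alpha>(1) \<beta>(1) t by (simp add: \<delta>_def)
      show "\<And>a. a \<in> A \<Longrightarrow> 0 \<le> \<gamma> a" using \<gamma>(1) by simp
      show "{a\<in>A. \<delta> a \<noteq> 0} \<in> \<Delta>"
        by (rule supp[OF \<sigma>]) (use \<alpha>(2) \<beta>(2) in \<open>simp add: \<delta>_def\<close>)
      show "{a\<in>A. \<gamma> a \<noteq> 0} \<in> \<Delta>"
        by (rule supp[OF \<tau> \<gamma>(2)])
      have "sum \<delta> A = (1 - t) * sum \<alpha> A + t * sum \<beta> A"
        by (simp add: \<delta>_def[abs_def] sum.distrib sum_distrib_left)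
      then show "sum \<delta> A = sum \<gamma> A"
        by (simp add: \<alpha>(3) \<beta>(3) \<gamma>(3))
      have "(\<Sum>a\<in>A. \<delta> a *\<^sub>R real_point a) =
          (1 - t) *\<^sub>R (\<Sum>a\<in>A. \<alpha> a *\<^sub>R real_point a) + t *\<^sub>R (\<Sum>a\<in>A. \<beta> a *\<^sub>R real_point a)"
        by (simp add: \<delta>_def scaleR_left_distrib sum.distrib scaleR_sum_right)
      then show "(\<Sum>a\<in>A. \<delta> a *\<^sub>R real_point a) = (\<Sum>a\<in>A. \<gamma> a *\<^sub>R real_point a)"
        by (simp add: \<alpha>(4) \<beta>(4) \<gamma>(4) t(3))
    qed
    then have "(1 - t) * \<alpha> a + t * \<beta> a = 0" if "a \<in> A" "a \<notin> \<tau>" for a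
      using that \<gamma>(2) by (auto simp: \<delta>_def)
    moreover have "0 \<le> (1 - t) * \<alpha> a" "0 \<le> t * \<beta> a" if "a \<in> A" for a
      using that \<alpha>(1) \<beta>(1) t by simp_all
    ultimately have "(1 - t) * \<alpha> a = 0 \<and> t * \<beta> a = 0" if "a \<in> A" "a \<notin> \<tau>" for a
      using that by (simp add: add_nonneg_eq_0_iff)
    then have "\<forall>a\<in>A. a \<notin> \<tau> \<longrightarrow> \<alpha> a = 0" "\<forall>a\<in>A. a \<notin> \<tau> \<longrightarrow> \<beta> a = 0"
      using t by auto
    then have "y \<in> geometric_simplex \<tau>" "z \<in> geometric_simplex \<tau>"
      using in_hull[OF \<tau>] \<alpha> \<beta> by blast+
    with y z show "y \<in> geometric_simplex \<sigma> \<inter> geometric_simplex \<tau>" "z \<in> geometric_simplex \<sigma> \<inter> geometric_simplex \<tau>"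
      by simp_all
  qed simp
  have "(\<Union>\<sigma>\<in>\<Delta>. geometric_simplex \<sigma>) = P"
  proof
    show "(\<Union>\<sigma>\<in>\<Delta>. geometric_simplex \<sigma>) \<subseteq> P"
      unfolding geometric_simplex_def A(3) using sub by (intro UN_least hull_mono image_mono)
    show "P \<subseteq> (\<Union>\<sigma>\<in>\<Delta>. geometric_simplex \<sigma>)"
      using cover by auto
  qed
  moreover have "(geometric_simplex \<sigma> \<inter> geometric_simplex \<tau>) face_of geometric_simplex \<tau>"
    if "\<sigma> \<in> \<Delta>" "\<tau> \<in> \<Delta>" for \<sigma> \<tau>
    using face[OF that(2,1)] by (simp add: Int_commute)
  ultimately show ?thesis
    unfolding lattice_triangulation_def using fin sub A(2) indep down face by auto
qed

section \<open>Volumes of unimodular simplices\<close>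

lemma det_Ints:
  fixes M :: "real ^ 'n ^ 'n"
  assumes "\<And>i j. M $ i $ j \<in> \<int>"
  shows "det M \<in> \<int>"
  unfolding det_def by (intro Ints_sum Ints_mult Ints_prod Ints_of_int assms)

text \<open>
  A matrix of integers with an integer inverse has determinant a unit of \<open>\<int>\<close>.
\<close>

lemma abs_det_eq_1:
  fixes M N :: "real ^ 'n ^ 'n"
  assumes "\<And>i j. M $ i $ j \<in> \<int>" "\<And>i j. N $ i $ j \<in> \<int>" "N ** M = mat 1"
  shows "\<bar>det M\<bar> = 1"
proof -
  obtain m n where mn: "det M = of_int m" "det N = of_int n"
    using det_Ints[of M] det_Ints[of N] assms(1,2) by (auto elim!: Ints_cases)
  have "det N * det M = 1"
    using assms(3) by (simp flip: det_mul)
  then have "real_of_int (n * m) = real_of_int 1"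
    unfolding mn by simp
  then have "n * m = 1"
    by (simp only: of_int_eq_iff)
  then have "\<bar>m\<bar> = 1"
    using abs_zmult_eq_1[of m n] by (simp add: mult.commute)
  then show ?thesis
    by (simp add: mn(1) flip: of_int_abs)
qed

text \<open>
  The determinant formula for the content of a simplex lives on \<open>real ^ 'n\<close>, while volumes are measured
  in the product \<open>\<Pi>\<^sub>M {..<d}\<close>; listing the coordinates by \<open>ix\<close> identifies the two measures.
\<close>

lemma distr_lborel_vec:
  fixes ix :: "'n::finite \<Rightarrow> nat"
  assumes ix: "bij_betw ix UNIV {..<d}"
  shows "distr lborel (Pi\<^sub>M {..<d} (\<lambda>_. lborel)) (\<lambda>y :: real ^ 'n. \<lambda>i\<in>{..<d}. y $ inv_into UNIV ix i) =
    Pi\<^sub>M {..<d} (\<lambda>_. lborel)"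
proof -
  interpret product_sigma_finite "\<lambda>_ :: nat. lborel :: real measure" by standard
  interpret B: product_sigma_finite "\<lambda>_ :: real ^ 'n. lborel :: real measure" by standard
  let ?b = "\<lambda>i. axis (inv_into UNIV ix i) 1 :: real ^ 'n"
  have inv_ix_facts: "inv_into UNIV ix i \<in> UNIV" "ix (inv_into UNIV ix i) = i" if "i < d" for i
    using ix that by (auto simp: bij_betw_def f_inv_into_f)
  have inj: "inj_on ?b {..<d}"
    by (rule inj_onI) (metis axis_eq_axis inv_ix_facts(2) lessThan_iff zero_neq_one)
  have Basis: "(Basis :: (real ^ 'n) set) = ?b ` {..<d}"
  proof -
    have "inv_into UNIV ix ` {..<d} = UNIV"
      using ix by (metis bij_betw_def inv_into_image_cancel subset_UNIV bij_betw_imp_surj_on bij_betw_inv_into)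
    then have "?b ` {..<d} = range (\<lambda>k. axis k 1)" 
      by (simp flip: image_image[of "\<lambda>k. axis k 1" "inv_into UNIV ix"])
    then show ?thesis
      by (auto simp: Basis_vec_def)
  qed
  let ?g = "\<lambda>y :: real ^ 'n. \<lambda>i\<in>{..<d}. y $ inv_into UNIV ix i"
  let ?M = "Pi\<^sub>M {..<d} (\<lambda>_. lborel :: real measure)"
  have meas_nth: "(\<lambda>y :: real ^ 'n. y $ k) \<in> borel_measurable borel" for k
    by (intro borel_measurable_continuous_onI continuous_intros)
  have g: "?g \<in> measurable lborel ?M"
    using meas_nth by (intro measurable_restrict) (simp add: measurable_lborel1)
  show ?thesis
  proof (rule PiM_eqI)
    fix X assume X: "\<And>i. i \<in> {..<d} \<Longrightarrow> X i \<in> sets (lborel :: real measure)"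
    define Y where "Y b = X (the_inv_into {..<d} ?b b)" for b
    have Yb: "Y (?b i) = X i" if "i < d" for i
      using the_inv_into_f_f[OF inj, of i] that by (simp add: Y_def)
    have box: "Pi\<^sub>E {..<d} X \<in> sets ?M"
      using X by (intro sets_PiM_I_finite) auto
    let ?s = "\<lambda>f. \<Sum>b\<in>Basis. f b *\<^sub>R b :: real ^ 'n"
    have s: "?s \<in> measurable (Pi\<^sub>M Basis (\<lambda>b. lborel)) borel"
      by measurable
    have box_vimage: "?s -` (?g -` Pi\<^sub>E {..<d} X) \<inter> space (Pi\<^sub>M (Basis :: (real ^ 'n) set) (\<lambda>b. lborel)) = Pi\<^sub>E Basis Y"
    proof -
      have nth: "?s f $ inv_into UNIV ix i = f (?b i)" if "i < d" for f i
      proof -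
        have "?s f $ inv_into UNIV ix i = ?s f \<bullet> ?b i"
          by (simp add: inner_axis)
        also have "\<dots> = f (?b i)"
          using that Basis by (simp add: inner_sum_left inner_Basis if_distrib cong: if_cong)
        finally show ?thesis .
      qed
      show ?thesis
      proof (rule equalityI; rule subsetI)
        fix f assume f: "f \<in> ?s -` (?g -` Pi\<^sub>E {..<d} X) \<inter> space (Pi\<^sub>M (Basis :: (real ^ 'n) set) (\<lambda>b. lborel))"
        then have "?g (?s f) \<in> Pi\<^sub>E {..<d} X" by simp
        then have "f (?b i) \<in> X i" if "i < d" for i
          using PiE_mem[of "?g (?s f)" "{..<d}" X i] that nth[OF that, of f] by simp
        then show "f \<in> Pi\<^sub>E Basis Y"
          using f Yb unfolding Basis by (auto simp: PiE_iff space_PiM)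
      next
        fix f assume f: "f \<in> Pi\<^sub>E Basis Y"
        then have "f (?b i) \<in> X i" if "i < d" for i
          using that Yb[OF that] Basis by (metis PiE_mem imageI lessThan_iff)
        with f nth show "f \<in> ?s -` (?g -` Pi\<^sub>E {..<d} X) \<inter> space (Pi\<^sub>M (Basis :: (real ^ 'n) set) (\<lambda>b. lborel))"
          by (auto simp: PiE_iff space_PiM)
      qed
    qed
    have gX: "?g -` Pi\<^sub>E {..<d} X \<in> sets borel"
      using measurable_sets[OF g box] by simp
    have "emeasure lborel (?g -` Pi\<^sub>E {..<d} X) = emeasure (Pi\<^sub>M Basis (\<lambda>b. lborel)) (Pi\<^sub>E Basis Y)"
    proof -
      have "(lborel :: (real ^ 'n) measure) = distr (Pi\<^sub>M Basis (\<lambda>b. lborel)) borel ?s"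
        by (simp only: lborel_def[where 'a = "real ^ 'n"] lborel_eq_real)
      then have "emeasure lborel (?g -` Pi\<^sub>E {..<d} X) =
          emeasure (distr (Pi\<^sub>M Basis (\<lambda>b. lborel)) borel ?s) (?g -` Pi\<^sub>E {..<d} X)"
        by (rule arg_cong)
      then show ?thesis
        using emeasure_distr[OF s gX] box_vimage by simp
    qed
    also have "\<dots> = (\<Prod>b\<in>Basis. emeasure lborel (Y b))"
      using X Yb by (intro B.emeasure_PiM) (auto simp: Basis)
    also have "\<dots> = (\<Prod>i<d. emeasure lborel (X i))"
      unfolding Basis using Yb by (subst prod.reindex[OF inj]) (simp add: )
    finally show "emeasure (distr lborel ?M ?g) (Pi\<^sub>E {..<d} X) = (\<Prod>i\<in>{..<d}. emeasure lborel (X i))"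
      using g box by (simp add: emeasure_distr)
  qed simp_all
qed

text \<open>
  The integer matrix of the barycentric coordinates \<open>f\<^sub>j\<close> is inverse to the matrix of the
  edge vectors at one vertex, so the determinant of the latter is a unit.
\<close>

lemma normalized_volume_simplex:
  fixes v :: "nat \<Rightarrow> (nat \<Rightarrow>\<^sub>0 int)" and c :: "nat \<Rightarrow> int" and l :: "nat \<Rightarrow> nat \<Rightarrow> int"
  assumes card: "CARD('n::{finite,wellorder}) = d"
    and bary: "\<And>j k. j \<le> d \<Longrightarrow> k \<le> d \<Longrightarrow>
      c j + (\<Sum>i<d. l j i * Poly_Mapping.lookup (v k) i) = (if j = k then 1 else 0)"
  shows "normalized_volume d (geometric_simplex (v ` {..d})) = 1"
proof -
  obtain ix :: "'n \<Rightarrow> nat" where ix: "bij_betw ix UNIV {..<d}"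
    using card finite_same_card_bij[of "UNIV :: 'n set" "{..<d}"] by auto
  have ix_less: "ix n < d" for n
    using ix by (auto simp: bij_betw_def)
  have inv_ix: "inv_into UNIV ix (ix n) = n" for n
    using ix by (simp add: bij_betw_def inv_into_f_f)
  have ix_inv: "ix (inv_into UNIV ix i) = i" if "i < d" for i
    using ix that by (auto simp: bij_betw_def f_inv_into_f)
  define L :: "(nat \<Rightarrow>\<^sub>0 real) \<Rightarrow> (real, 'n) vec" where "L x = (\<chi> n. Poly_Mapping.lookup x (ix n))" for x
  have L: "linear L"
    by (rule linearI) (auto simp: L_def vec_eq_iff lookup_add)
  define q where "q k = L (real_point (v k))" for k
  have q_nth: "q k $ n = of_int (Poly_Mapping.lookup (v k) (ix n))" for k n
    by (simp add: q_def L_def)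
  have fq: "of_int (c j) + (\<Sum>n\<in>UNIV. of_int (l j (ix n)) * q k $ n) = (if j = k then 1 else (0 :: real))"
    if "j \<le> d" "k \<le> d" for j k
  proof -
    have "(\<Sum>n\<in>UNIV. of_int (l j (ix n)) * q k $ n) = (\<Sum>i<d. of_int (l j i * Poly_Mapping.lookup (v k) i) :: real)"
      using sum.reindex_bij_betw[OF ix, of "\<lambda>i. of_int (l j i * Poly_Mapping.lookup (v k) i) :: real"]
      by (simp add: q_nth)
    then have "of_int (c j) + (\<Sum>n\<in>UNIV. of_int (l j (ix n)) * q k $ n) =
        of_int (c j + (\<Sum>i<d. l j i * Poly_Mapping.lookup (v k) i))"
      by simp
    then show ?thesis
      by (simp add: bary[OF that])
  qed
  have inj: "inj_on q {..d}"
  proof (rule inj_onI)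
    fix j k assume "j \<in> {..d}" "k \<in> {..d}" "q j = q k"
    then show "j = k"
      using fq[of j k] fq[of j j] by (auto split: if_splits)
  qed
  define M :: "((real, 'n) vec, 'n) vec" where "M = (\<chi> i. \<chi> j. q (Suc (ix j)) $ i - q 0 $ i)"
  define N :: "((real, 'n) vec, 'n) vec" where "N = (\<chi> j. \<chi> i. of_int (l (Suc (ix j)) (ix i)))"
  have "N ** M = mat 1"
  proof -
    have "(\<Sum>i\<in>UNIV. N $ j $ i * M $ i $ k) = (if j = k then 1 else 0)" for j k
    proof -
      have "(\<Sum>i\<in>UNIV. N $ j $ i * M $ i $ k) =
          (of_int (c (Suc (ix j))) + (\<Sum>i\<in>UNIV. of_int (l (Suc (ix j)) (ix i)) * q (Suc (ix k)) $ i)) -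
          (of_int (c (Suc (ix j))) + (\<Sum>i\<in>UNIV. of_int (l (Suc (ix j)) (ix i)) * q 0 $ i))"
        by (simp add: N_def M_def right_diff_distrib sum_subtractf)
      also have "\<dots> = (if Suc (ix j) = Suc (ix k) then 1 else 0)"
        using ix_less[of j] ix_less[of k] by (subst (1 2) fq) auto
      also have "\<dots> = (if j = k then 1 else 0)"
        using inv_ix by (metis Suc_inject)
      finally show ?thesis .
    qed
    then show ?thesis
      by (simp add: matrix_matrix_mult_def mat_def vec_eq_iff)
  qed
  then have det: "\<bar>det M\<bar> = 1"
    by (intro abs_det_eq_1[of M N]) (auto simp: M_def N_def q_nth)
  have "measure lborel (convex hull (q ` {..d})) = \<bar>det M\<bar> / fact CARD('n)"
    unfolding M_def
  proof (rule content_simplex)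
    show "card (q ` {..d}) = Suc CARD('n)"
      using inj by (simp add: card_image card)
    show "q 0 \<in> q ` {..d}" by simp
    have "bij_betw (\<lambda>n. Suc (ix n)) UNIV {1..d}"
      using bij_betw_trans[OF ix, of Suc "{1..d}"] by (simp add: o_def bij_betw_def image_Suc_lessThan)
    moreover have "bij_betw q {1..d} (q ` {..d} - {q 0})"
    proof -
      have "q ` {..d} - {q 0} = q ` ({..d} - {0})"
        using inj by (subst inj_on_image_set_diff[of q "{..d}"]) auto
      moreover have "{..d} - {0} = {1..d}" by auto
      ultimately show ?thesis
        using inj by (auto simp: bij_betw_def intro: inj_on_subset)
    qed
    ultimately show "bij_betw (\<lambda>n. q (Suc (ix n))) UNIV (q ` {..d} - {q 0})"
      using bij_betw_trans by (fastforce simp: o_def)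
  qed simp
  then have vol: "measure lborel (convex hull (q ` {..d})) = 1 / fact d"
    by (simp add: det card)
  let ?S = "geometric_simplex (v ` {..d})"
  let ?T = "(\<lambda>x. restrict (Poly_Mapping.lookup x) {..<d}) ` ?S"
  let ?g = "\<lambda>y :: (real, 'n) vec. \<lambda>i\<in>{..<d}. y $ inv_into UNIV ix i"
  let ?P = "Pi\<^sub>M {..<d} (\<lambda>_. lborel :: real measure)"
  have hull: "L ` ?S = convex hull (q ` {..d})"
    unfolding geometric_simplex_def by (simp add: convex_hull_linear_image[OF L] image_image q_def)
  have gL: "?g (L x) = restrict (Poly_Mapping.lookup x) {..<d}" for x
    by (auto simp: L_def ix_inv restrict_def)
  have g_inj: "y = z" if "?g y = ?g z" for y z
  proof -
    have "y $ n = z $ n" for n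
      using fun_cong[OF that, of "ix n"] ix_less[of n] by (simp add: inv_ix)
    then show ?thesis by (simp add: vec_eq_iff)
  qed
  have T: "?T = ?g ` (L ` ?S)"
    by (simp add: image_image gL)
  have vimage: "?g -` ?T = L ` ?S"
    unfolding T using g_inj by auto
  define h :: "(nat \<Rightarrow> real) \<Rightarrow> (real, 'n) vec" where "h z = (\<Sum>n\<in>UNIV. z (ix n) *\<^sub>R axis n 1)" for z
  have h_nth: "h z $ n = z (ix n)" for z n
    by (simp add: h_def axis_def if_distrib cong: if_cong)
  have "(\<lambda>z. z i) \<in> borel_measurable ?P" if "i < d" for i
    using measurable_component_singleton[of i "{..<d}" "\<lambda>_. lborel :: real measure"] that
    unfolding measurable_lborel1 by simp
  then have h: "h \<in> borel_measurable ?P"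
    unfolding h_def[abs_def] using ix_less
    by (intro borel_measurable_sum borel_measurable_scaleR borel_measurable_const) auto
  have "?T = h -` (L ` ?S) \<inter> space ?P"
  proof (rule equalityI; rule subsetI)
    fix z assume "z \<in> ?T"
    then obtain x where x: "x \<in> ?S" "z = ?g (L x)" unfolding T by blast
    then have "h z = L x"
      using ix_less by (simp add: vec_eq_iff h_nth inv_ix)
    then show "z \<in> h -` (L ` ?S) \<inter> space ?P"
      using x by (auto simp: space_PiM)
  next
    fix z assume "z \<in> h -` (L ` ?S) \<inter> space ?P"
    then have "h z \<in> L ` ?S" "z \<in> extensional {..<d}"
      by (auto simp: space_PiM PiE_def)
    moreover have "?g (h z) = z"
      using \<open>z \<in> extensional {..<d}\<close> by (auto simp: h_nth ix_inv extensional_def restrict_def)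
    ultimately show "z \<in> ?T"
      unfolding T by (intro image_eqI[of _ _ "h z"]) (simp_all only:)
  qed
  moreover have "L ` ?S \<in> sets borel"
    unfolding hull by (intro borel_closed compact_imp_closed compact_convex_hull finite_imp_compact) simp
  ultimately have T_sets: "?T \<in> sets ?P"
    using measurable_sets[OF h] by simp
  have g: "?g \<in> measurable lborel ?P"
  proof -
    have "(\<lambda>y :: (real, 'n) vec. y $ k) \<in> borel_measurable borel" for k
      by (intro borel_measurable_continuous_onI continuous_intros)
    then show ?thesis
      by (intro measurable_restrict) (simp add: measurable_lborel1)
  qed
  have "measure ?P ?T = measure (distr lborel ?P ?g) ?T"
    by (simp only: distr_lborel_vec[OF ix])
  also have "\<dots> = measure lborel (convex hull (q ` {..d}))"
    using measure_distr[OF g T_sets] by (simp add: vimage hull)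
  finally show ?thesis
    by (simp add: normalized_volume_def euclidean_volume_def vol)
qed

section \<open>The configuration\<close>

text \<open>
  The vertices are listed in lexicographic order; everywhere below they are referred to by their
  position \<open>0, \<dots>, 14\<close> in this list.
\<close>

definition vertices :: "int list list" where
  "vertices = [[0, 0, 0, 1, 1], [0, 0, 1, 1, 0], [0, 0, 1, 1, 1], [0, 1, 0, 0, 0], [0, 1, 0, 1, 0], [0, 1, 0, 1, 1], [0, 1, 1, 0, 0], [0, 1, 1, 1, 0], [1, 0, 0, 0, 0], [1, 0, 0, 1, 0], [1, 0, 1, 1, 0], [1, 1, 0, 0, 0], [1, 1, 0, 0, 1], [1, 1, 0, 1, 0], [1, 1, 0, 1, 1]]"

definition pt :: "nat \<Rightarrow> (nat \<Rightarrow>\<^sub>0 int)" where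
  "pt i = (\<Sum>c<5. Poly_Mapping.single c (vertices ! i ! c))"

definition nonedges :: "(nat \<times> nat) list" where
  "nonedges = [(0, 6), (0, 7), (0, 10), (1, 5), (1, 11), (1, 12), (1, 13), (1, 14), (3, 9), (3, 10), (3, 13), (3, 14), (4, 6), (4, 12), (4, 14), (5, 8), (5, 9), (5, 10), (6, 9), (6, 13), (7, 9), (7, 12), (8, 13), (8, 14), (12, 13)]"

text \<open>
  Coefficients \<open>c\<^sub>0, \<dots>, c\<^sub>5\<close> of the inequalities \<open>c\<^sub>0 + c\<^sub>1 x\<^sub>1 + \<dots> + c\<^sub>5 x\<^sub>5 \<ge> 0\<close> that define the polytope.
\<close>

definition facets :: "int list list" where
  "facets = [
     [-1, 1, 1, 0, 1, 0],
     [-1, 1, 1, 0, 2, -1],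
     [-1, 1, 1, 1, 0, 1],
     [0, 0, 0, 0, 0, 1],
     [0, 0, 0, 0, 1, 0],
     [0, 0, 0, 1, 0, 0],
     [0, 0, 1, -1, 1, 0],
     [0, 0, 1, 0, 0, 0],
     [0, 1, 0, 0, 0, 0],
     [0, 1, 0, 0, 1, -1],
     [1, -1, 0, -1, 1, 0],
     [1, -1, 0, 0, 0, 0],
     [1, -1, 1, -2, 2, -1],
     [1, -1, 1, 0, 0, -1],
     [1, 0, -1, 0, 0, 0],
     [1, 0, 0, -1, 0, 0],
     [1, 0, 0, 0, -1, 0],
     [1, 0, 0, 0, 0, -1],
     [2, -1, -1, -1, 0, 0],
     [2, 0, -1, -1, 0, -1],
     [3, -1, -1, -2, 0, -1]]"

text \<open>
  The maximal simplices: a list of six vertices, and in the same order the barycentric coordinates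
  of the simplex as affine forms, in the format of \<open>facets\<close>. All of them share the vertex \<open>2\<close>.
\<close>

definition cells :: "(nat list \<times> int list list) list" where
  "cells = [
     ([0,1,2,3,4,8],
        [[1,-1,-1,-1,0,0],[1,-1,-1,0,0,-1],[-1,1,1,1,0,1],[1,-1,0,0,-1,0],[-1,1,1,0,1,0],[0,1,0,0,0,0]]),
     ([0,1,2,4,8,9],
        [[1,-1,-1,-1,0,0],[1,-1,-1,0,0,-1],[-1,1,1,1,0,1],[0,0,1,0,0,0],[1,0,0,0,-1,0],[-1,1,0,0,1,0]]),
     ([0,2,3,4,5,11],
        [[1,0,-1,-1,0,0],[0,0,0,1,0,0],[1,-1,0,0,-1,0],[0,0,0,0,1,-1],[-1,0,1,0,0,1],[0,1,0,0,0,0]]),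
     ([0,2,3,4,8,11],
        [[0,0,0,-1,0,1],[0,0,0,1,0,0],[1,-1,0,0,-1,0],[0,0,0,0,1,-1],[1,0,-1,0,0,-1],[-1,1,1,0,0,1]]),
     ([0,2,3,5,11,12],
        [[1,0,-1,-1,0,0],[0,0,0,1,0,0],[1,-1,0,0,-1,0],[-1,0,1,0,1,0],[0,1,0,0,1,-1],[0,0,0,0,-1,1]]),
     ([0,2,3,8,11,12],
        [[0,0,0,-1,1,0],[0,0,0,1,0,0],[1,-1,0,0,-1,0],[1,0,-1,0,-1,0],[-1,1,1,0,2,-1],[0,0,0,0,-1,1]]),
     ([0,2,4,5,11,13],
        [[1,0,-1,-1,0,0],[0,0,0,1,0,0],[1,-1,0,0,0,-1],[-1,0,1,0,0,1],[1,0,0,0,-1,0],[-1,1,0,0,1,0]]),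
     ([0,2,4,8,9,11],
        [[0,0,0,-1,0,1],[0,0,0,1,0,0],[1,-1,0,0,0,-1],[2,-1,-1,0,-1,-1],[-1,1,0,0,1,0],[-1,1,1,0,0,1]]),
     ([0,2,4,9,11,13],
        [[0,0,0,-1,0,1],[0,0,0,1,0,0],[1,-1,0,0,0,-1],[1,0,-1,0,0,-1],[1,0,0,0,-1,0],[-2,1,1,0,1,1]]),
     ([0,2,5,11,12,14],
        [[1,0,-1,-1,0,0],[0,0,0,1,0,0],[0,-1,1,0,0,0],[1,0,0,0,0,-1],[0,0,0,0,-1,1],[-1,1,0,0,1,0]]),
     ([0,2,5,11,13,14],
        [[1,0,-1,-1,0,0],[0,0,0,1,0,0],[0,-1,1,0,0,0],[1,0,0,0,-1,0],[0,0,0,0,1,-1],[-1,1,0,0,0,1]]),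
     ([0,2,8,9,11,12],
        [[1,-1,0,-1,0,0],[0,0,0,1,0,0],[1,0,-1,0,-1,0],[-1,1,0,0,1,0],[1,-1,1,0,0,-1],[-1,1,0,0,0,1]]),
     ([0,2,9,11,12,14],
        [[1,-1,0,-1,0,0],[0,0,0,1,0,0],[0,1,-1,0,0,0],[1,-1,1,0,0,-1],[0,1,-1,0,-1,1],[-1,0,1,0,1,0]]),
     ([0,2,9,11,13,14],
        [[1,-1,0,-1,0,0],[0,0,0,1,0,0],[0,1,-1,0,0,0],[1,0,0,0,-1,0],[0,-1,1,0,1,-1],[-1,1,0,0,0,1]]),
     ([1,2,3,4,7,8],
        [[1,-1,-1,0,0,-1],[0,0,0,0,0,1],[1,-1,0,0,-1,0],[0,0,0,-1,1,0],[-1,1,1,1,0,0],[0,1,0,0,0,0]]),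
     ([1,2,3,6,7,8],
        [[1,-1,-1,0,0,-1],[0,0,0,0,0,1],[1,-1,0,-1,0,0],[0,0,0,1,-1,0],[-1,1,1,0,1,0],[0,1,0,0,0,0]]),
     ([1,2,4,7,8,10],
        [[1,-1,-1,0,0,-1],[0,0,0,0,0,1],[0,0,0,-1,1,0],[0,0,1,1,-1,0],[1,0,0,0,-1,0],[-1,1,0,0,1,0]]),
     ([1,2,4,8,9,10],
        [[1,-1,-1,0,0,-1],[0,0,0,0,0,1],[0,0,1,0,0,0],[1,0,0,0,-1,0],[0,0,-1,-1,1,0],[-1,1,1,1,0,0]]),
     ([1,2,6,7,8,10],
        [[1,-1,-1,0,0,-1],[0,0,0,0,0,1],[0,0,0,1,-1,0],[0,0,1,-1,1,0],[1,0,0,-1,0,0],[-1,1,0,1,0,0]]),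
     ([2,3,4,5,7,11],
        [[1,0,-1,0,0,0],[1,-1,0,0,-1,0],[1,0,-1,-1,1,-1],[-1,0,1,0,0,1],[-1,0,1,1,0,0],[0,1,0,0,0,0]]),
     ([2,3,4,7,8,11],
        [[0,0,0,0,0,1],[1,-1,0,0,-1,0],[0,0,0,-1,1,0],[0,0,0,1,0,-1],[1,0,-1,0,0,-1],[-1,1,1,0,0,1]]),
     ([2,3,5,6,7,11],
        [[1,0,-1,0,0,0],[2,-1,-1,-1,0,-1],[-1,0,1,0,0,1],[-1,0,1,1,-1,1],[0,0,0,0,1,-1],[0,1,0,0,0,0]]),
     ([2,3,5,6,11,12],
        [[1,0,-1,0,0,0],[2,-1,-1,-1,-1,0],[-1,0,1,0,1,0],[-1,0,1,1,0,0],[0,1,0,0,1,-1],[0,0,0,0,-1,1]]),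
     ([2,3,6,7,8,11],
        [[0,0,0,0,0,1],[1,-1,0,-1,0,0],[0,0,0,1,-1,0],[0,0,0,0,1,-1],[1,0,-1,0,0,-1],[-1,1,1,0,0,1]]),
     ([2,3,6,8,11,12],
        [[0,0,0,0,1,0],[1,-1,0,-1,0,0],[0,0,0,1,-1,0],[1,0,-1,0,-1,0],[-1,1,1,0,2,-1],[0,0,0,0,-1,1]]),
     ([2,4,5,7,11,13],
        [[1,0,-1,0,0,0],[2,-1,-1,-1,0,-1],[-1,0,1,0,0,1],[-1,0,1,1,0,0],[1,0,0,0,-1,0],[-1,1,0,0,1,0]]),
     ([2,4,7,8,10,11],
        [[0,0,0,0,0,1],[0,0,0,-1,1,0],[1,-1,0,1,-1,-1],[2,-1,-1,0,-1,-1],[-1,1,0,0,1,0],[-1,1,1,0,0,1]]),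
     ([2,4,7,10,11,13],
        [[0,0,0,0,0,1],[2,-1,-1,-1,0,-1],[-1,0,1,1,0,0],[1,0,-1,0,0,-1],[1,0,0,0,-1,0],[-2,1,1,0,1,1]]),
     ([2,4,8,9,10,11],
        [[0,0,0,0,0,1],[1,-1,0,0,0,-1],[2,-1,-1,0,-1,-1],[-1,1,0,-1,1,1],[0,0,0,1,0,-1],[-1,1,1,0,0,1]]),
     ([2,4,9,10,11,13],
        [[0,0,0,0,0,1],[1,-1,0,0,0,-1],[1,0,-1,-1,0,0],[0,0,0,1,0,-1],[1,0,0,0,-1,0],[-2,1,1,0,1,1]]),
     ([2,5,6,7,11,14],
        [[1,0,-1,0,0,0],[1,-1,0,-1,0,0],[-1,0,1,1,-1,1],[0,0,0,0,1,-1],[2,0,-1,-1,0,-1],[-2,1,1,1,0,1]]),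
     ([2,5,6,11,12,14],
        [[1,0,-1,0,0,0],[1,-1,0,-1,0,0],[-1,0,1,1,0,0],[2,0,-1,-1,0,-1],[0,0,0,0,-1,1],[-2,1,1,1,1,0]]),
     ([2,5,7,11,13,14],
        [[1,0,-1,0,0,0],[1,-1,0,-1,0,0],[-1,0,1,1,0,0],[1,0,0,0,-1,0],[1,0,-1,-1,1,-1],[-2,1,1,1,0,1]]),
     ([2,6,7,8,10,11],
        [[0,0,0,0,0,1],[0,0,0,1,-1,0],[1,-1,0,-1,1,-1],[2,-1,-1,-1,0,-1],[-1,1,0,1,0,0],[-1,1,1,0,0,1]]),
     ([2,6,7,10,11,14],
        [[2,-1,-1,-1,0,0],[-2,1,1,2,-1,1],[1,-1,0,-1,1,-1],[-1,1,0,1,0,0],[3,-1,-1,-2,0,-1],[-2,1,1,1,0,1]]),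
     ([2,6,8,10,11,12],
        [[1,-1,0,-1,1,0],[0,0,0,1,-1,0],[1,0,-1,0,-1,0],[-1,1,0,1,0,0],[1,-1,1,-2,2,-1],[-1,1,0,1,-1,1]]),
     ([2,6,10,11,12,14],
        [[2,-1,-1,-1,0,0],[-1,0,1,1,0,0],[-1,1,0,1,0,0],[3,-1,-1,-2,0,-1],[-1,1,0,1,-1,1],[-1,0,1,0,1,0]]),
     ([2,7,10,11,13,14],
        [[2,-1,-1,-1,0,0],[-1,0,1,1,0,0],[-1,1,0,1,0,0],[1,0,0,0,-1,0],[2,-1,-1,-2,1,-1],[-2,1,1,1,0,1]]),
     ([2,8,9,10,11,12],
        [[1,-1,0,0,0,0],[1,0,-1,0,-1,0],[0,0,0,-1,1,0],[-1,1,0,1,0,0],[1,-1,1,0,0,-1],[-1,1,0,0,0,1]]),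
     ([2,9,10,11,12,14],
        [[1,-1,0,0,0,0],[1,0,-1,-1,0,0],[-1,1,0,1,0,0],[1,-1,1,0,0,-1],[0,1,-1,0,-1,1],[-1,0,1,0,1,0]]),
     ([2,9,10,11,13,14],
        [[1,-1,0,0,0,0],[1,0,-1,-1,0,0],[-1,1,0,1,0,0],[1,0,0,0,-1,0],[0,-1,1,0,1,-1],[-1,1,0,0,0,1]])]"

text \<open>
  A decision tree with 52 leaves whose branching hyperplanes are walls between cells; it returns the position
  in \<open>cells\<close> of a simplex that contains the point. Some cells occur at several leaves because the
  tree cuts through them.
\<close>

definition locate :: "(nat \<Rightarrow> real) \<Rightarrow> nat" where
  "locate x = (if x 0 + x 1 + x 4 \<le> 1
      then (if x 3 \<le> x 2
        then (if x 0 + x 2 \<le> 1 then 15 else 18)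
        else (if x 0 + x 3 \<le> 1
          then (if x 0 + x 1 + x 2 \<le> 1 then 0 else 14)
          else (if x 3 \<le> x 1 + x 2
            then 16
            else (if x 0 + x 1 + x 2 \<le> 1 then 1 else 17))))
      else (if x 0 + x 2 \<le> 1
        then (if x 0 + x 3 \<le> 1
          then (if x 4 \<le> x 3
            then (if x 1 + x 4 \<le> 1
              then (if x 4 \<le> x 2
                then (if x 3 \<le> x 2 then 23 else 20)
                else 3)
              else (if x 1 + x 2 + x 4 \<le> 1 + x 3
                then (if x 1 + x 2 \<le> 1 then 2 else 19)
                else (if x 0 + x 1 + x 2 + x 4 \<le> 2 then 21 else 30)))
            else (if x 1 + x 3 \<le> 1
              then (if x 3 \<le> x 2 then 24 else 5)
              else (if x 0 + x 1 + x 2 + x 3 \<le> 2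
                then (if x 1 + x 2 \<le> 1 then 4 else 22)
                else 31)))
          else (if x 1 + x 2 \<le> 1
            then (if x 0 + x 4 \<le> 1
              then (if x 4 \<le> x 2
                then (if x 0 + x 3 + x 4 \<le> 1 + x 2
                  then 26
                  else (if x 0 + x 1 + x 3 + x 4 \<le> 2 then 28 else 29))
                else (if x 1 + x 4 \<le> 1
                  then (if x 0 + x 1 + x 3 + x 4 \<le> 2 then 7 else 8)
                  else 6))
              else (if x 1 \<le> x 0
                then (if x 1 + x 3 \<le> x 0 + x 4
                  then (if x 1 + x 3 \<le> 1 then 11 else 12)
                  else 13)
                else (if x 4 \<le> x 3 then 10 else 9)))
            else (if x 0 + x 1 + x 2 + x 4 \<le> 2
              then (if x 1 + x 4 \<le> 1
                then (if x 0 + x 1 + x 3 + x 4 \<le> 2 then 26 else 27)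
                else 25)
              else (if x 4 \<le> x 3
                then (if x 1 + x 2 + x 4 \<le> 1 + x 3 then 32 else 30)
                else 31))))
        else (if x 0 + x 2 + x 4 \<le> 1 + x 3
          then (if x 3 \<le> x 2
            then (if x 0 + x 1 + x 2 + x 4 \<le> 2 then 33 else 34)
            else (if x 1 + x 2 \<le> 1
              then (if x 0 + x 4 \<le> 1
                then (if x 0 + x 3 + x 4 \<le> 1 + x 2
                  then 26
                  else (if x 0 + x 1 + x 3 + x 4 \<le> 2 then 28 else 29))
                else (if x 1 + x 3 \<le> x 0 + x 4
                  then (if x 1 + x 3 \<le> 1 then 38 else 39)
                  else 40))
              else (if x 0 + x 1 + x 2 + x 4 \<le> 2
                then (if x 0 + x 1 + x 3 + x 4 \<le> 2 then 26 else 27)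
                else (if x 0 + x 1 + 2 * x 2 + x 4 \<le> 2 + x 3 then 37 else 34))))
          else (if x 1 + x 3 \<le> 1
            then (if x 3 \<le> x 2 then 35 else 38)
            else (if x 1 + x 2 \<le> 1 then 39 else 36)))))"

text \<open>
  An entry \<open>(i, j, k, l)\<close> stands for the relation \<open>x\<^sub>i x\<^sub>j = x\<^sub>k x\<^sub>l\<close>, oriented so that the weight decreases.
\<close>

definition moves :: "(nat \<times> nat \<times> nat \<times> nat) list" where
  "moves = [(0, 6, 2, 3), (0, 7, 1, 5), (2, 4, 1, 5), (0, 10, 2, 9), (5, 8, 0, 11), (5, 9, 0, 13), (3, 10, 1, 11), (6, 9, 1, 11), (7, 8, 1, 11), (1, 12, 2, 11), (4, 10, 1, 13), (7, 9, 1, 13), (1, 14, 2, 13), (5, 10, 2, 13), (3, 7, 4, 6), (3, 9, 4, 8), (3, 13, 4, 11), (3, 14, 5, 11), (4, 12, 5, 11), (4, 14, 5, 13), (6, 13, 7, 11), (6, 14, 7, 12), (8, 13, 9, 11), (8, 14, 9, 12), (11, 14, 12, 13)]"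

definition weights :: "nat list" where
  "weights = [1, 1, 1, 3, 2, 1, 4, 4, 2, 2, 3, 0, 1, 1, 4]"

definition homogeneous :: "nat \<Rightarrow> int list" where
  "homogeneous i = 1 # vertices ! i"

definition affine_value :: "int list \<Rightarrow> (nat \<Rightarrow> real) \<Rightarrow> real" where
  "affine_value f x = of_int (f ! 0) + (\<Sum>c<5. of_int (f ! Suc c) * x c)"

lemma sum_lessThan_5: "(\<Sum>c<5::nat. f c) = f 0 + f 1 + f 2 + f 3 + (f 4 :: 'a::comm_monoid_add)"
  by (simp add: eval_nat_numeral)

lemma sum_lessThan_15: "(\<Sum>i<15::nat. f i) = f 0 + f 1 + f 2 + f 3 + f 4 + f 5 + f 6 + f 7 + f 8 + f 9 + f 10 + f 11 + f 12 + f 13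
    + (f 14 :: 'a::comm_monoid_add)"
  by (simp add: eval_nat_numeral)

lemma all_lessThan_15: "(\<forall>i<15. Q i) \<longleftrightarrow> Q 0 \<and> Q 1 \<and> Q 2 \<and> Q 3 \<and> Q 4 \<and> Q 5 \<and> Q 6 \<and> Q 7 \<and> Q 8 \<and> Q 9 \<and>
    Q 10 \<and> Q 11 \<and> Q 12 \<and> Q 13 \<and> Q (14::nat)"
  by (auto simp: eval_nat_numeral All_less_Suc)

lemma facets_nonneg: "\<forall>f\<in>set facets. \<forall>v\<in>set vertices. 0 \<le> f ! 0 + (\<Sum>c<5. f ! Suc c * v ! c)"
  unfolding sum_lessThan_5 facets_def vertices_def by code_simp

text \<open>
  The two matrix identities say that the forms and the vertices of a cell, with a leading 1, are inverse to
  each other in either order: one gives unimodularity, the other reconstructs a point from its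
  barycentric coordinates.
\<close>

definition well_formed_cells :: bool where
  "well_formed_cells \<longleftrightarrow> list_all (\<lambda>(J, L). length J = 6 \<and> length L = 6 \<and>
     list_all (\<lambda>i. i < 15) J \<and> distinct J \<and>
     list_all (\<lambda>(i, j). i \<notin> set J \<or> j \<notin> set J) nonedges \<and>
     map (\<lambda>f. map (\<lambda>i. \<Sum>e\<leftarrow>[0..<6]. f ! e * homogeneous i ! e) J) L = map (\<lambda>j. map (\<lambda>k. if j = k then 1 else 0) [0..<6]) [0..<6] \<and>
     map (\<lambda>e. map (\<lambda>c. \<Sum>j\<leftarrow>[0..<6]. L ! j ! e * homogeneous (J ! j) ! c) [0..<6]) [0..<6] = map (\<lambda>j. map (\<lambda>k. if j = k then 1 else 0) [0..<6]) [0..<6])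
   cells"

lemma cells_well_formed: well_formed_cells
  by code_simp

lemma locate_correct:
  assumes "\<forall>f\<in>set facets. 0 \<le> affine_value f x"
  shows "\<forall>f\<in>set (snd (cells ! locate x)). 0 \<le> affine_value f x" "locate x < 41"
proof -
  note facets = assms[unfolded facets_def affine_value_def sum_lessThan_5, simplified]
  show "locate x < 41"
    unfolding locate_def if_distrib[of "\<lambda>k. k < 41"] by (simp only: rel_simps if_cancel)
  show "\<forall>f\<in>set (snd (cells ! locate x)). 0 \<le> affine_value f x"
    unfolding locate_def One_nat_def if_distrib[of "\<lambda>k. \<forall>f\<in>set (snd (cells ! k)). 0 \<le> affine_value f x"] if_bool_eq_conj
    apply (intro conjI impI)
    apply (simp_all (no_asm) add: cells_def affine_value_def sum_lessThan_5)
    apply (insert facets)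
    apply (intro conjI; linarith)+
    done
qed

text \<open>
  The five coordinates and the total weight give six linear equations for the 15 differences of weights.
  Together with the sign conditions coming from the forbidden pairs they force all differences to
  vanish; the case analysis is small.
\<close>

lemma unique_difference:
  fixes k :: "nat \<Rightarrow> real"
  assumes "(\<Sum>i<15. k i) = 0" "\<forall>c<5. (\<Sum>i<15. k i * (vertices ! i ! c)) = 0"
    and "\<forall>(i, j)\<in>set nonedges. \<not> (0 < k i \<and> 0 < k j) \<and> \<not> (k i < 0 \<and> k j < 0)"
  shows "\<forall>i<15. k i = 0"
proof -
  have five: "(\<forall>c<5. Q c) \<longleftrightarrow> Q 0 \<and> Q 1 \<and> Q 2 \<and> Q 3 \<and> Q (4::nat)" for Q
    by (auto simp: eval_nat_numeral All_less_Suc)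
  note sums = assms(1,2)[unfolded sum_lessThan_15 five vertices_def, simplified]
  note signs = assms(3)[unfolded nonedges_def, simplified]
  show ?thesis
    unfolding all_lessThan_15 One_nat_def using sums signs by (smt (z3))
qed

text \<open>
  The same principle for the complex of monomials that avoid the leading monomials of the Groebner basis:
  the 25 quadratic ones and \<open>x\<^sub>4 x\<^sub>6 x\<^sub>8\<close>.
\<close>

lemma unique_standard:
  fixes k :: "nat \<Rightarrow> real"
  assumes "(\<Sum>i<15. k i) = 0" "\<forall>c<5. (\<Sum>i<15. k i * (vertices ! i ! c)) = 0"
    and "\<forall>(i, j, r)\<in>set moves. \<not> (0 < k i \<and> 0 < k j) \<and> \<not> (k i < 0 \<and> k j < 0)"
    and "\<not> (0 < k 4 \<and> 0 < k 6 \<and> 0 < k 8)" "\<not> (k 4 < 0 \<and> k 6 < 0 \<and> k 8 < 0)"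
  shows "\<forall>i<15. k i = 0"
proof -
  have five: "(\<forall>c<5. Q c) \<longleftrightarrow> Q 0 \<and> Q 1 \<and> Q 2 \<and> Q 3 \<and> Q (4::nat)" for Q
    by (auto simp: eval_nat_numeral All_less_Suc)
  note sums = assms(1,2)[unfolded sum_lessThan_15 five vertices_def, simplified]
  note signs = assms(3)[unfolded moves_def, simplified]
  show ?thesis
    unfolding all_lessThan_15 One_nat_def using sums signs assms(4,5) by (smt (verit))
qed

section \<open>The polytope and its triangulation\<close>

definition points :: "(nat \<Rightarrow>\<^sub>0 int) set" where
  "points = pt ` {..<15}"

definition example_polytope :: "(nat \<Rightarrow>\<^sub>0 real) set" where
  "example_polytope = convex hull (real_point ` points)"

definition triangulation :: "(nat \<Rightarrow>\<^sub>0 int) set set" where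
  "triangulation = image pt ` {J. J \<subseteq> {..<15} \<and> (\<forall>(i, j)\<in>set nonedges. i \<notin> J \<or> j \<notin> J)}"

lemma lookup_pt: "Poly_Mapping.lookup (pt i) c = (if c < 5 then vertices ! i ! c else 0)"
  by (auto simp: pt_def lookup_sum lookup_single when_def)

lemma keys_pt: "Poly_Mapping.keys (pt i) \<subseteq> {..<5}"
  by (auto simp: in_keys_iff lookup_pt split: if_splits)

lemma vertices_wellformed: "length vertices = 15" "\<forall>v\<in>set vertices. length v = 5 \<and> set v \<subseteq> {0, 1}" "distinct vertices"
  by (simp_all add: vertices_def)

lemma inj_pt: "inj_on pt {..<15}"
proof (rule inj_onI)
  fix i j assume ij: "i \<in> {..<15}" "j \<in> {..<15}" "pt i = pt j"
  have "vertices ! i ! c = vertices ! j ! c" if "c < 5" for c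
    using arg_cong[OF ij(3), of "\<lambda>p. Poly_Mapping.lookup p c"] that by (simp add: lookup_pt)
  moreover have "length (vertices ! i) = 5" "length (vertices ! j) = 5"
    using ij(1,2) vertices_wellformed by auto
  ultimately have "vertices ! i = vertices ! j"
    by (intro nth_equalityI) auto
  then show "i = j"
    using ij(1,2) vertices_wellformed by (simp add: nth_eq_iff_index_eq)
qed

lemma finite_points_set: "finite points"
  by (simp add: points_def)

lemma points_zero_one:
  "points \<subseteq> {a. Poly_Mapping.keys a \<subseteq> {..<5} \<and> (\<forall>i. Poly_Mapping.lookup a i \<in> {0, 1})}"
proof -
  have "vertices ! i ! c \<in> {0, 1}" if "i < 15" "c < 5" for i c
  proof -
    have "vertices ! i \<in> set vertices" using that vertices_wellformed(1) by simp
    then have "length (vertices ! i) = 5" "set (vertices ! i) \<subseteq> {0, 1}"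
      using vertices_wellformed(2) by auto
    with that show ?thesis by (metis nth_mem subsetD)
  qed
  then have "Poly_Mapping.lookup (pt i) c \<in> {0, 1}" if "i < 15" for i c
    using that by (cases "c < 5") (auto simp only: lookup_pt if_True if_False insertI1)
  then show ?thesis
    using keys_pt unfolding points_def by blast
qed

lemma lattice_points_example: "lattice_points 5 example_polytope = points"
  unfolding example_polytope_def by (rule lattice_points_zero_one[OF finite_points_set points_zero_one])

lemma sum_points: "(\<Sum>a\<in>points. f a) = (\<Sum>i<15. f (pt i))"
  unfolding points_def by (simp add: sum.reindex[OF inj_pt])

lemma triangulation_iff:
  assumes "J \<subseteq> {..<15}"
  shows "pt ` J \<in> triangulation \<longleftrightarrow> (\<forall>(i, j)\<in>set nonedges. i \<notin> J \<or> j \<notin> J)"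
proof
  assume "pt ` J \<in> triangulation"
  then obtain J' where J': "J' \<subseteq> {..<15}" "\<forall>(i, j)\<in>set nonedges. i \<notin> J' \<or> j \<notin> J'" "pt ` J = pt ` J'"
    by (auto simp: triangulation_def)
  then have "J = J'"
    using inj_on_image_eq_iff[OF inj_pt assms J'(1)] by simp
  with J' show "\<forall>(i, j)\<in>set nonedges. i \<notin> J \<or> j \<notin> J" by simp
qed (use assms in \<open>auto simp: triangulation_def\<close>)

lemma triangulation_sub: "\<sigma> \<in> triangulation \<Longrightarrow> \<sigma> \<subseteq> points"
  by (auto simp: triangulation_def points_def)

lemma triangulation_cases:
  assumes "\<sigma> \<subseteq> points"
  obtains J where "J \<subseteq> {..<15}" "\<sigma> = pt ` J"
  using assms unfolding points_def by (meson subset_imageE)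

lemma triangulation_down:
  assumes "\<sigma> \<in> triangulation" "\<tau> \<subseteq> \<sigma>" shows "\<tau> \<in> triangulation"
proof -
  obtain J where J: "J \<subseteq> {..<15}" "\<sigma> = pt ` J"
    using triangulation_cases[OF triangulation_sub[OF assms(1)]] .
  obtain J' where J': "J' \<subseteq> J" "\<tau> = pt ` J'"
    using assms(2) unfolding J(2) by (meson subset_imageE)
  then show ?thesis
    using assms(1) J by (fastforce simp: triangulation_iff)
qed

lemma nonedges_less: "\<forall>(i, j)\<in>set nonedges. i < 15 \<and> j < 15 \<and> i \<noteq> j"
  by (simp add: nonedges_def)

text \<open>
  A set that is not a face contains a forbidden pair, and a minimal one is that pair.
\<close>

lemma flag_triangulation: "flag triangulation"
  unfolding flag_def
proof (intro allI impI)
  fix N assume N: "minimal_nonface triangulation N"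
  have "N \<subseteq> points"
    using N triangulation_sub by (auto simp: minimal_nonface_def)
  then obtain J where J: "J \<subseteq> {..<15}" "N = pt ` J"
    by (rule triangulation_cases)
  have "\<not> (\<forall>(i, j)\<in>set nonedges. i \<notin> J \<or> j \<notin> J)"
    using N J by (simp add: minimal_nonface_def triangulation_iff)
  then obtain i j where ij: "(i, j) \<in> set nonedges" "i \<in> J" "j \<in> J" by auto
  have "i < 15" "j < 15" "i \<noteq> j"
    using ij(1) nonedges_less by auto
  have "pt ` {i, j} \<notin> triangulation"
    using ij J by (subst triangulation_iff) auto
  then have "N = pt ` {i, j}"
    using N ij J unfolding minimal_nonface_def by (metis image_mono insert_subset psubsetI empty_subsetI)
  moreover have "pt i \<noteq> pt j"
    using inj_pt \<open>i < 15\<close> \<open>j < 15\<close> \<open>i \<noteq> j\<close> by (auto dest: inj_onD)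
  ultimately show "card N = 2" by simp
qed

lemma unique_weights:
  fixes \<alpha> \<beta> :: "nat \<Rightarrow> real"
  assumes nonneg: "\<And>i. i < 15 \<Longrightarrow> 0 \<le> \<alpha> i" "\<And>i. i < 15 \<Longrightarrow> 0 \<le> \<beta> i"
    and faces: "\<forall>(i, j)\<in>set nonedges. \<alpha> i = 0 \<or> \<alpha> j = 0" "\<forall>(i, j)\<in>set nonedges. \<beta> i = 0 \<or> \<beta> j = 0"
    and sums: "(\<Sum>i<15. \<alpha> i) = (\<Sum>i<15. \<beta> i)"
      "(\<Sum>i<15. \<alpha> i *\<^sub>R real_point (pt i)) = (\<Sum>i<15. \<beta> i *\<^sub>R real_point (pt i))"
  shows "\<forall>i<15. \<alpha> i = \<beta> i"
proof -
  have "\<forall>i<15. \<alpha> i - \<beta> i = 0"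
  proof (rule unique_difference)
    show "(\<Sum>i<15. \<alpha> i - \<beta> i) = 0"
      using sums(1) by (simp add: sum_subtractf)
    show "\<forall>c<5. (\<Sum>i<15. (\<alpha> i - \<beta> i) * (vertices ! i ! c)) = 0"
    proof (intro allI impI)
      fix c :: nat assume "c < 5"
      then show "(\<Sum>i<15. (\<alpha> i - \<beta> i) * (vertices ! i ! c)) = 0"
        using arg_cong[OF sums(2), of "\<lambda>x. Poly_Mapping.lookup x c"]
        by (simp add: lookup_sum lookup_pt left_diff_distrib sum_subtractf)
    qed
    show "\<forall>(i, j)\<in>set nonedges. \<not> (0 < \<alpha> i - \<beta> i \<and> 0 < \<alpha> j - \<beta> j) \<and> \<not> (\<alpha> i - \<beta> i < 0 \<and> \<alpha> j - \<beta> j < 0)"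
    proof clarify
      fix i j assume ij: "(i, j) \<in> set nonedges"
      then have "i < 15" "j < 15" using nonedges_less by auto
      moreover have "\<alpha> i = 0 \<or> \<alpha> j = 0" "\<beta> i = 0 \<or> \<beta> j = 0"
        using faces ij by auto
      ultimately show "\<not> (0 < \<alpha> i - \<beta> i \<and> 0 < \<alpha> j - \<beta> j) \<and> \<not> (\<alpha> i - \<beta> i < 0 \<and> \<alpha> j - \<beta> j < 0)"
        using nonneg[of i] nonneg[of j] by auto
    qed
  qed
  then show ?thesis by simp
qed

lemma cell_props:
  assumes "(J, L) \<in> set cells"
  shows "length J = 6" "length L = 6" "set J \<subseteq> {..<15}" "distinct J"
    "\<forall>(i, j)\<in>set nonedges. i \<notin> set J \<or> j \<notin> set J"
    "\<And>j k. j < 6 \<Longrightarrow> k < 6 \<Longrightarrow> (\<Sum>e<6. L ! j ! e * homogeneous (J ! k) ! e) = (if j = k then 1 else 0)"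
    "\<And>e c. e < 6 \<Longrightarrow> c < 6 \<Longrightarrow> (\<Sum>j<6. L ! j ! e * homogeneous (J ! j) ! c) = (if e = c then 1 else 0)"
proof -
  have sum_list: "(\<Sum>e\<leftarrow>[0..<6]. f e) = (\<Sum>e<6. f e)" for f :: "nat \<Rightarrow> int"
    by (simp add: sum_list_distinct_conv_sum_set atLeast0LessThan)
  note check = cells_well_formed[unfolded well_formed_cells_def list_all_iff, rule_format, OF assms, unfolded prod.case sum_list]
  show "length J = 6" "length L = 6" "set J \<subseteq> {..<15}" "distinct J"
    "\<forall>(i, j)\<in>set nonedges. i \<notin> set J \<or> j \<notin> set J"
    using check by auto
  from check have
    1: "map (\<lambda>f. map (\<lambda>i. \<Sum>e<6. f ! e * homogeneous i ! e) J) L = map (\<lambda>j. map (\<lambda>k. if j = k then 1 else 0) [0..<6]) [0..<6]" and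
    2: "map (\<lambda>e. map (\<lambda>c. \<Sum>j<6. L ! j ! e * homogeneous (J ! j) ! c) [0..<6]) [0..<6] = map (\<lambda>j. map (\<lambda>k. if j = k then 1 else 0) [0..<6]) [0..<6]"
    by blast+
  show "(\<Sum>e<6. L ! j ! e * homogeneous (J ! k) ! e) = (if j = k then 1 else 0)" if "j < 6" "k < 6" for j k
    using arg_cong[OF 1, of "\<lambda>M. M ! j ! k"] that \<open>length J = 6\<close> \<open>length L = 6\<close> by simp
  show "(\<Sum>j<6. L ! j ! e * homogeneous (J ! j) ! c) = (if e = c then 1 else 0)" if "e < 6" "c < 6" for e c
    using arg_cong[OF 2, of "\<lambda>M. M ! e ! c"] that by simp
qed

lemma sum_lessThan_6: "(\<Sum>e<6. f e) = f 0 + (\<Sum>c<5. f (Suc c) :: 'a::comm_monoid_add)"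
proof -
  have "{..<6::nat} = {..<Suc 5}" by auto
  then show ?thesis by (simp only: sum.lessThan_Suc_shift)
qed

text \<open>
  The weights of a point are its barycentric coordinates in the cell found by \<open>locate\<close>. They are summed
  over the positions of a vertex in the cell only to turn a list into a function of the vertex.
\<close>

lemma covered:
  assumes "x \<in> example_polytope"
  obtains J L w where "(J, L) \<in> set cells" "\<forall>i<15. 0 \<le> w i" "\<forall>i. i \<notin> set J \<longrightarrow> w i = 0" "(\<Sum>i<15. w i) = 1"
    "(\<Sum>i<15. w i *\<^sub>R real_point (pt i)) = x"
proof -
  obtain u where u': "\<forall>a\<in>points. 0 \<le> u a" "sum u points = 1" "(\<Sum>a\<in>points. u a *\<^sub>R real_point a) = x"
    using assms finite_points_set by (auto simp: example_polytope_def convex_hull_real_point)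
  have u: "\<forall>i<15. 0 \<le> u (pt i)" "(\<Sum>i<15. u (pt i)) = 1" "(\<Sum>i<15. u (pt i) *\<^sub>R real_point (pt i)) = x"
    using u'(1) u'(2,3)[unfolded sum_points] by (auto simp: points_def)
  let ?x = "Poly_Mapping.lookup x"
  have x_high: "?x c = 0" if "\<not> c < 5" for c
    unfolding u(3)[symmetric] using that by (simp add: lookup_sum lookup_pt)
  have "0 \<le> affine_value f ?x" if "f \<in> set facets" for f
  proof -
    have "affine_value f ?x = (\<Sum>i<15. u (pt i) * of_int (f ! 0)) + (\<Sum>c<5. of_int (f ! Suc c) * (\<Sum>i<15. u (pt i) * of_int (vertices ! i ! c)))"
      by (simp add: affine_value_def u(3)[symmetric] lookup_sum lookup_pt u(2) flip: sum_distrib_right)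
    also have "(\<Sum>c<5. of_int (f ! Suc c) * (\<Sum>i<15. u (pt i) * of_int (vertices ! i ! c))) =
        (\<Sum>i<15. \<Sum>c<5. u (pt i) * (of_int (f ! Suc c) * of_int (vertices ! i ! c)))"
      by (subst sum.swap) (simp add: sum_distrib_left mult_ac)
    finally have "affine_value f ?x = (\<Sum>i<15. u (pt i) * of_int (f ! 0 + (\<Sum>c<5. f ! Suc c * vertices ! i ! c)))"
      by (simp add: sum.distrib distrib_left sum_distrib_left)
    also have "\<dots> \<ge> 0"
    proof (intro sum_nonneg mult_nonneg_nonneg)
      fix i assume i: "i \<in> {..<15::nat}"
      then show "0 \<le> u (pt i)" using u(1) by simp
      have "vertices ! i \<in> set vertices" using i vertices_wellformed(1) by simp
      then have "0 \<le> f ! 0 + (\<Sum>c<5. f ! Suc c * vertices ! i ! c)"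
        using facets_nonneg that by blast
      then show "0 \<le> real_of_int (f ! 0 + (\<Sum>c<5. f ! Suc c * vertices ! i ! c))"
        by (simp only: of_int_0_le_iff)
    qed
    finally show ?thesis .
  qed
  then have loc: "\<forall>f\<in>set (snd (cells ! locate ?x)). 0 \<le> affine_value f ?x" "locate ?x < 41"
    using locate_correct[of ?x] by auto
  obtain J L where JL: "cells ! locate ?x = (J, L)" by fastforce
  have "length cells = 41" by (simp add: cells_def)
  then have cell: "(J, L) \<in> set cells"
    using loc(2) JL by (metis nth_mem)
  note props = cell_props[OF cell]
  have L_nonneg: "0 \<le> affine_value (L ! j) ?x" if "j < 6" for j
    using loc(1) that props(2) by (simp add: JL)
  define w where "w i = (\<Sum>j\<in>{j. j < 6 \<and> J ! j = i}. affine_value (L ! j) ?x)" for i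
  have J_less: "J ! j < 15" if "j < 6" for j
    using props(1,3) that by (metis lessThan_iff nth_mem subsetD)
  have w_sum: "(\<Sum>i<15. w i * g i) = (\<Sum>j<6. affine_value (L ! j) ?x * g (J ! j))" for g :: "nat \<Rightarrow> real"
  proof -
    have "(\<Sum>i<15. w i * g i) = (\<Sum>i<15. \<Sum>j\<in>{j \<in> {..<6}. J ! j = i}. affine_value (L ! j) ?x * g (J ! j))"
      unfolding w_def sum_distrib_right by (intro sum.cong refl) auto
    also have "\<dots> = (\<Sum>j<6. affine_value (L ! j) ?x * g (J ! j))"
      using J_less by (intro sum.group) auto
    finally show ?thesis .
  qed
  let ?X = "\<lambda>e. case e of 0 \<Rightarrow> 1 | Suc c \<Rightarrow> ?x c"
  have affine_X: "affine_value f ?x = (\<Sum>e<6. of_int (f ! e) * ?X e)" for f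
    unfolding sum_lessThan_6 affine_value_def by simp
  have recover: "(\<Sum>j<6. affine_value (L ! j) ?x * of_int (homogeneous (J ! j) ! c)) = ?X c" if "c < 6" for c
  proof -
    have "(\<Sum>j<6. affine_value (L ! j) ?x * of_int (homogeneous (J ! j) ! c)) =
        (\<Sum>j<6. \<Sum>e<6. ?X e * of_int (L ! j ! e * homogeneous (J ! j) ! c))"
      unfolding affine_X sum_distrib_right by (intro sum.cong refl) simp
    also have "\<dots> = (\<Sum>e<6. ?X e * of_int (\<Sum>j<6. L ! j ! e * homogeneous (J ! j) ! c))"
      by (subst sum.swap) (simp add: sum_distrib_left)
    also have "\<dots> = (\<Sum>e<6. if e = c then ?X c else 0)"
      by (intro sum.cong refl) (auto simp: props(7)[OF _ that])
    also have "\<dots> = ?X c" using that by simp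
    finally show ?thesis .
  qed
  show ?thesis
  proof (rule that[OF cell])
    show "\<forall>i<15. 0 \<le> w i"
      unfolding w_def using L_nonneg by (auto intro!: sum_nonneg)
    show "\<forall>i. i \<notin> set J \<longrightarrow> w i = 0"
    proof (intro allI impI)
      fix i assume "i \<notin> set J"
      then have "{j. j < 6 \<and> J ! j = i} = {}"
        using props(1) by (auto simp: in_set_conv_nth)
      then show "w i = 0" unfolding w_def by (simp only: sum.empty)
    qed
    show "(\<Sum>i<15. w i) = 1"
      using w_sum[of "\<lambda>_. 1"] recover[of 0] by (simp add: homogeneous_def)
    show "(\<Sum>i<15. w i *\<^sub>R real_point (pt i)) = x"
    proof (rule poly_mapping_eqI)
      fix c
      show "Poly_Mapping.lookup (\<Sum>i<15. w i *\<^sub>R real_point (pt i)) c = ?x c"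
      proof (cases "c < 5")
        case True
        then show ?thesis
          using w_sum[of "\<lambda>i. vertices ! i ! c"] recover[of "Suc c"]
          by (simp add: lookup_sum lookup_pt homogeneous_def)
      next
        case False
        then show ?thesis
          by (simp add: x_high lookup_sum lookup_pt)
      qed
    qed
  qed
qed

lemma cell_face:
  assumes "(J, L) \<in> set cells" shows "pt ` set J \<in> triangulation"
  using cell_props(3,5)[OF assms] by (simp add: triangulation_iff)

lemma triangulates: "lattice_triangulation 5 example_polytope triangulation"
proof (rule lattice_triangulationI[OF finite_points_set lattice_points_example[symmetric] example_polytope_def])
  show "\<sigma> \<subseteq> points" if "\<sigma> \<in> triangulation" for \<sigma>
    using that by (rule triangulation_sub)
  show "\<tau> \<in> triangulation" if "\<sigma> \<in> triangulation" "\<tau> \<subseteq> \<sigma>" for \<sigma> \<tau>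
    using that by (rule triangulation_down)
next
  fix x assume "x \<in> example_polytope"
  then obtain J L w where w: "(J, L) \<in> set cells" "\<forall>i<15. 0 \<le> w i" "\<forall>i. i \<notin> set J \<longrightarrow> w i = 0" "(\<Sum>i<15. w i) = 1"
    "(\<Sum>i<15. w i *\<^sub>R real_point (pt i)) = x"
    by (rule covered)
  have J: "set J \<subseteq> {..<15}" using cell_props(3)[OF w(1)] .
  have inj: "inj_on (\<lambda>i. real_point (pt i)) (set J)"
    using comp_inj_on[OF inj_on_subset[OF inj_pt J] inj_on_subset[OF inj_real_point subset_UNIV]] by (simp add: o_def)
  have "sum w (set J) = 1"
    using w(3) J unfolding w(4)[symmetric] by (intro sum.mono_neutral_left) auto
  moreover have "(\<Sum>i\<in>set J. w i *\<^sub>R real_point (pt i)) = x"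
    using w(3) J unfolding w(5)[symmetric] by (intro sum.mono_neutral_left) auto
  moreover have "(\<Sum>i\<in>set J. w i *\<^sub>R real_point (pt i)) \<in> convex hull (real_point ` pt ` set J)"
    using \<open>sum w (set J) = 1\<close> w(2) J by (intro convex_sum) (auto intro!: hull_inc)
  ultimately have "x \<in> geometric_simplex (pt ` set J)"
    by (simp add: geometric_simplex_def)
  then show "\<exists>\<sigma>\<in>triangulation. x \<in> geometric_simplex \<sigma>"
    using cell_face[OF w(1)] by blast
next
  fix \<alpha> \<beta> :: "(nat \<Rightarrow>\<^sub>0 int) \<Rightarrow> real"
  assume \<alpha>: "\<And>a. a \<in> points \<Longrightarrow> 0 \<le> \<alpha> a" and \<beta>: "\<And>a. a \<in> points \<Longrightarrow> 0 \<le> \<beta> a"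
    and faces: "{a \<in> points. \<alpha> a \<noteq> 0} \<in> triangulation" "{a \<in> points. \<beta> a \<noteq> 0} \<in> triangulation"
    and sums: "sum \<alpha> points = sum \<beta> points"
      "(\<Sum>a\<in>points. \<alpha> a *\<^sub>R real_point a) = (\<Sum>a\<in>points. \<beta> a *\<^sub>R real_point a)"
  have clique: "\<forall>(i, j)\<in>set nonedges. \<gamma> (pt i) = 0 \<or> \<gamma> (pt j) = 0"
    if "{a \<in> points. \<gamma> a \<noteq> 0} \<in> triangulation" for \<gamma> :: "(nat \<Rightarrow>\<^sub>0 int) \<Rightarrow> real"
  proof -
    have "{a \<in> points. \<gamma> a \<noteq> 0} = pt ` {i. i < 15 \<and> \<gamma> (pt i) \<noteq> 0}"
      by (auto simp: points_def)
    then have "\<forall>(i, j)\<in>set nonedges. i \<notin> {i. i < 15 \<and> \<gamma> (pt i) \<noteq> 0} \<or> j \<notin> {i. i < 15 \<and> \<gamma> (pt i) \<noteq> 0}"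
      using that triangulation_iff[of "{i. i < 15 \<and> \<gamma> (pt i) \<noteq> 0}"] by auto
    then show ?thesis using nonedges_less by fastforce
  qed
  have "\<forall>i<15. \<alpha> (pt i) = \<beta> (pt i)"
    by (rule unique_weights[OF \<alpha> \<beta> clique[OF faces(1)] clique[OF faces(2)] sums[unfolded sum_points]])
       (auto simp: points_def)
  then show "\<forall>a\<in>points. \<alpha> a = \<beta> a"
    by (auto simp: points_def)
qed

text \<open>
  The barycentre of a maximal face lies in some cell; by uniqueness of the weights that cell contains
  all vertices of the face.
\<close>

lemma maximal_faces:
  assumes \<sigma>: "\<sigma> \<in> triangulation" "\<forall>\<tau>\<in>triangulation. \<not> \<sigma> \<subset> \<tau>"
  obtains J L where "(J, L) \<in> set cells" "\<sigma> = pt ` set J"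
proof -
  obtain I where I: "I \<subseteq> {..<15}" "\<sigma> = pt ` I"
    using triangulation_cases[OF triangulation_sub[OF \<sigma>(1)]] .
  have fin: "finite I" using I(1) by (rule finite_subset) simp
  have "I \<noteq> {}"
  proof
    assume "I = {}"
    moreover have "pt ` {0} \<in> triangulation"
      using nonedges_less by (subst triangulation_iff) auto
    ultimately show False using \<sigma>(2) I(2) by auto
  qed
  then have card: "card I \<noteq> 0" using fin by simp
  define \<alpha> where "\<alpha> i = (if i \<in> I then 1 / real (card I) else 0)" for i
  have sum1: "(\<Sum>i<15. \<alpha> i) = 1"
  proof -
    have "(\<Sum>i<15. \<alpha> i) = (\<Sum>i\<in>I. 1 / real (card I))"
      using I(1) by (intro sum.mono_neutral_cong_right) (auto simp: \<alpha>_def)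
    then show ?thesis using card by simp
  qed
  define x where "x = (\<Sum>i<15. \<alpha> i *\<^sub>R real_point (pt i))"
  have "x \<in> example_polytope"
    unfolding x_def example_polytope_def using sum1
    by (intro convex_sum) (auto simp: \<alpha>_def points_def intro!: hull_inc)
  then obtain J L w where w: "(J, L) \<in> set cells" "\<forall>i<15. 0 \<le> w i" "\<forall>i. i \<notin> set J \<longrightarrow> w i = 0" "(\<Sum>i<15. w i) = 1"
    "(\<Sum>i<15. w i *\<^sub>R real_point (pt i)) = x"
    by (rule covered)
  have "\<forall>i<15. \<alpha> i = w i"
  proof (rule unique_weights)
    show "\<forall>(i, j)\<in>set nonedges. \<alpha> i = 0 \<or> \<alpha> j = 0"
      using \<sigma>(1) I by (auto simp: \<alpha>_def triangulation_iff)
    show "\<forall>(i, j)\<in>set nonedges. w i = 0 \<or> w j = 0"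
      using cell_props(5)[OF w(1)] w(3) by auto
  qed (use w sum1 in \<open>auto simp: \<alpha>_def x_def\<close>)
  then have "\<alpha> i = 0" if "i < 15" "i \<notin> set J" for i
    using that w(3) by simp
  then have "I \<subseteq> set J"
    using I(1) card by (fastforce simp: \<alpha>_def)
  then have "\<sigma> \<subseteq> pt ` set J" using I(2) by auto
  then have "\<sigma> = pt ` set J"
    using \<sigma>(2) cell_face[OF w(1)] by auto
  then show thesis using that w(1) by blast
qed

lemma unimodular_triangulation: "unimodular 5 triangulation"
  unfolding unimodular_def
proof (intro ballI impI)
  fix \<sigma> assume "\<sigma> \<in> triangulation" "\<forall>\<tau>\<in>triangulation. \<not> \<sigma> \<subset> \<tau>"
  then obtain J L where JL: "(J, L) \<in> set cells" "\<sigma> = pt ` set J"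
    by (rule maximal_faces)
  note props = cell_props[OF JL(1)]
  have "set J = (\<lambda>k. J ! k) ` {..5}"
    using props(1) by (force simp: set_conv_nth)
  then have \<sigma>: "\<sigma> = (\<lambda>k. pt (J ! k)) ` {..5}"
    by (simp add: JL(2) image_image)
  show "normalized_volume 5 (geometric_simplex \<sigma>) = 1"
    unfolding \<sigma>
  proof (rule normalized_volume_simplex[where 'n = 5 and c = "\<lambda>j. L ! j ! 0" and l = "\<lambda>j i. L ! j ! Suc i"])
    fix j k :: nat assume "j \<le> 5" "k \<le> 5"
    then show "L ! j ! 0 + (\<Sum>i<5. L ! j ! Suc i * Poly_Mapping.lookup (pt (J ! k)) i) = (if j = k then 1 else 0)"
      using props(6)[of j k] by (simp add: sum_lessThan_6 homogeneous_def lookup_pt)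
  qed simp
qed

section \<open>The toric ideal is generated by quadrics\<close>

lemma lookup_of_nat_mult: "Poly_Mapping.lookup (of_nat n * a) c = of_nat n * Poly_Mapping.lookup a c"
  for a :: "nat \<Rightarrow>\<^sub>0 int"
  by (induction n) (auto simp: lookup_add algebra_simps)

definition standard :: "((nat \<Rightarrow>\<^sub>0 int) \<Rightarrow>\<^sub>0 nat) \<Rightarrow> bool" where
  "standard m \<longleftrightarrow> (\<forall>(i, j, r)\<in>set moves. Poly_Mapping.lookup m (pt i) = 0 \<or> Poly_Mapping.lookup m (pt j) = 0) \<and>
     (Poly_Mapping.lookup m (pt 4) = 0 \<or> Poly_Mapping.lookup m (pt 6) = 0 \<or> Poly_Mapping.lookup m (pt 8) = 0)"

definition weight :: "((nat \<Rightarrow>\<^sub>0 int) \<Rightarrow>\<^sub>0 nat) \<Rightarrow> nat" where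
  "weight m = (\<Sum>i<15. weights ! i * Poly_Mapping.lookup m (pt i))"

lemma toric_exponent_points:
  assumes "Poly_Mapping.keys m \<subseteq> points"
  shows "toric_exponent m = (\<Sum>i<15. (Poly_Mapping.lookup m (pt i), of_nat (Poly_Mapping.lookup m (pt i)) * pt i))"
  by (simp only: toric_exponent_superset[OF finite_points_set assms] sum_points)

text \<open>
  The exponents of two monomials with the same image are two representations of the same lattice point.
\<close>

lemma standard_unique:
  assumes keys: "Poly_Mapping.keys m \<subseteq> points" "Poly_Mapping.keys m' \<subseteq> points"
    and eq: "toric_exponent m = toric_exponent m'" and std: "standard m" "standard m'"
  shows "m = m'"
proof -
  let ?n = "\<lambda>i. Poly_Mapping.lookup m (pt i)" and ?n' = "\<lambda>i. Poly_Mapping.lookup m' (pt i)"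
  have sums: "(\<Sum>i<15. ?n i) = (\<Sum>i<15. ?n' i)" "(\<Sum>i<15. of_nat (?n i) * pt i) = (\<Sum>i<15. of_nat (?n' i) * pt i)"
    using arg_cong[OF eq, of fst] arg_cong[OF eq, of snd]
    by (simp_all add: toric_exponent_points[OF keys(1)] toric_exponent_points[OF keys(2)] fst_sum snd_sum)
  have "\<forall>i<15. real (?n i) - real (?n' i) = 0"
  proof (rule unique_standard)
    show "(\<Sum>i<15. real (?n i) - real (?n' i)) = 0"
      using arg_cong[OF sums(1), of real] by (simp add: sum_subtractf)
    show "\<forall>c<5. (\<Sum>i<15. (real (?n i) - real (?n' i)) * (vertices ! i ! c)) = 0"
    proof (intro allI impI)
      fix c :: nat assume c: "c < 5"
      have "(\<Sum>i<15. int (?n i) * vertices ! i ! c) = (\<Sum>i<15. int (?n' i) * vertices ! i ! c)"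
        using arg_cong[OF sums(2), of "\<lambda>p. Poly_Mapping.lookup p c"] c
        by (simp add: lookup_sum lookup_of_nat_mult lookup_pt)
      then have "real_of_int (\<Sum>i<15. int (?n i) * vertices ! i ! c) = real_of_int (\<Sum>i<15. int (?n' i) * vertices ! i ! c)"
        by (rule arg_cong)
      then show "(\<Sum>i<15. (real (?n i) - real (?n' i)) * (vertices ! i ! c)) = 0"
        by (simp add: left_diff_distrib sum_subtractf)
    qed
    show "\<forall>(i, j, r)\<in>set moves. \<not> (0 < real (?n i) - real (?n' i) \<and> 0 < real (?n j) - real (?n' j)) \<and>
        \<not> (real (?n i) - real (?n' i) < 0 \<and> real (?n j) - real (?n' j) < 0)"
      using std by (fastforce simp: standard_def)
  qed (use std in \<open>auto simp: standard_def\<close>)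
  then have "Poly_Mapping.lookup m a = Poly_Mapping.lookup m' a" if "a \<in> points" for a
    using that by (auto simp: points_def)
  moreover have "Poly_Mapping.lookup m a = Poly_Mapping.lookup m' a" if "a \<notin> points" for a
    using that keys by (metis in_keys_iff subsetD)
  ultimately show ?thesis
    by (intro poly_mapping_eqI) blast
qed

lemma moves_correct:
  assumes "(i, j, k, l) \<in> set moves"
  shows "i < 15" "j < 15" "k < 15" "l < 15" "i \<noteq> j" "pt i + pt j = pt k + pt l"
    "weights ! k + weights ! l < weights ! i + weights ! j"
proof -
  have "\<forall>(i, j, k, l)\<in>set moves. i < 15 \<and> j < 15 \<and> k < 15 \<and> l < 15 \<and> i \<noteq> j \<and>
      weights ! k + weights ! l < weights ! i + weights ! j \<and>
      (\<forall>c\<in>set [0..<5]. vertices ! i ! c + vertices ! j ! c = vertices ! k ! c + vertices ! l ! c)"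
    by code_simp
  note props = bspec[OF this assms, unfolded prod.case]
  from props show "i < 15" "j < 15" "k < 15" "l < 15" "i \<noteq> j"
    "weights ! k + weights ! l < weights ! i + weights ! j"
    by auto
  show "pt i + pt j = pt k + pt l"
    using props by (intro poly_mapping_eqI) (simp add: lookup_add lookup_pt)
qed

lemma weight_add: "weight (m + m') = weight m + weight m'"
  by (simp add: weight_def lookup_add distrib_left sum.distrib)

lemma weight_single: "k < 15 \<Longrightarrow> weight (Poly_Mapping.single (pt k) 1) = weights ! k"
proof -
  assume k: "k < 15"
  have "weight (Poly_Mapping.single (pt k) 1) = (\<Sum>i<15. if i = k then weights ! k else 0)"
    unfolding weight_def lookup_single using k inj_pt
    by (intro sum.cong) (auto simp: when_def dest: inj_onD)
  then show ?thesis using k by simp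
qed

lemma split_monomial:
  assumes "Poly_Mapping.lookup m a \<noteq> (0::nat)"
  obtains m0 where "m = m0 + Poly_Mapping.single a 1" "Poly_Mapping.keys m0 \<subseteq> Poly_Mapping.keys m"
    "\<forall>b. b \<noteq> a \<longrightarrow> Poly_Mapping.lookup m0 b = Poly_Mapping.lookup m b"
proof -
  define m0 where "m0 = m - Poly_Mapping.single a 1"
  have look: "Poly_Mapping.lookup m0 b = Poly_Mapping.lookup m b - (if b = a then 1 else 0)" for b
    by (simp add: m0_def minus_poly_mapping.rep_eq lookup_single when_def)
  show ?thesis
  proof (rule that[of m0])
    show "m = m0 + Poly_Mapping.single a 1"
      using assms by (intro poly_mapping_eqI) (auto simp: lookup_add look lookup_single when_def)
    show "Poly_Mapping.keys m0 \<subseteq> Poly_Mapping.keys m"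
      by (auto simp: in_keys_iff look)
    show "\<forall>b. b \<noteq> a \<longrightarrow> Poly_Mapping.lookup m0 b = Poly_Mapping.lookup m b"
      by (simp add: look)
  qed
qed

lemma keys_add_subset:
  "Poly_Mapping.keys m \<subseteq> C \<Longrightarrow> Poly_Mapping.keys n \<subseteq> C \<Longrightarrow> Poly_Mapping.keys (m + n) \<subseteq> C"
  using keys_add[of m n] by (blast intro: subset_trans)

lemma pt_points: "i < 15 \<Longrightarrow> pt i \<in> points"
  by (simp add: points_def)

lemma pt_neq: "i < 15 \<Longrightarrow> j < 15 \<Longrightarrow> i \<noteq> j \<Longrightarrow> pt i \<noteq> pt j"
  using inj_pt by (auto dest: inj_onD)


lemma toric_example: "toric 5 example_polytope"
  by unfold_locales (simp add: lattice_points_example finite_points_set)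

text \<open>
  Rewriting along \<open>moves\<close>, and \<open>x\<^sub>4 x\<^sub>6 x\<^sub>8 \<rightarrow> x\<^sub>1 x\<^sub>3 x\<^bsub>11\<^esub>\<close>, decreases the weight and ends in a standard
  monomial, which the image determines. The cubic step decomposes as
  \<open>x\<^sub>4 x\<^sub>6 x\<^sub>8 = x\<^sub>3 x\<^sub>7 x\<^sub>8 = x\<^sub>1 x\<^sub>3 x\<^bsub>11\<^esub>\<close>; its first half uses a move backwards and increases the weight, so
  that the quadrics alone do not form a terminating and confluent system.
\<close>

lemma generated_by_quadrics_example:
  fixes K :: "'k::field itself"
  shows "generated_by_quadrics K (lattice_points 5 example_polytope) (toric_ideal K 5 example_polytope)"
proof -
  interpret toric K 5 example_polytope
    by (rule toric_example)
  have A: "A = points" by (rule lattice_points_example)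
  have step: "quadric_equiv (m + Poly_Mapping.single (pt i) 1 + Poly_Mapping.single (pt j) 1)
      (m + Poly_Mapping.single (pt k) 1 + Poly_Mapping.single (pt l) 1)"
    if "(i, j, k, l) \<in> set moves" "Poly_Mapping.keys m \<subseteq> points" for i j k l m
    using moves_correct[OF that(1)] that(2) by (intro quadric_equiv_step) (auto simp: A pt_points)
  have exponent_step: "toric_exponent (m + Poly_Mapping.single (pt i) 1 + Poly_Mapping.single (pt j) 1) =
      toric_exponent (m + Poly_Mapping.single (pt k) 1 + Poly_Mapping.single (pt l) 1)"
    if "(i, j, k, l) \<in> set moves" for i j k l m
    using moves_correct(6)[OF that] by (simp add: toric_exponent_add add.assoc)
  have weight_step: "weight (m + Poly_Mapping.single (pt i) 1 + Poly_Mapping.single (pt j) 1) >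
      weight (m + Poly_Mapping.single (pt k) 1 + Poly_Mapping.single (pt l) 1)"
    if "(i, j, k, l) \<in> set moves" for i j k l m
    using moves_correct[OF that] by (simp add: weight_add weight_single[unfolded One_nat_def])
  have keys_add3: "Poly_Mapping.keys (m + Poly_Mapping.single (pt k) 1 + Poly_Mapping.single (pt l) 1) \<subseteq> points"
    if "Poly_Mapping.keys m \<subseteq> points" "k < 15" "l < 15" for m :: "(nat \<Rightarrow>\<^sub>0 int) \<Rightarrow>\<^sub>0 nat" and k l
    using that by (intro keys_add_subset) (auto simp: pt_points)
  have reduce: "\<exists>m'. Poly_Mapping.keys m' \<subseteq> points \<and> toric_exponent m' = toric_exponent m \<and> quadric_equiv m m' \<and> standard m'"
    if "Poly_Mapping.keys m \<subseteq> points" for m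
    using that
  proof (induction "weight m" arbitrary: m rule: less_induct)
    case less
    have continue: ?case
      if m1: "Poly_Mapping.keys m1 \<subseteq> points" "toric_exponent m = toric_exponent m1" "quadric_equiv m m1" "weight m1 < weight m" for m1
    proof -
      obtain m' where "Poly_Mapping.keys m' \<subseteq> points" "toric_exponent m' = toric_exponent m1" "quadric_equiv m1 m'" "standard m'"
        using less.hyps[OF m1(4,1)] by blast
      then show ?thesis
        using m1(2) quadric_equiv_trans[OF m1(3)] by (intro exI[of _ m']) simp
    qed
    show ?case
    proof (cases "standard m")
      case True
      then show ?thesis
        using less.prems quadric_equiv_refl by blast
    next
      case False
      then consider i j k l where "(i, j, k, l) \<in> set moves" "Poly_Mapping.lookup m (pt i) \<noteq> 0" "Poly_Mapping.lookup m (pt j) \<noteq> 0"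
        | "Poly_Mapping.lookup m (pt 4) \<noteq> 0" "Poly_Mapping.lookup m (pt 6) \<noteq> 0" "Poly_Mapping.lookup m (pt 8) \<noteq> 0"
        unfolding standard_def by auto
      then show ?thesis
      proof cases
        case 1
        note props = moves_correct[OF 1(1)]
        obtain m1 where m1: "m = m1 + Poly_Mapping.single (pt j) 1" "Poly_Mapping.keys m1 \<subseteq> Poly_Mapping.keys m"
          "\<forall>b. b \<noteq> pt j \<longrightarrow> Poly_Mapping.lookup m1 b = Poly_Mapping.lookup m b"
          by (rule split_monomial[OF 1(3)])
        have "Poly_Mapping.lookup m1 (pt i) \<noteq> 0"
          using m1(3) pt_neq[OF props(1,2,5)] 1(2) by simp
        then obtain m2 where m2: "m1 = m2 + Poly_Mapping.single (pt i) 1" "Poly_Mapping.keys m2 \<subseteq> Poly_Mapping.keys m1"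
          "\<forall>b. b \<noteq> pt i \<longrightarrow> Poly_Mapping.lookup m2 b = Poly_Mapping.lookup m1 b"
          by (rule split_monomial)
        have m: "m = m2 + Poly_Mapping.single (pt i) 1 + Poly_Mapping.single (pt j) 1" and k: "Poly_Mapping.keys m2 \<subseteq> points"
          using m1 m2 less.prems by auto
        show ?thesis
        proof (rule continue)
          show "Poly_Mapping.keys (m2 + Poly_Mapping.single (pt k) 1 + Poly_Mapping.single (pt l) 1) \<subseteq> points"
            by (rule keys_add3[OF k props(3,4)])
          show "toric_exponent m = toric_exponent (m2 + Poly_Mapping.single (pt k) 1 + Poly_Mapping.single (pt l) 1)"
            unfolding m by (rule exponent_step[OF 1(1)])
          show "quadric_equiv m (m2 + Poly_Mapping.single (pt k) 1 + Poly_Mapping.single (pt l) 1)"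
            unfolding m by (rule step[OF 1(1) k])
          show "weight (m2 + Poly_Mapping.single (pt k) 1 + Poly_Mapping.single (pt l) 1) < weight m"
            unfolding m by (rule weight_step[OF 1(1)])
        qed
      next
        case 2
        obtain m1 where m1: "m = m1 + Poly_Mapping.single (pt 8) 1" "Poly_Mapping.keys m1 \<subseteq> Poly_Mapping.keys m"
          "\<forall>b. b \<noteq> pt 8 \<longrightarrow> Poly_Mapping.lookup m1 b = Poly_Mapping.lookup m b"
          by (rule split_monomial[OF 2(3)])
        have "Poly_Mapping.lookup m1 (pt 6) \<noteq> 0" "Poly_Mapping.lookup m1 (pt 4) \<noteq> 0"
          using m1(3) pt_neq[of 6 8] pt_neq[of 4 8] 2 by auto
        obtain m2 where m2: "m1 = m2 + Poly_Mapping.single (pt 6) 1" "Poly_Mapping.keys m2 \<subseteq> Poly_Mapping.keys m1"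
          "\<forall>b. b \<noteq> pt 6 \<longrightarrow> Poly_Mapping.lookup m2 b = Poly_Mapping.lookup m1 b"
          by (rule split_monomial[OF \<open>Poly_Mapping.lookup m1 (pt 6) \<noteq> 0\<close>])
        have "Poly_Mapping.lookup m2 (pt 4) \<noteq> 0"
          using m2(3) pt_neq[of 4 6] \<open>Poly_Mapping.lookup m1 (pt 4) \<noteq> 0\<close> by auto
        then obtain m3 where m3: "m2 = m3 + Poly_Mapping.single (pt 4) 1" "Poly_Mapping.keys m3 \<subseteq> Poly_Mapping.keys m2"
          "\<forall>b. b \<noteq> pt 4 \<longrightarrow> Poly_Mapping.lookup m3 b = Poly_Mapping.lookup m2 b"
          by (rule split_monomial)
        let ?x = "\<lambda>i. Poly_Mapping.single (pt i) (1::nat)"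
        have k: "Poly_Mapping.keys m3 \<subseteq> points" using m1 m2 m3 less.prems by auto
        have k8: "Poly_Mapping.keys (m3 + ?x 8) \<subseteq> points" and k3: "Poly_Mapping.keys (m3 + ?x 3) \<subseteq> points"
          using k by (intro keys_add_subset; simp add: pt_points)+
        have m: "m = m3 + ?x 8 + ?x 4 + ?x 6"
          using m1 m2 m3 by (simp add: ac_simps)
        have r: "(3, 7, 4, 6) \<in> set moves" "(7, 8, 1, 11) \<in> set moves"
          by (simp_all add: moves_def)
        have swap: "m3 + ?x 8 + ?x 3 + ?x 7 = m3 + ?x 3 + ?x 7 + ?x 8"
          by (simp only: ac_simps)
        show ?thesis
        proof (rule continue)
          show "Poly_Mapping.keys (m3 + ?x 3 + ?x 1 + ?x 11) \<subseteq> points"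
            by (rule keys_add3[OF k3]) simp_all
          show "toric_exponent m = toric_exponent (m3 + ?x 3 + ?x 1 + ?x 11)"
            using exponent_step[OF r(1), of "m3 + ?x 8"] exponent_step[OF r(2), of "m3 + ?x 3"]
            by (simp only: m swap)
          show "quadric_equiv m (m3 + ?x 3 + ?x 1 + ?x 11)"
            using quadric_equiv_trans[OF quadric_equiv_sym[OF step[OF r(1) k8]] step[OF r(2) k3, folded swap]]
            by (simp only: m)
          show "weight (m3 + ?x 3 + ?x 1 + ?x 11) < weight m"
            by (simp add: m weight_add weight_single[unfolded One_nat_def]) (simp add: weights_def)
        qed
      qed
    qed
  qed
  show ?thesis
  proof (rule generated_by_quadricsI)
    fix m m' :: "(nat \<Rightarrow>\<^sub>0 int) \<Rightarrow>\<^sub>0 nat"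
    assume "Poly_Mapping.keys m \<subseteq> A" "Poly_Mapping.keys m' \<subseteq> A" and eq: "toric_exponent m = toric_exponent m'"
    then obtain n n' where n: "Poly_Mapping.keys n \<subseteq> points" "toric_exponent n = toric_exponent m" "quadric_equiv m n" "standard n"
      and n': "Poly_Mapping.keys n' \<subseteq> points" "toric_exponent n' = toric_exponent m'" "quadric_equiv m' n'" "standard n'"
      using reduce[of m] reduce[of m'] unfolding A by blast
    have "n = n'"
      using n n' eq by (intro standard_unique) auto
    then show "quadric_equiv m m'"
      using n(3) quadric_equiv_sym[OF n'(3)] quadric_equiv_trans by blast
  qed
qed

section \<open>The toric ring is not Koszul\<close>

text \<open>
  The functions \<open>T\<close> and \<open>B\<close> of the criterion, indexed by vertices. The class of the cocycle generates the
  first cohomology of the interval; this representative has few nonzero values.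
\<close>

definition cocycle :: "nat \<Rightarrow> nat \<Rightarrow> int" where
  "cocycle i j = (if (i, j) \<in> set [(0, 6), (5, 8), (8, 5), (11, 6)] then 1
     else if (i, j) \<in> set [(5, 11), (8, 11)] then -1 else 0)"

definition cocycle_long :: "nat \<Rightarrow> nat \<Rightarrow> int" where
  "cocycle_long i j = (if (i, j) \<in> set [(0, 6), (11, 5), (11, 6), (11, 8)] then 1
     else if (i, j) \<in> set [(5, 11), (6, 0), (6, 11), (8, 11)] then -1 else 0)"

text \<open>
  The coordinates read as decimal digits. Sums of four vertices have digits at most 4, so an equation
  between such sums becomes an equation between integers, suited for enumeration.
\<close>

definition decimal_code :: "(nat \<Rightarrow>\<^sub>0 int) \<Rightarrow> int" where
  "decimal_code p = (\<Sum>c<5. Poly_Mapping.lookup p c * 10 ^ (4 - c))"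

definition coded_points :: "(nat \<times> int) list" where
  "coded_points = [(0, 11), (1, 110), (2, 111), (3, 1000), (4, 1010), (5, 1011), (6, 1100), (7, 1110),
     (8, 10000), (9, 10010), (10, 10110), (11, 11000), (12, 11001), (13, 11010), (14, 11011)]"

lemma decimal_code_pt: "i < 15 \<Longrightarrow> (i, decimal_code (pt i)) \<in> set coded_points"
proof -
  have "\<forall>i<15. (i, \<Sum>c<5. vertices ! i ! c * 10 ^ (4 - c)) \<in> set coded_points"
    unfolding all_lessThan_15 sum_lessThan_5 by code_simp
  then show "i < 15 \<Longrightarrow> (i, decimal_code (pt i)) \<in> set coded_points"
    by (simp add: decimal_code_def lookup_pt)
qed

text \<open>
  All ways to write \<open>\<Lambda>\<close>, whose code is 23111, as an ordered sum of four vertices are enumerated by running over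
  three summands and comparing the fourth with the difference.
\<close>

lemma cocycle_check:
  "list_all (\<lambda>(i, a). list_all (\<lambda>(l, d). list_all (\<lambda>(j, b).
     let s = 23111 - a - d - b in list_all (\<lambda>(k, c).
       if c = s then cocycle k l - cocycle j i = cocycle_long i l else True)
     coded_points) coded_points) coded_points) coded_points"
  by code_simp

lemma cocycle_condition:
  assumes "i < 15" "j < 15" "k < 15" "l < 15" "pt i + pt j + pt k + pt l = pt 11 + pt 11 + pt 0 + pt 6"
  shows "cocycle k l - cocycle j i = cocycle_long i l"
proof -
  have decimal_code_add: "decimal_code (p + q) = decimal_code p + decimal_code q" for p q
    by (simp add: decimal_code_def lookup_add distrib_right sum.distrib)
  have "decimal_code (pt i) + decimal_code (pt j) + decimal_code (pt k) + decimal_code (pt l) = decimal_code (pt 11 + pt 11 + pt 0 + pt 6)"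
    by (simp only: assms(5)[symmetric] decimal_code_add)
  also have "\<dots> = 23111"
    unfolding decimal_code_add by (simp add: decimal_code_def lookup_pt sum_lessThan_5 vertices_def)
  finally have "decimal_code (pt k) = 23111 - decimal_code (pt i) - decimal_code (pt l) - decimal_code (pt j)"
    by simp
  with bspec[OF bspec[OF bspec[OF bspec[OF cocycle_check[unfolded list_all_iff Let_def]
      decimal_code_pt[OF assms(1)], unfolded prod.case] decimal_code_pt[OF assms(4)], unfolded prod.case]
      decimal_code_pt[OF assms(2)], unfolded prod.case] decimal_code_pt[OF assms(3)], unfolded prod.case]
  show ?thesis by simp
qed

lemma pt_sums:
  "pt 0 + pt 6 = pt 2 + pt 3" "pt 9 + pt 6 = pt 10 + pt 3"
  "pt 3 + pt 12 + pt 9 + pt 6 = pt 11 + pt 11 + pt 0 + pt 6"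
proof -
  have "\<forall>c\<in>set [0..<5]. vertices ! 0 ! c + vertices ! 6 ! c = vertices ! 2 ! c + vertices ! 3 ! c"
    "\<forall>c\<in>set [0..<5]. vertices ! 9 ! c + vertices ! 6 ! c = vertices ! 10 ! c + vertices ! 3 ! c"
    "\<forall>c\<in>set [0..<5]. vertices ! 3 ! c + vertices ! 12 ! c + vertices ! 9 ! c + vertices ! 6 ! c =
      vertices ! 11 ! c + vertices ! 11 ! c + vertices ! 0 ! c + vertices ! 6 ! c"
    by code_simp+
  then show "pt 0 + pt 6 = pt 2 + pt 3" "pt 9 + pt 6 = pt 10 + pt 3"
    "pt 3 + pt 12 + pt 9 + pt 6 = pt 11 + pt 11 + pt 0 + pt 6"
    by (rule_tac [!] poly_mapping_eqI) (simp_all only: lookup_add lookup_pt, simp_all)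
qed

text \<open>
  The closed path uses \<open>\<Lambda> = 11 + 11 + 0 + 6\<close> in terms of positions, with \<open>0 + 6 = 2 + 3\<close> and \<open>9 + 6 = 10 + 3\<close>. Of the
  four values of the cocycle on it only the one at \<open>(0, 6)\<close> is nonzero, and it equals 1.
\<close>

lemma not_koszul_example:
  fixes K :: "'k::field itself"
  shows "\<not> koszul (toric_ring K 5 example_polytope) (toric_grading K 5 example_polytope)"
proof -
  interpret toric K 5 example_polytope
    by (rule toric_example)
  define ix where "ix = the_inv_into {..<15} pt"
  have ix: "ix (pt i) = i" if "i < 15" for i
    using that the_inv_into_f_f[OF inj_pt] by (simp add: ix_def)
  have A: "a \<in> A \<longleftrightarrow> (\<exists>i<15. a = pt i)" for a
    by (auto simp: lattice_points_example points_def)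
  show ?thesis
  proof (rule not_koszul_criterion[where b = "pt 6" and b' = "pt 3"
        and ?a1.0 = "pt 0" and ?a1' = "pt 2" and ?r1.0 = "pt 11" and ?s1.0 = "pt 11"
        and ?a2.0 = "pt 9" and ?a2' = "pt 10" and ?r2.0 = "pt 3" and ?s2.0 = "pt 12"])
    fix x y p q assume "x \<in> A" "y \<in> A" "p \<in> A" "q \<in> A" and sum: "x + y + p + q = pt 11 + pt 11 + pt 0 + pt 6"
    then obtain i j k l where [simp]: "i < 15" "j < 15" "k < 15" "l < 15" and
      [simp]: "x = pt i" "y = pt j" "p = pt k" "q = pt l"
      unfolding A by blast
    have "of_int (cocycle k l - cocycle j i) = (of_int (cocycle_long i l) :: 'k)"
      using cocycle_condition[of i j k l] sum by simp
    then show "of_int (cocycle (ix p) (ix q)) - of_int (cocycle (ix y) (ix x)) = (of_int (cocycle_long (ix x) (ix q)) :: 'k)"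
      by (simp add: ix)
  next
    show "pt 11 + pt 11 + pt 0 + pt 6 = pt 11 + pt 11 + pt 0 + pt 6" by (rule refl)
    show "pt 0 + pt 6 = pt 2 + pt 3" "pt 9 + pt 6 = pt 10 + pt 3"
      "pt 3 + pt 12 + pt 9 + pt 6 = pt 11 + pt 11 + pt 0 + pt 6"
      by (fact pt_sums)+
    show "of_int (cocycle (ix (pt 0)) (ix (pt 6))) - of_int (cocycle (ix (pt 2)) (ix (pt 3))) \<noteq>
        (of_int (cocycle (ix (pt 9)) (ix (pt 6))) - of_int (cocycle (ix (pt 10)) (ix (pt 3))) :: 'k)"
      by (simp add: ix cocycle_def)
  qed (simp_all add: lattice_points_example pt_points)
qed

theorem proposition1p5:
  fixes K :: "'k::field itself"
  shows "\<exists>d P. zero_one_polytope d P \<and>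
           (\<exists>\<Delta>. lattice_triangulation d P \<Delta> \<and> flag \<Delta> \<and> unimodular d \<Delta>) \<and>
           generated_by_quadrics K (lattice_points d P) (toric_ideal K d P) \<and>
           \<not> koszul (toric_ring K d P) (toric_grading K d P)"
proof (intro exI conjI)
  show "zero_one_polytope 5 example_polytope"
    unfolding zero_one_polytope_def example_polytope_def using points_zero_one by blast
qed (rule triangulates flag_triangulation unimodular_triangulation generated_by_quadrics_example not_koszul_example)+

end
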